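(* Let $\Gamma$ be a connected finite acyclic quiver over a ground field $\mathbf{k}$ of characteristic $0$. Let $\mathfrak{c}_1,\dots,\mathfrak{c}_{\gamma_2}$ be the primitive cycles of $\Gamma$ ($\gamma_2=|F|$), let $\mathfrak{B}_F^-=\{D_{\mathfrak{c}_i}\mid 2\le i\le\gamma_2\}$ and $\mathfrak{B}_{AL}=\{D_{p,r}\mid(p,r)\in\Gamma_{AL}\}$, and let $\mathfrak{B}^*$ be any basis of $\mathfrak{D}_E/(\mathfrak{D}_V\oplus\mathfrak{D}_F)$ (represented by elements of $\mathfrak{D}_E$). Then the disjoint union $$\mathfrak{B}_{AL}\sqcup\mathfrak{B}_F^-\sqcup\mathfrak{B}^*$$ forms (via cosets modulo inner derivations) a basis of $HH^1(\mathbf{k}\Gamma)$.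
   Context: A quiver $\Gamma=(V,E,t,h)$ consists of a set $V$ of vertices, a set $E$ of arrows and maps $t,h:E\to V$ (tail and head). It is acyclic if it has no oriented cycles, and connected if its underlying graph is connected. A path of length $\ell\ge0$ is $p=v_0p_1v_1\cdots p_\ell v_\ell$ with $p_j\in E$, $t(p_j)=v_{j-1}$, $h(p_j)=v_j$; $t(p)=v_0$, $h(p)=v_\ell$; vertices are the paths of length $0$; $\mathcal{P}$ is the set of paths. The path algebra $\mathbf{k}\Gamma$ has basis $\mathcal{P}$, with product of $p,q$ the concatenation $pq$ if $h(p)=t(q)$ and $0$ otherwise. $p\parallel q$ means $t(p)=t(q)$ and $h(p)=h(q)$. $HH^1(\mathbf{k}\Gamma)=\mathrm{Der}(\mathbf{k}\Gamma)/\mathrm{InDer}(\mathbf{k}\Gamma)$, derivations modulo inner derivations $D_a(b)=ab-ba$. For $r\in E$, $s\in\mathcal{P}$, $s\parallel r$, $D_{r,s}$ is the derivation of $\mathbf{k}\Gamma$ with $D_{r,s}(v)=0$ for $v\in V$, $D_{r,s}(r)=s$ and $D_{r,s}(q)=0$ for $q\in E$, $q\ne r$. $\Gamma_{AL}$ is the set of almost oriented cycles: pairs $(p,r)$ with $p\in E$, $r\in\mathcal{P}$, $r\neq p$, $r\parallel p$. Quivers come with a fixed embedding of the underlying graph into a closed connected oriented surface $S$ of genus $g$, with $g$ smallest possible. The set $F$ of faces is the set of connected components of $S\setminus\Gamma$. For $f\in F$, its boundary $\mathfrak{c}_f$ is called a primitive cycle. The face derivation $D_{\mathfrak{c}}$,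 $\mathfrak{c}=\mathfrak{c}_f$, is the derivation of $\mathbf{k}\Gamma$ with $D_{\mathfrak{c}}(v)=0$ for $v\in V$ and, for $p\in E$, $D_{\mathfrak{c}}(p)=p$ if $p$ is clockwise on $\mathfrak{c}$, $-p$ if $p$ is counterclockwise on $\mathfrak{c}$, and $0$ if $p$ is not on $\mathfrak{c}$; clockwise is as viewed from inside $f$ (i.e. $f$ lies on the right of $p$). If both sides of $p$ lie in $f$, then $p$ occurs once in each direction, the contributions cancel, and $D_{\mathfrak{c}}(p)=0$. $\mathfrak{D}_V$, $\mathfrak{D}_E$, $\mathfrak{D}_F$ are the $\mathbf{k}$-linear spans of $\{D_v\mid v\in V\}$, $\{D_{p,p}\mid p\in E\}$, $\{D_{\mathfrak{c}_f}\mid f\in F\}$; $\mathfrak{D}_V$ and $\mathfrak{D}_F$ are contained in $\mathfrak{D}_E$ and $\mathfrak{D}_V\cap\mathfrak{D}_F=0$ in characteristic $0$. *)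

theory Defs
  imports
    "Graph_Theory.Digraph_Component"
    "HOL-Library.Poly_Mapping"
    "HOL-Library.Function_Algebras"
    "HOL-Complex_Analysis.Complex_Analysis"
begin

section \<open>Bases of quotient spaces\<close>

definition coset :: "'a::ab_group_add set \<Rightarrow> 'a \<Rightarrow> 'a set" where
  "coset U w = {x. x - w \<in> U}"

definition quotient_space :: "'a::ab_group_add set \<Rightarrow> 'a set \<Rightarrow> 'a set set" where
  "quotient_space W U = coset U ` W"

text \<open>
  For subspaces \<open>U\<close> and \<open>W\<close> of a vector space with scalar multiplication \<open>scl\<close>: the vectors
  \<open>b i\<close> of \<open>W\<close> represent a basis of the quotient of \<open>W\<close> by \<open>U\<close>, that is, their cosets are
  linearly independent and span. The vector space operations on cosets are those of
  representatives. Being a family, \<open>b\<close> has no repeated cosets; for a set \<open>B\<close> of representatives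
  take \<open>I = B\<close> and \<open>b = id\<close>.
\<close>

definition quotient_basis ::
  "('k::field \<Rightarrow> 'a::ab_group_add \<Rightarrow> 'a) \<Rightarrow> 'a set \<Rightarrow> 'a set \<Rightarrow> 'i set \<Rightarrow> ('i \<Rightarrow> 'a) \<Rightarrow> bool" where
  "quotient_basis scl W U I b \<longleftrightarrow>
     (\<forall>i\<in>I. b i \<in> W) \<and>
     (\<forall>J c. finite J \<and> J \<subseteq> I \<and> coset U (\<Sum>i\<in>J. scl (c i) (b i)) = coset U 0
        \<longrightarrow> (\<forall>i\<in>J. c i = 0)) \<and>
     (\<forall>C \<in> quotient_space W U. \<exists>J c. finite J \<and> J \<subseteq> I \<and> C = coset U (\<Sum>i\<in>J. scl (c i) (b i)))"


section \<open>Path algebras of quivers\<close>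

text \<open>
  A quiver is a \<open>pre_digraph\<close> (parallel arrows are allowed). The path
  \<open>v\<^sub>0 p\<^sub>1 v\<^sub>1 \<dots> p\<^sub>l v\<^sub>l\<close> is represented as \<open>(v\<^sub>0, [p\<^sub>1, \<dots>, p\<^sub>l])\<close>.
\<close>

definition acyclic_quiver :: "('v, 'e) pre_digraph \<Rightarrow> bool" where
  "acyclic_quiver G \<longleftrightarrow> (\<nexists>p. pre_digraph.cycle G p)"

type_synonym ('v, 'e) path = "'v \<times> 'e list"

definition paths :: "('v, 'e) pre_digraph \<Rightarrow> ('v, 'e) path set" where
  "paths G = {(u, p). \<exists>v. pre_digraph.awalk G u p v}"

definition ptail :: "('v, 'e) path \<Rightarrow> 'v" where
  "ptail p = fst p"

definition phead :: "('v, 'e) pre_digraph \<Rightarrow> ('v, 'e) path \<Rightarrow> 'v" where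
  "phead G p = pre_digraph.awlast G (fst p) (snd p)"

definition parallel :: "('v, 'e) pre_digraph \<Rightarrow> ('v, 'e) path \<Rightarrow> ('v, 'e) path \<Rightarrow> bool" where
  "parallel G p q \<longleftrightarrow> ptail p = ptail q \<and> phead G p = phead G q"

definition vertex_path :: "'v \<Rightarrow> ('v, 'e) path" where
  "vertex_path v = (v, [])"

definition arrow_path :: "('v, 'e) pre_digraph \<Rightarrow> 'e \<Rightarrow> ('v, 'e) path" where
  "arrow_path G e = (tail G e, [e])"

definition concat_path :: "('v, 'e) path \<Rightarrow> ('v, 'e) path \<Rightarrow> ('v, 'e) path" where
  "concat_path p q = (fst p, snd p @ snd q)"

text \<open>
  Elements of the path algebra are finitely supported functions on paths. The
  multiplication that \<open>Poly_Mapping\<close> puts on this type is not used.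
\<close>

type_synonym ('v, 'e, 'k) pelem = "('v, 'e) path \<Rightarrow>\<^sub>0 'k"

definition path_algebra :: "('v, 'e) pre_digraph \<Rightarrow> ('v, 'e, 'k::field) pelem set" where
  "path_algebra G = {x. Poly_Mapping.keys x \<subseteq> paths G}"

definition basis_elem :: "('v, 'e) path \<Rightarrow> ('v, 'e, 'k::field) pelem" where
  "basis_elem p = Poly_Mapping.single p 1"

definition pscale :: "'k::field \<Rightarrow> ('v, 'e, 'k) pelem \<Rightarrow> ('v, 'e, 'k) pelem" where
  "pscale c x = Poly_Mapping.map ((*) c) x"

definition pmult ::
  "('v, 'e) pre_digraph \<Rightarrow> ('v, 'e, 'k::field) pelem \<Rightarrow> ('v, 'e, 'k) pelem \<Rightarrow> ('v, 'e, 'k) pelem" where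
  "pmult G x y =
     (\<Sum>p\<in>Poly_Mapping.keys x. \<Sum>q\<in>Poly_Mapping.keys y.
        if phead G p = ptail q
        then Poly_Mapping.single (concat_path p q) (Poly_Mapping.lookup x p * Poly_Mapping.lookup y q)
        else 0)"


section \<open>Derivations and the first Hochschild cohomology\<close>

text \<open>
  Maps on the path algebra are total functions that vanish outside its carrier, so that
  equality of maps is equality on the carrier. They are added pointwise
  (\<open>HOL-Library.Function_Algebras\<close>).
\<close>

type_synonym ('v, 'e, 'k) pmap = "('v, 'e, 'k) pelem \<Rightarrow> ('v, 'e, 'k) pelem"

definition map_scale :: "'k::field \<Rightarrow> ('v, 'e, 'k) pmap \<Rightarrow> ('v, 'e, 'k) pmap" where
  "map_scale c D = (\<lambda>x. pscale c (D x))"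

lemma lookup_pscale: "Poly_Mapping.lookup (pscale c x) p = c * Poly_Mapping.lookup x p"
  by (simp add: pscale_def Poly_Mapping.map.rep_eq when_def)

lemma vector_space_map_scale:
  "vector_space (map_scale :: 'k::field \<Rightarrow> ('v, 'e, 'k) pmap \<Rightarrow> ('v, 'e, 'k) pmap)"
  by unfold_locales
    (auto intro!: ext poly_mapping_eqI
      simp: map_scale_def lookup_pscale lookup_add algebra_simps)

definition Der :: "('v, 'e) pre_digraph \<Rightarrow> ('v, 'e, 'k::field) pmap set" where
  "Der G = {D.
     (\<forall>x. x \<notin> path_algebra G \<longrightarrow> D x = 0) \<and>
     (\<forall>x\<in>path_algebra G. D x \<in> path_algebra G) \<and>
     (\<forall>x\<in>path_algebra G. \<forall>y\<in>path_algebra G. D (x + y) = D x + D y) \<and>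
     (\<forall>c. \<forall>x\<in>path_algebra G. D (pscale c x) = pscale c (D x)) \<and>
     (\<forall>x\<in>path_algebra G. \<forall>y\<in>path_algebra G. D (pmult G x y) = pmult G (D x) y + pmult G x (D y))}"

definition inner_der :: "('v, 'e) pre_digraph \<Rightarrow> ('v, 'e, 'k::field) pelem \<Rightarrow> ('v, 'e, 'k) pmap" where
  "inner_der G a = (\<lambda>b. if b \<in> path_algebra G then pmult G a b - pmult G b a else 0)"

definition InDer :: "('v, 'e) pre_digraph \<Rightarrow> ('v, 'e, 'k::field) pmap set" where
  "InDer G = inner_der G ` path_algebra G"

definition HH1_basis :: "('v, 'e) pre_digraph \<Rightarrow> 'i set \<Rightarrow> ('i \<Rightarrow> ('v, 'e, 'k::field) pmap) \<Rightarrow> bool" where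
  "HH1_basis G I b \<longleftrightarrow> quotient_basis map_scale (Der G) (InDer G) I b"

definition arrow_der :: "('v, 'e) pre_digraph \<Rightarrow> ('e \<Rightarrow> ('v, 'e, 'k::field) pelem) \<Rightarrow> ('v, 'e, 'k) pmap" where
  "arrow_der G \<delta> = (THE D. D \<in> Der G \<and>
     (\<forall>v\<in>verts G. D (basis_elem (vertex_path v)) = 0) \<and>
     (\<forall>q\<in>arcs G. D (basis_elem (arrow_path G q)) = \<delta> q))"

definition D_vertex :: "('v, 'e) pre_digraph \<Rightarrow> 'v \<Rightarrow> ('v, 'e, 'k::field) pmap" where
  "D_vertex G v = inner_der G (basis_elem (vertex_path v))"

definition D_arrow :: "('v, 'e) pre_digraph \<Rightarrow> 'e \<Rightarrow> ('v, 'e) path \<Rightarrow> ('v, 'e, 'k::field) pmap" where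
  "D_arrow G r s = arrow_der G (\<lambda>q. if q = r then basis_elem s else 0)"

definition almost_oriented_cycles :: "('v, 'e) pre_digraph \<Rightarrow> ('e \<times> ('v, 'e) path) set" where
  "almost_oriented_cycles G =
     {(p, r). p \<in> arcs G \<and> r \<in> paths G \<and> r \<noteq> arrow_path G p \<and> parallel G r (arrow_path G p)}"


section \<open>Closed oriented surfaces\<close>

text \<open>A chart is a pair of an open set and a map, whose values outside that set are irrelevant.\<close>

definition surface_chart :: "'s topology \<Rightarrow> 's set \<times> ('s \<Rightarrow> complex) \<Rightarrow> bool" where
  "surface_chart X c \<longleftrightarrow> (case c of (U, \<phi>) \<Rightarrow>
     openin X U \<and> open (\<phi> ` U) \<and>
     homeomorphic_map (subtopology X U) (top_of_set (\<phi> ` U)) \<phi>)"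

text \<open>For a homeomorphism \<open>h\<close> between open subsets of the plane, with domain \<open>W\<close>: local degree 1.\<close>

definition orientation_preserving :: "complex set \<Rightarrow> (complex \<Rightarrow> complex) \<Rightarrow> bool" where
  "orientation_preserving W h \<longleftrightarrow>
     (\<forall>z r. 0 < r \<and> cball z r \<subseteq> W \<longrightarrow> winding_number (h \<circ> circlepath z r) (h z) = 1)"

definition compatible_charts :: "'s set \<times> ('s \<Rightarrow> complex) \<Rightarrow> 's set \<times> ('s \<Rightarrow> complex) \<Rightarrow> bool" where
  "compatible_charts c c' \<longleftrightarrow> (case (c, c') of ((U, \<phi>), (V, \<psi>)) \<Rightarrow>
     orientation_preserving (\<phi> ` (U \<inter> V)) (\<psi> \<circ> inv_into U \<phi>))"

text \<open>An orientation is a maximal oriented atlas.\<close>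

definition surface_orientation :: "'s topology \<Rightarrow> ('s set \<times> ('s \<Rightarrow> complex)) set \<Rightarrow> bool" where
  "surface_orientation X A \<longleftrightarrow>
     (\<forall>c\<in>A. surface_chart X c) \<and>
     (\<Union>c\<in>A. fst c) = topspace X \<and>
     (\<forall>c\<in>A. \<forall>c'\<in>A. compatible_charts c c') \<and>
     (\<forall>c. surface_chart X c \<and> (\<forall>c'\<in>A. compatible_charts c c' \<and> compatible_charts c' c) \<longrightarrow> c \<in> A)"

definition closed_oriented_surface :: "'s topology \<Rightarrow> ('s set \<times> ('s \<Rightarrow> complex)) set \<Rightarrow> bool" where
  "closed_oriented_surface X A \<longleftrightarrow>
     topspace X \<noteq> {} \<and> connected_space X \<and> compact_space X \<and> Hausdorff_space X \<and>
     surface_orientation X A"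

text \<open>
  The genus is the largest number of pairwise disjoint simple closed curves whose union does
  not separate the surface.
\<close>

definition nonseparating_curves :: "'s topology \<Rightarrow> 's set set \<Rightarrow> bool" where
  "nonseparating_curves X \<C> \<longleftrightarrow>
     finite \<C> \<and> disjoint \<C> \<and>
     (\<forall>C\<in>\<C>. C \<subseteq> topspace X \<and> subtopology X C homeomorphic_space top_of_set (sphere (0::complex) 1)) \<and>
     connected_space (subtopology X (topspace X - \<Union>\<C>))"

definition has_genus :: "'s topology \<Rightarrow> nat \<Rightarrow> bool" where
  "has_genus X g \<longleftrightarrow>
     (\<exists>\<C>. nonseparating_curves X \<C> \<and> card \<C> = g) \<and>
     (\<forall>\<C>. nonseparating_curves X \<C> \<longrightarrow> card \<C> \<le> g)"


section \<open>Embedded quivers\<close>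

text \<open>
  An embedding consists of the positions \<open>pos\<close> of the vertices and parametrised curves \<open>cur e\<close>,
  running from the tail to the head of \<open>e\<close>.
\<close>

definition drawing :: "('v, 'e) pre_digraph \<Rightarrow> ('v \<Rightarrow> 's) \<Rightarrow> ('e \<Rightarrow> real \<Rightarrow> 's) \<Rightarrow> 's set" where
  "drawing G pos cur = pos ` verts G \<union> (\<Union>e\<in>arcs G. cur e ` {0..1})"

definition graph_embedding ::
  "('v, 'e) pre_digraph \<Rightarrow> 's topology \<Rightarrow> ('v \<Rightarrow> 's) \<Rightarrow> ('e \<Rightarrow> real \<Rightarrow> 's) \<Rightarrow> bool" where
  "graph_embedding G X pos cur \<longleftrightarrow>
     inj_on pos (verts G) \<and> pos ` verts G \<subseteq> topspace X \<and>
     (\<forall>e\<in>arcs G. pathin X (cur e) \<and> cur e 0 = pos (tail G e) \<and> cur e 1 = pos (head G e) \<and>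
        inj_on (cur e) {0<..<1} \<and> cur e ` {0<..<1} \<inter> pos ` verts G = {}) \<and>
     (\<forall>e\<in>arcs G. \<forall>e'\<in>arcs G. e \<noteq> e' \<longrightarrow> cur e ` {0<..<1} \<inter> cur e' ` {0<..<1} = {})"

definition genus_minimal ::
  "('v, 'e) pre_digraph \<Rightarrow> 's topology \<Rightarrow> bool" where
  "genus_minimal G X \<longleftrightarrow> (\<exists>g. has_genus X g \<and>
     (\<forall>(X' :: 's topology) A' pos' cur' g'.
        closed_oriented_surface X' A' \<and> graph_embedding G X' pos' cur' \<and> has_genus X' g' \<longrightarrow> g \<le> g'))"

text \<open>
  The type of points in \<^const>\<open>genus_minimal\<close> is no restriction: all closed surfaces have the
  same cardinality, so each of them occurs as a topology on \<open>'s\<close> as soon as one does.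

  Next, the local models of an embedding. Around an interior point of an arrow there is a
  positively oriented chart that straightens the arrow to the real diameter of the unit disc,
  traversed from left to right; the lower half disc is then on the right of the arrow.
\<close>

definition arrow_chart ::
  "('v, 'e) pre_digraph \<Rightarrow> ('s set \<times> ('s \<Rightarrow> complex)) set \<Rightarrow> ('v \<Rightarrow> 's) \<Rightarrow> ('e \<Rightarrow> real \<Rightarrow> 's)
     \<Rightarrow> 'e \<Rightarrow> real \<Rightarrow> 's set \<Rightarrow> ('s \<Rightarrow> complex) \<Rightarrow> bool" where
  "arrow_chart G A pos cur e s U \<phi> \<longleftrightarrow>
     (U, \<phi>) \<in> A \<and> cur e s \<in> U \<and> \<phi> (cur e s) = 0 \<and> \<phi> ` U = ball 0 1 \<and>
     drawing G pos cur \<inter> U \<subseteq> cur e ` {0<..<1} \<and>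
     \<phi> ` (drawing G pos cur \<inter> U) = {z \<in> ball 0 1. Im z = 0} \<and>
     (\<forall>s1 s2. 0 < s1 \<and> s1 < s2 \<and> s2 < 1 \<and> cur e s1 \<in> U \<and> cur e s2 \<in> U
        \<longrightarrow> Re (\<phi> (cur e s1)) < Re (\<phi> (cur e s2)))"

text \<open>
  Ends of arrows: \<open>(e, False)\<close> is the end of \<open>e\<close> at its tail and \<open>(e, True)\<close> the one at its
  head. Curves of ends leave the vertex. Around a vertex there is a chart in which the drawing
  consists of radii of the unit disc, one for each arrow end at the vertex.
\<close>

definition ends_at :: "('v, 'e) pre_digraph \<Rightarrow> 'v \<Rightarrow> ('e \<times> bool) set" where
  "ends_at G v = {(e, b). e \<in> arcs G \<and> (if b then head G e else tail G e) = v}"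

definition end_cur :: "('e \<Rightarrow> real \<Rightarrow> 's) \<Rightarrow> 'e \<times> bool \<Rightarrow> real \<Rightarrow> 's" where
  "end_cur cur d s = cur (fst d) (if snd d then 1 - s else s)"

definition vertex_chart ::
  "('v, 'e) pre_digraph \<Rightarrow> ('s set \<times> ('s \<Rightarrow> complex)) set \<Rightarrow> ('v \<Rightarrow> 's) \<Rightarrow> ('e \<Rightarrow> real \<Rightarrow> 's)
     \<Rightarrow> 'v \<Rightarrow> 's set \<Rightarrow> ('s \<Rightarrow> complex) \<Rightarrow> bool" where
  "vertex_chart G A pos cur v U \<phi> \<longleftrightarrow>
     (U, \<phi>) \<in> A \<and> pos v \<in> U \<and> \<phi> (pos v) = 0 \<and> \<phi> ` U = ball 0 1 \<and>
     (\<exists>dir len. inj_on dir (ends_at G v) \<and>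
        (\<forall>d\<in>ends_at G v. cmod (dir d) = 1 \<and> 0 < len d \<and> len d \<le> 1 \<and>
           end_cur cur d ` {0<..<len d} \<subseteq> U \<and>
           \<phi> ` end_cur cur d ` {0<..<len d} = {of_real r * dir d | r. 0 < r \<and> r < 1}) \<and>
        drawing G pos cur \<inter> U = insert (pos v) (\<Union>d\<in>ends_at G v. end_cur cur d ` {0<..<len d}))"

text \<open>
  The usual tameness of embedded graphs. By the Schoenflies theorem every
  \<^const>\<open>graph_embedding\<close> of a finite graph into an oriented surface has these charts.
\<close>

definition tame_embedding ::
  "('v, 'e) pre_digraph \<Rightarrow> 's topology \<Rightarrow> ('s set \<times> ('s \<Rightarrow> complex)) set
     \<Rightarrow> ('v \<Rightarrow> 's) \<Rightarrow> ('e \<Rightarrow> real \<Rightarrow> 's) \<Rightarrow> bool" where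
  "tame_embedding G X A pos cur \<longleftrightarrow>
     graph_embedding G X pos cur \<and>
     (\<forall>e\<in>arcs G. \<forall>s\<in>{0<..<1}. \<exists>U \<phi>. arrow_chart G A pos cur e s U \<phi>) \<and>
     (\<forall>v\<in>verts G. \<exists>U \<phi>. vertex_chart G A pos cur v U \<phi>)"

definition faces ::
  "('v, 'e) pre_digraph \<Rightarrow> 's topology \<Rightarrow> ('v \<Rightarrow> 's) \<Rightarrow> ('e \<Rightarrow> real \<Rightarrow> 's) \<Rightarrow> 's set set" where
  "faces G X pos cur = connected_components_of (subtopology X (topspace X - drawing G pos cur))"

definition on_right ::
  "('v, 'e) pre_digraph \<Rightarrow> ('s set \<times> ('s \<Rightarrow> complex)) set \<Rightarrow> ('v \<Rightarrow> 's) \<Rightarrow> ('e \<Rightarrow> real \<Rightarrow> 's)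
     \<Rightarrow> 's set \<Rightarrow> 'e \<Rightarrow> bool" where
  "on_right G A pos cur f e \<longleftrightarrow>
     (\<exists>s\<in>{0<..<1}. \<exists>U \<phi>. arrow_chart G A pos cur e s U \<phi> \<and> {x \<in> U. Im (\<phi> x) < 0} \<subseteq> f)"

definition on_left ::
  "('v, 'e) pre_digraph \<Rightarrow> ('s set \<times> ('s \<Rightarrow> complex)) set \<Rightarrow> ('v \<Rightarrow> 's) \<Rightarrow> ('e \<Rightarrow> real \<Rightarrow> 's)
     \<Rightarrow> 's set \<Rightarrow> 'e \<Rightarrow> bool" where
  "on_left G A pos cur f e \<longleftrightarrow>
     (\<exists>s\<in>{0<..<1}. \<exists>U \<phi>. arrow_chart G A pos cur e s U \<phi> \<and> {x \<in> U. Im (\<phi> x) > 0} \<subseteq> f)"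

text \<open>
  An arrow is clockwise on the boundary of \<open>f\<close> if \<open>f\<close> is on its right. If \<open>f\<close> is on
  both sides, the two contributions cancel.
\<close>

definition D_face ::
  "('v, 'e) pre_digraph \<Rightarrow> ('s set \<times> ('s \<Rightarrow> complex)) set \<Rightarrow> ('v \<Rightarrow> 's) \<Rightarrow> ('e \<Rightarrow> real \<Rightarrow> 's)
     \<Rightarrow> 's set \<Rightarrow> ('v, 'e, 'k::field) pmap" where
  "D_face G A pos cur f = arrow_der G (\<lambda>p.
     pscale (of_bool (on_right G A pos cur f p) - of_bool (on_left G A pos cur f p))
       (basis_elem (arrow_path G p)))"

definition span_V :: "('v, 'e) pre_digraph \<Rightarrow> ('v, 'e, 'k::field) pmap set" where
  "span_V G = module.span map_scale (D_vertex G ` verts G)"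

definition span_E :: "('v, 'e) pre_digraph \<Rightarrow> ('v, 'e, 'k::field) pmap set" where
  "span_E G = module.span map_scale ((\<lambda>p. D_arrow G p (arrow_path G p)) ` arcs G)"

definition span_F ::
  "('v, 'e) pre_digraph \<Rightarrow> 's topology \<Rightarrow> ('s set \<times> ('s \<Rightarrow> complex)) set
     \<Rightarrow> ('v \<Rightarrow> 's) \<Rightarrow> ('e \<Rightarrow> real \<Rightarrow> 's) \<Rightarrow> ('v, 'e, 'k::field) pmap set" where
  "span_F G X A pos cur = module.span map_scale (D_face G A pos cur ` faces G X pos cur)"

end

theory Submission
  imports Defs
begin

text \<open>
  Subtracting an inner derivation, every derivation may be assumed to kill the vertices. It then
  sends an arrow \<open>p\<close> to a combination of paths parallel to \<open>p\<close>. The coefficients at paths other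
  than \<open>p\<close> are the coordinates belonging to almost oriented cycles, and what remains is a diagonal
  derivation \<open>p \<mapsto> w p \<cdot> p\<close>. As there are no oriented cycles, an inner derivation killing the
  vertices is the diagonal derivation of a gradient \<open>w p = a (tail p) - a (head p)\<close>.

  A combination of face derivations is the diagonal derivation of
  \<open>w p = c (right face of p) - c (left face of p)\<close>. It vanishes only for constant \<open>c\<close>, because the
  surface is connected. Going once around a vertex shows that such a \<open>w\<close> is a conservative flow,
  hence orthogonal to all gradients; over an ordered field the two kinds of functions therefore
  meet only in 0, and an additive map to the rationals extends this to characteristic 0.

  That the sides of an arrow are well-defined follows from orientedness: a transition map that
  straightens the arrow to itself but does not preserve its sides has winding number
  \<open>0\<close> or \<open>-1\<close> on small circles, as a linear homotopy shows.
\<close>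

section \<open>Local degree in the plane: which side of a line goes where\<close>

section \<open>Transition maps along a line\<close>

text \<open>Everything about faces is therefore read off from the half discs beside single arrows,
  where a function \<open>c\<close> on faces shows up as its jump across each arrow. Connectedness
  of the surface and conservation at the vertices become statements about such jumps; they are local
  forms of the facts that a closed 0-cochain is constant and that a boundary has no boundary. The
  obstacle is that the walk around a vertex sees the sides of an arrow in a vertex chart, while
  \<open>on_left\<close> and \<open>on_right\<close> refer to arrow charts, and to arbitrary ones. A
  common notion of straightened arrow lets one comparison of charts settle both. Omitting one face
  works because \<open>c\<close> matters only up to a constant, and the constant can be chosen so
  that \<open>c\<close> vanishes on the omitted face.\<close>

lemma zero_notin_closed_segment_same_side:
  assumes "Im a > 0 \<and> Im b > 0 \<or> Im a < 0 \<and> Im b < 0 \<or> Im a = 0 \<and> Im b = 0 \<and> Re a * Re b > 0"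
  shows "0 \<notin> closed_segment a b"
proof
  assume "0 \<in> closed_segment a b"
  then obtain t where t: "0 \<le> t" "t \<le> 1" "(1 - t) * Re a + t * Re b = 0" "(1 - t) * Im a + t * Im b = 0"
    by (auto simp: closed_segment_def complex_eq_iff)
  have *: "\<not> (0 < x \<and> 0 < y)" if "(1 - t) * x + t * y = 0" for x y
    using that t(1,2) by (smt (verit) mult_nonneg_nonneg mult_eq_0_iff)
  have "\<not> (x < 0 \<and> y < 0)" if "(1 - t) * x + t * y = 0" for x y
    using *[of "-x" "-y"] that by (simp add: algebra_simps)
  with * show False using assms t by (auto simp: zero_less_mult_iff)
qed

text \<open>Both segment lemmas certify that a linear homotopy avoids 0. Here \<open>a\<close> may
  lie on the boundary line of the half plane: the segment leaves that line at once, so 0 could only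
  be its starting point.\<close>

lemma zero_notin_closed_segment_to_half_plane:
  assumes "0 \<le> s * Im a" "0 < s * Im b" "a \<noteq> 0"
  shows "0 \<notin> closed_segment a b"
proof
  assume "0 \<in> closed_segment a b"
  then obtain t where t: "0 \<le> t" "t \<le> 1" "(1 - t) * Re a + t * Re b = 0" "(1 - t) * Im a + t * Im b = 0"
    by (auto simp: closed_segment_def complex_eq_iff)
  have "(1 - t) * (s * Im a) + t * (s * Im b) = s * ((1 - t) * Im a + t * Im b)"
    by (simp add: algebra_simps)
  then have eq: "(1 - t) * (s * Im a) + t * (s * Im b) = 0" using t by simp
  have "0 \<le> (1 - t) * (s * Im a)" "0 \<le> t * (s * Im b)" using t assms by auto
  then have "t * (s * Im b) = 0" using eq by linarith
  then have "t = 0" using assms by auto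
  then show False using t assms by (auto simp: complex_eq_iff)
qed

text \<open>Each open half disc goes into a single half plane, which leaves four sign patterns. If
  both halves land on the same side, the image loop contracts in the complement of 0 and its winding
  number is 0; if they are swapped, it deforms to the conjugate circle and the winding number is -1.
  The division by \<open>u\<close> appears because \<open>h\<close> is written in a coordinate
  rotated by \<open>u\<close>, whereas the orientation condition is about a circle in the chart
  itself.\<close>

lemma transition_sides:
  fixes h :: "complex \<Rightarrow> complex"
  assumes r: "0 < r" and u: "norm u = 1"
    and cont: "continuous_on (cball 0 r) h"
    and real: "\<And>w. w \<in> cball 0 r \<Longrightarrow> Im (h w) = 0 \<longleftrightarrow> Im w = 0"
    and ord: "\<And>w. w \<in> cball 0 r \<Longrightarrow> Im w = 0 \<Longrightarrow> sgn (Re (h w)) = sgn (Re w)"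
    and wn: "winding_number (\<lambda>t. h (circlepath 0 r t / u)) 0 = 1"
    and w: "w \<in> cball 0 r"
  shows "sgn (Im (h w)) = sgn (Im w)"
proof -
  define \<gamma> where "\<gamma> t = circlepath 0 r t / u" for t
  have \<gamma>: "\<gamma> t \<in> cball 0 r" "\<gamma> t \<noteq> 0" for t
    using r u by (auto simp: \<gamma>_def circlepath norm_divide norm_mult)
  have path: "path (\<lambda>t. h (\<gamma> t))"
    unfolding path_def
    by (rule continuous_on_compose2[OF cont])
       (use \<gamma> u in \<open>auto simp: \<gamma>_def circlepath intro!: continuous_intros\<close>)
  have loop: "pathfinish (\<lambda>t. h (\<gamma> t)) = pathstart (\<lambda>t. h (\<gamma> t))"
    by (auto simp: pathfinish_def pathstart_def \<gamma>_def circlepath)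
  \<comment> \<open>An open half disc is convex, hence connected, and \<open>Im \<circ> h\<close>
    has no zero on it.\<close>
  have const: "sgn (Im (h w)) = sgn (Im (h w'))"
    if "w \<in> cball 0 r" "w' \<in> cball 0 r" "sgn (Im w) = sgn (Im w')" for w w'
  proof (cases "Im w = 0")
    case True
    then have "Im w' = 0" using that(3) by (simp add: sgn_if split: if_splits)
    then show ?thesis using True real[of w] real[of w'] that by simp
  next
    case False
    define C where "C = cball 0 r \<inter> {z. sgn (Im z) = sgn (Im w)}"
    have "{z. sgn (Im z) = sgn (Im w)} = (if Im w > 0 then {z. Im z > 0} else {z. Im z < 0})"
      using False by (auto simp: sgn_if)
    then have "convex C"
      unfolding C_def by (auto intro!: convex_Int convex_halfspace_Im_gt convex_halfspace_Im_lt)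
    then have "topological_space_class.connected ((Im \<circ> h) ` C)"
      by (intro connected_continuous_image convex_connected continuous_on_compose
            continuous_on_subset[OF cont] continuous_intros) (auto simp: C_def)
    then have "is_interval ((Im \<circ> h) ` C)" by (simp add: is_interval_connected_1)
    moreover have "Im (h w) \<in> (Im \<circ> h) ` C" "Im (h w') \<in> (Im \<circ> h) ` C"
      using that by (auto simp: C_def)
    moreover have "0 \<notin> (Im \<circ> h) ` C"
      using real False by (auto simp: C_def sgn_if split: if_splits)
    ultimately show ?thesis
      unfolding is_interval_1 by (smt (verit) sgn_if)
  qed
  define p where "p = \<i> * of_real r"
  have p: "p \<in> cball 0 r" "- p \<in> cball 0 r" "Im p > 0" using r by (auto simp: p_def norm_mult)
  have up: "sgn (Im (h w)) = sgn (Im (h p))" if "w \<in> cball 0 r" "Im w > 0" for w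
    using const[of w p] that p by simp
  have dn: "sgn (Im (h w)) = sgn (Im (h (-p)))" if "w \<in> cball 0 r" "Im w < 0" for w
    using const[of w "-p"] that p by simp
  have hp: "Im (h p) \<noteq> 0" "Im (h (-p)) \<noteq> 0" using real[of p] real[of "-p"] p by auto
  have same: False if "sgn (Im (h p)) = sgn (Im (h (-p)))"
  proof -
    \<comment> \<open>The loop stays in the closed half plane of \<open>h p\<close> and misses 0, so
      it can be pulled straight to the unit point \<open>j\<close> inside that half plane.\<close>
    define j where "j = \<i> * of_real (sgn (Im (h p)))"
    have "winding_number (linepath j j) 0 = winding_number (\<lambda>t. h (\<gamma> t)) 0"
    proof (rule winding_number_loops_linear_eq[OF path _ loop])
      fix t :: real assume "t \<in> {0..1}"
      have "0 \<le> sgn (Im (h p)) * Im (h (\<gamma> t))"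
        using up[OF \<gamma>(1), of t] dn[OF \<gamma>(1), of t] real[OF \<gamma>(1), of t] that
        by (cases "Im (\<gamma> t)" "0::real" rule: linorder_cases) (auto simp: sgn_if split: if_splits)
      moreover have "h (\<gamma> t) \<noteq> 0"
        using real[OF \<gamma>(1), of t] ord[OF \<gamma>(1), of t] \<gamma>(2)[of t] by (auto simp: sgn_0_0 complex_eq_iff)
      ultimately show "0 \<notin> closed_segment (h (\<gamma> t)) (linepath j j t)"
        using hp by (intro zero_notin_closed_segment_to_half_plane) (auto simp: j_def linepath_refl sgn_if)
    qed auto
    then show False using wn hp by (auto simp: \<gamma>_def j_def winding_number_trivial sgn_if)
  qed
  have swap: False if "sgn (Im (h p)) = -1" "sgn (Im (h (-p))) = 1"
  proof -
    define a where "a = Arg2pi u / (2 * pi)"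
    have a: "u = exp (2 * of_real pi * \<i> * of_real a)" "0 \<le> a" "a \<le> 1"
      using Arg2pi[of u] u by (simp_all add: a_def is_Arg_def)
    \<comment> \<open>The conjugate of \<open>\<gamma>\<close> is the clockwise circle starting at
      \<open>r * u\<close>. Written as a shifted and reversed circle, it has winding number
      -1.\<close>
    define k where "k = shiftpath (1 - a) (reversepath (circlepath 0 r))"
    have k: "k t = cnj (\<gamma> t)" if "t \<in> {0..1}" for t
    proof -
      have "cnj (\<gamma> t) = of_real r * exp (2 * of_real pi * \<i> * of_real (a - t))"
        by (simp add: \<gamma>_def circlepath a(1) exp_cnj exp_diff exp_minus field_simps)
      also have "\<dots> = k t"
        using exp_plus_2pin[of "2 * of_real pi * \<i> * of_real (a - t)" 1]
        by (auto simp: k_def shiftpath_def reversepath_def circlepath algebra_simps)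
      finally show ?thesis by simp
    qed
    have "winding_number k 0 = winding_number (\<lambda>t. h (\<gamma> t)) 0"
    proof (rule winding_number_loops_linear_eq[OF path _ loop])
      show "path k" "pathfinish k = pathstart k"
        using a by (auto simp: k_def path_shiftpath closed_shiftpath)
      fix t :: real assume t: "t \<in> {0..1}"
      show "0 \<notin> closed_segment (h (\<gamma> t)) (k t)"
        unfolding k[OF t]
        using up[OF \<gamma>(1), of t] dn[OF \<gamma>(1), of t] real[OF \<gamma>(1), of t] ord[OF \<gamma>(1), of t] \<gamma>(2)[of t] that
        by (intro zero_notin_closed_segment_same_side,
            cases "Im (\<gamma> t)" "0::real" rule: linorder_cases)
           (auto simp: sgn_if complex_eq_iff zero_less_mult_iff split: if_splits)
    qed 
    moreover have "winding_number k 0 = - winding_number (circlepath 0 r) 0"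
      unfolding k_def using a r
      by (subst winding_number_shiftpath) (auto simp: winding_number_reversepath)
    moreover have "winding_number (circlepath 0 r) 0 = 1"
      using r by (intro winding_number_circlepath_centre)
    ultimately show False using wn by (simp add: \<gamma>_def)
  qed
  have cases: "sgn (Im (h p)) = 1 \<and> sgn (Im (h (-p))) = -1"
    using same swap hp by (cases "Im (h p) > 0"; cases "Im (h (-p)) > 0") (simp_all add: sgn_if)
  show ?thesis
    using up[OF w] dn[OF w] cases real[OF w] by (cases "Im w" "0::real" rule: linorder_cases) auto
qed

section \<open>Charts as homeomorphisms onto open sets of the plane\<close>

section \<open>Charts of an oriented surface\<close>

lemma sign_half_disc:
  fixes u :: complex
  assumes C_def: "C = {z \<in> ball x r. sgn (Im ((z - x) / u)) = s}"
    and "norm u = 1" "0 < r" "s = 1 \<or> s = - 1"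
  shows "topological_space_class.connected C" and "C \<noteq> {}"
proof -
  have u: "u \<noteq> 0" using assms(2) by auto
  have *: "norm (z / u) = norm z" "norm (u * z) = norm z" for z using assms(2) by (simp_all add: norm_divide norm_mult)
  \<comment> \<open>The similarity \<open>w \<mapsto> x + u * w\<close> carries a half disc bounded
    by the real axis to \<open>C\<close>; the former is an intersection of convex sets.\<close>
  have C: "C = (\<lambda>w. x + u * w) ` (ball 0 r \<inter> {w. sgn (Im w) = s})"
  proof (intro equalityI subsetI)
    fix z assume "z \<in> C"
    then show "z \<in> (\<lambda>w. x + u * w) ` (ball 0 r \<inter> {w. sgn (Im w) = s})"
      using u by (intro image_eqI[where x = "(z - x) / u"]) (auto simp: C_def * dist_norm norm_minus_commute)
  qed (use u in \<open>auto simp: C_def dist_norm *\<close>)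
  have "{w. sgn (Im w) = s} = (if s = 1 then {w. Im w > 0} else {w. Im w < 0})"
    using assms(4) by (auto simp: sgn_if)
  then have "convex (ball 0 r \<inter> {w. sgn (Im w) = s})"
    by (auto intro!: convex_Int convex_halfspace_Im_gt convex_halfspace_Im_lt)
  then show "topological_space_class.connected C"
    unfolding C by (intro connected_continuous_image continuous_intros convex_connected)
  have "\<i> * of_real (s * r / 2) \<in> ball 0 r \<inter> {w. sgn (Im w) = s}"
    using assms(3,4) by (auto simp: norm_mult)
  then show "C \<noteq> {}" unfolding C by blast
qed

locale oriented_surface =
  fixes X :: "'s topology" and A :: "('s set \<times> ('s \<Rightarrow> complex)) set"
  assumes surface: "closed_oriented_surface X A"
begin

lemma chart:
  assumes "(U, \<phi>) \<in> A"
  shows chart_openin: "openin X U" and chart_open_image: "open (\<phi> ` U)"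
    and chart_inj: "inj_on \<phi> U"
    and chart_continuous: "continuous_map (subtopology X U) euclidean \<phi>"
    and chart_inv_continuous: "continuous_map (top_of_set (\<phi> ` U)) X (inv_into U \<phi>)"
    and chart_subset: "U \<subseteq> topspace X"
proof -
  have c: "surface_chart X (U, \<phi>)"
    using surface assms unfolding closed_oriented_surface_def surface_orientation_def by blast
  then show o: "openin X U" and "open (\<phi> ` U)" by (auto simp: surface_chart_def)
  have hm: "homeomorphic_map (subtopology X U) (top_of_set (\<phi> ` U)) \<phi>"
    using c by (auto simp: surface_chart_def)
  show sub: "U \<subseteq> topspace X" using o by (rule openin_subset)
  have ts: "topspace (subtopology X U) = U" using sub by auto
  show inj: "inj_on \<phi> U" using homeomorphic_imp_injective_map[OF hm] ts by simp
  show "continuous_map (subtopology X U) euclidean \<phi>"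
    using homeomorphic_imp_continuous_map[OF hm] by (simp add: continuous_map_in_subtopology)
  obtain g where g: "homeomorphic_maps (subtopology X U) (top_of_set (\<phi> ` U)) \<phi> g"
    using hm unfolding homeomorphic_map_maps by blast
  have eq: "g z = inv_into U \<phi> z" if z: "z \<in> \<phi> ` U" for z
  proof -
    obtain x where "x \<in> U" "z = \<phi> x" using z by blast
    moreover have "g (\<phi> x) = x" if "x \<in> U" for x
      using g that ts unfolding homeomorphic_maps_def by simp
    ultimately show ?thesis using inj by simp
  qed
  have "continuous_map (top_of_set (\<phi> ` U)) (subtopology X U) g"
    using g by (simp add: homeomorphic_maps_def)
  then have "continuous_map (top_of_set (\<phi> ` U)) X g"
    by (simp add: continuous_map_in_subtopology)
  then show "continuous_map (top_of_set (\<phi> ` U)) X (inv_into U \<phi>)"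
    by (rule continuous_map_eq) (use eq in auto)
qed

lemma chart_preimage_openin:
  assumes "(U, \<phi>) \<in> A" "open W"
  shows "openin X {x \<in> U. \<phi> x \<in> W}"
proof -
  have "openin (subtopology X U) {x \<in> topspace (subtopology X U). \<phi> x \<in> W}"
    using assms(2) by (intro openin_continuous_map_preimage[OF chart_continuous[OF assms(1)]]) simp
  moreover have "topspace (subtopology X U) = U" using chart_subset[OF assms(1)] by auto
  ultimately show ?thesis
    using chart_openin[OF assms(1)] by (metis openin_trans_full)
qed

lemma chart_image_open:
  assumes "(U, \<phi>) \<in> A" "openin X S"
  shows "open (\<phi> ` (U \<inter> S))"
proof -
  have "openin (top_of_set (\<phi> ` U)) {z \<in> topspace (top_of_set (\<phi> ` U)). inv_into U \<phi> z \<in> S}"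
    by (rule openin_continuous_map_preimage[OF chart_inv_continuous[OF assms(1)] assms(2)])
  moreover have "{z \<in> topspace (top_of_set (\<phi> ` U)). inv_into U \<phi> z \<in> S} = \<phi> ` (U \<inter> S)"
    using chart_inj[OF assms(1)] by (auto simp: inv_into_f_f)
  ultimately show ?thesis
    using chart_open_image[OF assms(1)] by (metis openin_open_trans)
qed

lemma chart_preimage_connectedin:
  assumes "(U, \<phi>) \<in> A" "topological_space_class.connected C" "C \<subseteq> \<phi> ` U"
  shows "connectedin X {x \<in> U. \<phi> x \<in> C}"
proof -
  have "connectedin X (inv_into U \<phi> ` C)"
    using assms by (intro connectedin_continuous_map_image[OF chart_inv_continuous[OF assms(1)]])
      (simp add: connectedin_subtopology connectedin_iff_connected)
  also have "inv_into U \<phi> ` C = {x \<in> U. \<phi> x \<in> C}"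
  proof (intro equalityI subsetI)
    fix x assume "x \<in> {x \<in> U. \<phi> x \<in> C}"
    then show "x \<in> inv_into U \<phi> ` C"
      using chart_inj[OF assms(1)] by (intro image_eqI[where x = "\<phi> x"]) auto
  next
    fix x assume "x \<in> inv_into U \<phi> ` C"
    then obtain z where "z \<in> C" "x = inv_into U \<phi> z" by auto
    then show "x \<in> {x \<in> U. \<phi> x \<in> C}"
      using assms(3) by (auto simp: f_inv_into_f subset_iff intro: inv_into_into)
  qed
  finally show ?thesis .
qed

text \<open>Orientedness of the atlas enters the argument only through this lemma; the other facts
  about charts are purely topological.\<close>

lemma chart_winding:
  assumes "(U, \<phi>) \<in> A" "(V, \<psi>) \<in> A" "0 < r" "cball z r \<subseteq> \<phi> ` (U \<inter> V)"
  shows "winding_number (\<lambda>t. \<psi> (inv_into U \<phi> (circlepath z r t))) (\<psi> (inv_into U \<phi> z)) = 1"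
proof -
  have "compatible_charts (U, \<phi>) (V, \<psi>)"
    using assms(1,2) surface unfolding closed_oriented_surface_def surface_orientation_def by blast
  then show ?thesis
    using assms(3,4) by (auto simp: compatible_charts_def orientation_preserving_def o_def)
qed

lemma chart_cover:
  assumes "x \<in> topspace X"
  shows "\<exists>U \<phi>. (U, \<phi>) \<in> A \<and> x \<in> U"
proof -
  have "(\<Union>c\<in>A. fst c) = topspace X"
    using surface unfolding closed_oriented_surface_def surface_orientation_def by blast
  then obtain c where "c \<in> A" "x \<in> fst c" using assms by blast
  then show ?thesis by (cases c) auto
qed

lemma transition_continuous:
  assumes "(U, \<phi>) \<in> A" "(V, \<psi>) \<in> A"
  shows "continuous_on (\<phi> ` (U \<inter> V)) (\<lambda>z. \<psi> (inv_into U \<phi> z))"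
proof -
  have "continuous_map (top_of_set (\<phi> ` (U \<inter> V))) X (inv_into U \<phi>)"
    by (rule continuous_map_from_subtopology_mono[OF chart_inv_continuous[OF assms(1)]]) blast
  moreover have "inv_into U \<phi> z \<in> V" if z: "z \<in> \<phi> ` (U \<inter> V)" for z
  proof -
    obtain x where "x \<in> U" "x \<in> V" "z = \<phi> x" using z by blast
    then show ?thesis using chart_inj[OF assms(1)] by simp
  qed
  ultimately have "continuous_map (top_of_set (\<phi> ` (U \<inter> V))) (subtopology X V) (inv_into U \<phi>)"
    by (simp add: continuous_map_in_subtopology image_subset_iff)
  from continuous_map_compose[OF this chart_continuous[OF assms(2)]]
  show ?thesis by (simp add: o_def)
qed

end

section \<open>Comparing two charts that straighten the same arrow\<close>

section \<open>Straightened arrows\<close>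

lemma connectedin_same_component:
  assumes "connectedin Y C" "x \<in> C" "y \<in> C"
  shows "connected_component_of_set Y x = connected_component_of_set Y y"
proof -
  have "connected_component_of Y x y"
    using assms by (meson connected_component_of_def)
  then show ?thesis by (simp add: connected_component_of_equiv)
qed

locale tame_quiver = oriented_surface X A + fin_digraph G
  for X :: "'s topology" and A and G :: "('v, 'e) pre_digraph" +
  fixes pos :: "'v \<Rightarrow> 's" and cur :: "'e \<Rightarrow> real \<Rightarrow> 's"
  assumes tame: "tame_embedding G X A pos cur"
begin

abbreviation Dr :: "'s set" where "Dr \<equiv> drawing G pos cur"

definition complement :: "'s topology" where "complement = subtopology X (topspace X - Dr)"

text \<open>At points of the drawing the value is the empty set, so statements about faces are made
  for points off the drawing.\<close>

definition face_at :: "'s \<Rightarrow> 's set" where "face_at y = connected_component_of_set complement y"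

lemma embedding: "graph_embedding G X pos cur"
  using tame unfolding tame_embedding_def by blast

lemma arrow_chart_exists: "e \<in> arcs G \<Longrightarrow> s \<in> {0<..<1} \<Longrightarrow> \<exists>U \<phi>. arrow_chart G A pos cur e s U \<phi>"
  using tame unfolding tame_embedding_def by blast

lemma vertex_chart_exists: "v \<in> verts G \<Longrightarrow> \<exists>U \<phi>. vertex_chart G A pos cur v U \<phi>"
  using tame unfolding tame_embedding_def by blast

lemma arrow_continuous: "e \<in> arcs G \<Longrightarrow> continuous_map (top_of_set {0..1}) X (cur e)"
  using embedding unfolding graph_embedding_def pathin_def by blast

lemma arrow_ends: "e \<in> arcs G \<Longrightarrow> cur e 0 = pos (tail G e)" "e \<in> arcs G \<Longrightarrow> cur e 1 = pos (head G e)"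
  using embedding unfolding graph_embedding_def by blast+

lemma pos_in_space: "v \<in> verts G \<Longrightarrow> pos v \<in> topspace X"
  using embedding[unfolded graph_embedding_def, THEN conjunct2, THEN conjunct1] by blast

lemma arrow_point_not_vertex: "e \<in> arcs G \<Longrightarrow> s \<in> {0<..<1} \<Longrightarrow> v \<in> verts G \<Longrightarrow> cur e s \<noteq> pos v"
  using embedding unfolding graph_embedding_def by blast

lemma arrow_point_inj:
  assumes "e \<in> arcs G" "e' \<in> arcs G" "s \<in> {0<..<1}" "s' \<in> {0<..<1}" "cur e s = cur e' s'"
  shows "e = e'" "s = s'"
proof -
  have "e \<noteq> e' \<longrightarrow> cur e ` {0<..<1} \<inter> cur e' ` {0<..<1} = {}"
    using embedding assms(1,2) unfolding graph_embedding_def by blast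
  then show "e = e'" using assms(3-5) by blast
  have "inj_on (cur e) {0<..<1}"
    using embedding assms(1,2) unfolding graph_embedding_def by blast
  then show "s = s'" using assms(3-5) \<open>e = e'\<close> by (auto dest: inj_onD)
qed

lemma in_drawing_iff:
  "x \<in> Dr \<longleftrightarrow> (\<exists>v\<in>verts G. x = pos v) \<or> (\<exists>e\<in>arcs G. \<exists>s\<in>{0<..<1}. x = cur e s)"
proof -
  have "{0..1} = insert 0 (insert 1 {0<..<1::real})" by auto
  then have "cur e ` {0..1} = insert (pos (tail G e)) (insert (pos (head G e)) (cur e ` {0<..<1}))"
    if "e \<in> arcs G" for e using arrow_ends[OF that] by simp
  then have "Dr = pos ` verts G \<union> (\<Union>e\<in>arcs G. insert (pos (tail G e)) (insert (pos (head G e)) (cur e ` {0<..<1})))"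
    unfolding drawing_def by simp
  also have "\<dots> = pos ` verts G \<union> (\<Union>e\<in>arcs G. cur e ` {0<..<1})"
    using tail_in_verts head_in_verts by blast
  finally show ?thesis by blast
qed

lemma arrow_point_in_drawing: "e \<in> arcs G \<Longrightarrow> s \<in> {0<..<1} \<Longrightarrow> cur e s \<in> Dr"
  unfolding in_drawing_iff by blast

text \<open>The drawing is a finite union of compact sets in a Hausdorff space.\<close>

lemma drawing_closed: "closedin X Dr"
proof -
  have "compactin X (cur e ` {0..1})" if "e \<in> arcs G" for e
    using that by (intro image_compactin[OF _ arrow_continuous]) (auto simp: compactin_subtopology)
  then have "compactin X (\<Union>e\<in>arcs G. cur e ` {0..1})"
    using finite_arcs by (intro compactin_Union) auto
  moreover have "compactin X (pos ` verts G)"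
    using pos_in_space finite_verts by (intro finite_imp_compactin) auto
  ultimately have "compactin X Dr" unfolding drawing_def by (rule compactin_Un[rotated])
  moreover have "Hausdorff_space X" using surface unfolding closed_oriented_surface_def by blast
  ultimately show ?thesis by (rule compactin_imp_closedin[rotated])
qed

lemma faces_eq: "faces G X pos cur = face_at ` (topspace X - Dr)"
  by (auto simp: faces_def connected_components_of_def face_at_def complement_def)

lemma connectedin_complement: "connectedin X C \<Longrightarrow> C \<inter> Dr = {} \<Longrightarrow> connectedin complement C"
  unfolding complement_def connectedin_subtopology by (auto dest: connectedin_subset_topspace)

lemma face_at_eqI:
  assumes "connectedin X C" "C \<inter> Dr = {}" "x \<in> C" "y \<in> C"
  shows "face_at x = face_at y"
  unfolding face_at_def using connectedin_same_component[OF connectedin_complement] assms by blast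

lemma face_at_mem: "y \<in> face_at x \<Longrightarrow> face_at y = face_at x"
  by (simp add: face_at_def connected_component_of_equiv)

lemma subset_face_at: "connectedin X C \<Longrightarrow> C \<inter> Dr = {} \<Longrightarrow> x \<in> C \<Longrightarrow> C \<subseteq> face_at x"
  unfolding face_at_def by (intro connected_component_of_maximal connectedin_complement)

text \<open>
  A chart in which the drawing near the point \<open>cur e s\<close> is the line in direction \<open>u\<close>, traversed
  in that direction. Both arrow charts and, along an arrow end, vertex charts are of this kind.
\<close>

definition straight where
  "straight e s U \<phi> u r \<longleftrightarrow>
     (U, \<phi>) \<in> A \<and> e \<in> arcs G \<and> s \<in> {0<..<1} \<and> cur e s \<in> U \<and> norm u = 1 \<and> 0 < r \<and>
     cball (\<phi> (cur e s)) r \<subseteq> \<phi> ` U \<and>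
     (\<forall>y\<in>U. \<phi> y \<in> cball (\<phi> (cur e s)) r \<longrightarrow>
        (y \<in> Dr \<longleftrightarrow> Im ((\<phi> y - \<phi> (cur e s)) / u) = 0) \<and>
        (y \<in> Dr \<longrightarrow> (\<exists>s'\<in>{0<..<1}. y = cur e s' \<and> sgn (Re ((\<phi> y - \<phi> (cur e s)) / u)) = sgn (s' - s))))"

lemma arrow_chartD:
  assumes "arrow_chart G A pos cur e s U \<phi>" "e \<in> arcs G"
  shows "(U, \<phi>) \<in> A" "cur e s \<in> U" "\<phi> (cur e s) = 0" "\<phi> ` U = ball 0 1"
    and "y \<in> U \<Longrightarrow> y \<in> Dr \<longleftrightarrow> Im (\<phi> y) = 0"
    and "y \<in> U \<Longrightarrow> y \<in> Dr \<Longrightarrow> \<exists>s'\<in>{0<..<1}. y = cur e s'"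
    and "s1 \<in> {0<..<1} \<Longrightarrow> s2 \<in> {0<..<1} \<Longrightarrow> cur e s1 \<in> U \<Longrightarrow> cur e s2 \<in> U \<Longrightarrow>
           sgn (Re (\<phi> (cur e s2)) - Re (\<phi> (cur e s1))) = sgn (s2 - s1)"
proof -
  note c = assms(1)[unfolded arrow_chart_def]
  show UA: "(U, \<phi>) \<in> A" and "cur e s \<in> U" "\<phi> (cur e s) = 0" and im: "\<phi> ` U = ball 0 1"
    using c by - (elim conjE, assumption)+
  have sub: "Dr \<inter> U \<subseteq> cur e ` {0<..<1}" and eq: "\<phi> ` (Dr \<inter> U) = {z \<in> ball 0 1. Im z = 0}"
    and mono: "\<forall>s1 s2. 0 < s1 \<and> s1 < s2 \<and> s2 < 1 \<and> cur e s1 \<in> U \<and> cur e s2 \<in> U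
        \<longrightarrow> Re (\<phi> (cur e s1)) < Re (\<phi> (cur e s2))"
    using c by - (elim conjE, assumption)+
  show "\<exists>s'\<in>{0<..<1}. y = cur e s'" if "y \<in> U" "y \<in> Dr" using sub that by blast
  show "y \<in> Dr \<longleftrightarrow> Im (\<phi> y) = 0" if y: "y \<in> U"
  proof
    assume "y \<in> Dr"
    then have "\<phi> y \<in> \<phi> ` (Dr \<inter> U)" using y by blast
    then show "Im (\<phi> y) = 0" unfolding eq by simp
  next
    assume "Im (\<phi> y) = 0"
    moreover have "\<phi> y \<in> ball 0 1" using im y by blast
    ultimately have "\<phi> y \<in> \<phi> ` (Dr \<inter> U)" unfolding eq by simp
    then obtain y' where "\<phi> y = \<phi> y'" "y' \<in> Dr \<inter> U" by blast
    then show "y \<in> Dr" using inj_onD[OF chart_inj[OF UA], of y y'] y by blast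
  qed
  show "sgn (Re (\<phi> (cur e s2)) - Re (\<phi> (cur e s1))) = sgn (s2 - s1)"
    if "s1 \<in> {0<..<1}" "s2 \<in> {0<..<1}" "cur e s1 \<in> U" "cur e s2 \<in> U"
  proof -
    have *: "Re (\<phi> (cur e a)) < Re (\<phi> (cur e b))"
      if "a \<in> {0<..<1}" "b \<in> {0<..<1}" "cur e a \<in> U" "cur e b \<in> U" "a < b" for a b
      using mono that by simp
    show ?thesis
      using *[of s1 s2] *[of s2 s1] that by (cases s1 s2 rule: linorder_cases) auto
  qed
qed

text \<open>An arrow chart is centred at one point of the arrow, but it straightens the arrow at
  every other point of its domain as well. Recentring makes it possible to compare two arrow charts
  at any common point.\<close>

lemma straight_arrow_chart:
  assumes "arrow_chart G A pos cur e s U \<phi>" "e \<in> arcs G" "s' \<in> {0<..<1}" "cur e s' \<in> U"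
  shows "\<exists>r. straight e s' U \<phi> 1 r"
proof -
  note c = arrow_chartD[OF assms(1,2)]
  have "\<phi> (cur e s') \<in> ball 0 1" using c(4) assms(4) by blast
  then obtain r where r: "0 < r" "cball (\<phi> (cur e s')) r \<subseteq> ball 0 1"
    using open_contains_cball[of "ball (0::complex) 1"] open_ball by blast
  have 0: "Im (\<phi> (cur e s')) = 0" using c(5)[OF assms(4)] arrow_point_in_drawing assms(2,3) by blast
  have "\<exists>s''\<in>{0<..<1}. y = cur e s'' \<and> sgn (Re ((\<phi> y - \<phi> (cur e s')) / 1)) = sgn (s'' - s')"
    if y: "y \<in> U" "y \<in> Dr" for y
    using c(6)[OF y] c(7)[OF assms(3)] y assms(3,4) by (metis div_by_1 minus_complex.simps(1))
  moreover have "y \<in> Dr \<longleftrightarrow> Im ((\<phi> y - \<phi> (cur e s')) / 1) = 0" if "y \<in> U" for y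
    using c(5)[OF that] 0 by simp
  ultimately show ?thesis
    unfolding straight_def using r c assms by (intro exI[of _ r]) auto
qed

text \<open>The transition map meets the conditions of \<open>transition_sides\<close>: both charts
  recognise the drawing as a line, both order it by the parameter of the arrow, and the orientation
  supplies winding number 1.\<close>

lemma straight_sides_agree:
  assumes st: "straight e s U \<phi> u \<rho>" and ch: "arrow_chart G A pos cur e s0 V \<psi>" "cur e s \<in> V"
  obtains r where "0 < r" "r \<le> \<rho>" "{y \<in> U. \<phi> y \<in> cball (\<phi> (cur e s)) r} \<subseteq> V"
    "\<And>y. y \<in> U \<Longrightarrow> \<phi> y \<in> cball (\<phi> (cur e s)) r \<Longrightarrow> sgn (Im (\<psi> y)) = sgn (Im ((\<phi> y - \<phi> (cur e s)) / u))"
proof -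
  define x where "x = \<phi> (cur e s)"
  have e: "e \<in> arcs G" "s \<in> {0<..<1}" "(U, \<phi>) \<in> A" "cur e s \<in> U" "norm u = 1" "0 < \<rho>" "cball x \<rho> \<subseteq> \<phi> ` U"
    and D: "\<And>y. y \<in> U \<Longrightarrow> \<phi> y \<in> cball x \<rho> \<Longrightarrow> y \<in> Dr \<longleftrightarrow> Im ((\<phi> y - x) / u) = 0"
    and D': "\<And>y. y \<in> U \<Longrightarrow> \<phi> y \<in> cball x \<rho> \<Longrightarrow> y \<in> Dr \<Longrightarrow>
        \<exists>s'\<in>{0<..<1}. y = cur e s' \<and> sgn (Re ((\<phi> y - x) / u)) = sgn (s' - s)"
    using st unfolding straight_def x_def by blast+
  note c = arrow_chartD[OF ch(1) e(1)]
  have u: "u \<noteq> 0" using e(5) by auto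
  have i: "inv_into U \<phi> (\<phi> y) = y" if "y \<in> U" for y using that chart_inj[OF e(3)] by simp
  have "open (\<phi> ` (U \<inter> V))" by (rule chart_image_open[OF e(3) chart_openin[OF c(1)]])
  moreover have "x \<in> \<phi> ` (U \<inter> V)" using e(4) ch(2) x_def by blast
  ultimately obtain r0 where r0: "0 < r0" "cball x r0 \<subseteq> \<phi> ` (U \<inter> V)"
    using open_contains_cball by metis
  define r where "r = min r0 \<rho>"
  have r: "0 < r" "r \<le> \<rho>" "cball x r \<subseteq> \<phi> ` (U \<inter> V)" "cball x r \<subseteq> cball x \<rho>"
    using r0 e(6) by (auto simp: r_def)
  have sub: "y \<in> V" if y: "y \<in> U" "\<phi> y \<in> cball x r" for y
  proof -
    obtain y' where "\<phi> y = \<phi> y'" "y' \<in> U" "y' \<in> V" using r(3) y by blast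
    then show ?thesis using inj_onD[OF chart_inj[OF e(3)], of y y'] y by blast
  qed
  \<comment> \<open>The coordinate \<open>w\<close> turns the direction \<open>u\<close> at
    \<open>x\<close> into the positive real axis at 0. In the target, only a real number is
    subtracted, so imaginary parts do not change.\<close>
  define h where "h w = \<psi> (inv_into U \<phi> (x + u * w)) - \<psi> (cur e s)" for w
  have pt: "\<exists>y\<in>U \<inter> V. \<phi> y = x + u * w \<and> \<phi> y \<in> cball x r \<and> (\<phi> y - x) / u = w \<and> h w = \<psi> y - \<psi> (cur e s)"
    if "w \<in> cball 0 r" for w
  proof -
    have "x + u * w \<in> cball x r" using that e(5) by (simp add: dist_norm norm_mult)
    then obtain y where y: "y \<in> U" "y \<in> V" "x + u * w = \<phi> y" using r(3) by blast
    have "(\<phi> y - x) / u = w" using u by (simp flip: y(3))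
    moreover have "h w = \<psi> y - \<psi> (cur e s)" using i[OF y(1)] by (simp add: h_def y(3))
    ultimately show ?thesis using y \<open>x + u * w \<in> cball x r\<close> by auto
  qed
  have s0: "Im (\<psi> (cur e s)) = 0" using c(5)[OF ch(2)] arrow_point_in_drawing[OF e(1,2)] by blast
  have key: "sgn (Im (h w)) = sgn (Im w)" if "w \<in> cball 0 r" for w
  proof (rule transition_sides[OF r(1) e(5) _ _ _ _ that])
    have "continuous_on (cball 0 r) (\<lambda>w. \<psi> (inv_into U \<phi> (x + u * w)))"
    proof (rule continuous_on_compose2[OF transition_continuous[OF e(3) c(1)]])
      show "(\<lambda>w. x + u * w) ` cball 0 r \<subseteq> \<phi> ` (U \<inter> V)" using pt by fastforce
    qed (intro continuous_intros)
    then show "continuous_on (cball 0 r) h" unfolding h_def by (intro continuous_intros)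
  next
    fix w :: complex assume w: "w \<in> cball 0 r"
    then obtain y where y: "y \<in> U" "y \<in> V" "\<phi> y \<in> cball x r" "(\<phi> y - x) / u = w" "h w = \<psi> y - \<psi> (cur e s)"
      using pt by blast
    show iff: "Im (h w) = 0 \<longleftrightarrow> Im w = 0"
      using D[OF y(1)] c(5)[OF y(2)] y s0 r(4) by auto
    assume "Im w = 0"
    then have yD: "y \<in> Dr" using D[OF y(1)] y r(4) by auto
    then obtain s' where "s' \<in> {0<..<1}" "y = cur e s'" "sgn (Re w) = sgn (s' - s)"
      using D'[OF y(1) _ yD] y(3,4) r(4) by blast
    then show "sgn (Re (h w)) = sgn (Re w)"
      using c(7)[OF e(2) _ ch(2), of s'] y by simp
  next
    have "winding_number (\<lambda>t. \<psi> (inv_into U \<phi> (circlepath x r t)) - \<psi> (cur e s)) 0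
        = winding_number (\<lambda>t. \<psi> (inv_into U \<phi> (circlepath x r t))) (\<psi> (cur e s))"
      by (rule winding_number_offset[symmetric])
    also have "\<psi> (cur e s) = \<psi> (inv_into U \<phi> x)" using i[OF e(4)] by (simp add: x_def)
    also have "winding_number (\<lambda>t. \<psi> (inv_into U \<phi> (circlepath x r t))) (\<psi> (inv_into U \<phi> x)) = 1"
      by (rule chart_winding[OF e(3) c(1) r(1,3)])
    finally show "winding_number (\<lambda>t. h (circlepath 0 r t / u)) 0 = 1"
      using u i[OF e(4)] by (simp add: h_def circlepath x_def)
  qed
  have fin: "sgn (Im (\<psi> y)) = sgn (Im ((\<phi> y - x) / u))" if "y \<in> U" "\<phi> y \<in> cball x r" for y
  proof -
    define w where "w = (\<phi> y - x) / u"
    have "w \<in> cball 0 r" using that(2) e(5) by (simp add: w_def norm_divide dist_norm norm_minus_commute)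
    moreover have "x + u * w = \<phi> y" using u by (simp add: w_def)
    ultimately show ?thesis using key[of w] i[OF that(1)] s0 by (simp add: h_def w_def)
  qed
  show thesis
    by (rule that[OF r(1,2)]) (use sub fin in \<open>auto simp: x_def\<close>)
qed

end

section \<open>Independence of the adjacent faces from chart and base point\<close>

section \<open>The faces on the two sides of an arrow\<close>

context tame_quiver
begin

text \<open>A connected set off the drawing lies in one face, so within a single chart each side of
  the arrow belongs to a definite face.\<close>

lemma arrow_half:
  assumes ch: "arrow_chart G A pos cur e s V \<psi>" "e \<in> arcs G" and \<sigma>: "\<sigma> = 1 \<or> \<sigma> = - 1"
  defines "H \<equiv> {y \<in> V. sgn (Im (\<psi> y)) = \<sigma>}"
  shows "connectedin X H" "H \<inter> Dr = {}" "H \<noteq> {}"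
proof -
  note c = arrow_chartD[OF ch]
  define C where "C = {z \<in> ball (0::complex) 1. sgn (Im z) = \<sigma>}"
  have C': "C = {z \<in> ball 0 1. sgn (Im ((z - 0) / 1)) = \<sigma>}" by (simp add: C_def)
  have H: "H = {y \<in> V. \<psi> y \<in> C}" using c(4) by (auto simp: C_def H_def)
  have "C \<subseteq> \<psi> ` V" unfolding c(4) by (auto simp: C_def)
  then show "connectedin X H"
    unfolding H by (intro chart_preimage_connectedin[OF c(1)] sign_half_disc(1)[OF C' _ _ \<sigma>]) auto
  have "C \<noteq> {}" by (intro sign_half_disc(2)[OF C' _ _ \<sigma>]) auto
  then show "H \<noteq> {}" using \<open>C \<subseteq> \<psi> ` V\<close> unfolding H by blast
  show "H \<inter> Dr = {}" using c(5) \<sigma> by (auto simp: H_def)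
qed

text \<open>The radius \<open>r'\<close> is variable because two charts are known to agree on sides
  only in a sufficiently small disc.\<close>

lemma straight_half:
  assumes st: "straight e s U \<phi> u r" and \<sigma>: "\<sigma> = 1 \<or> \<sigma> = - 1" and r': "0 < r'" "r' \<le> r"
  defines "H \<equiv> {y \<in> U. \<phi> y \<in> ball (\<phi> (cur e s)) r' \<and> sgn (Im ((\<phi> y - \<phi> (cur e s)) / u)) = \<sigma>}"
  shows "connectedin X H" "H \<inter> Dr = {}" "H \<noteq> {}"
proof -
  define x where "x = \<phi> (cur e s)"
  have c: "(U, \<phi>) \<in> A" "norm u = 1" "cball x r \<subseteq> \<phi> ` U"
    and D: "\<And>y. y \<in> U \<Longrightarrow> \<phi> y \<in> cball x r \<Longrightarrow> y \<in> Dr \<longleftrightarrow> Im ((\<phi> y - x) / u) = 0"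
    using st unfolding straight_def x_def by blast+
  define C where "C = {z \<in> ball x r'. sgn (Im ((z - x) / u)) = \<sigma>}"
  have H: "H = {y \<in> U. \<phi> y \<in> C}" by (simp add: H_def C_def x_def)
  have sub: "C \<subseteq> cball x r" using r' by (auto simp: C_def)
  then have C: "C \<subseteq> \<phi> ` U" using c(3) by blast
  show "connectedin X H"
    unfolding H by (intro chart_preimage_connectedin[OF c(1) _ C] sign_half_disc(1)[OF C_def c(2) r'(1) \<sigma>])
  have "C \<noteq> {}" by (intro sign_half_disc(2)[OF C_def c(2) r'(1) \<sigma>])
  then show "H \<noteq> {}" using C unfolding H by blast
  show "H \<inter> Dr = {}" using D sub \<sigma> unfolding H C_def by fastforce
qed

text \<open>The link is a point \<open>w\<close> so close to \<open>cur e s\<close> that both charts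
  contain it and see it on the same side: within the first chart it shares a half disc with
  \<open>z\<close>, within the second one with \<open>y\<close>.\<close>

lemma straight_face:
  assumes st: "straight e s U \<phi> u r" and \<sigma>: "\<sigma> = 1 \<or> \<sigma> = - 1"
    and z: "z \<in> U" "\<phi> z \<in> ball (\<phi> (cur e s)) r" "sgn (Im ((\<phi> z - \<phi> (cur e s)) / u)) = \<sigma>"
    and ch: "arrow_chart G A pos cur e s0 V \<psi>" "cur e s \<in> V" and y: "y \<in> V" "sgn (Im (\<psi> y)) = \<sigma>"
  shows "face_at z = face_at y"
proof -
  have e: "e \<in> arcs G" "0 < r" using st unfolding straight_def by blast+
  from straight_sides_agree[OF st ch]
  obtain r' where r': "0 < r'" "r' \<le> r" "{y \<in> U. \<phi> y \<in> cball (\<phi> (cur e s)) r'} \<subseteq> V"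
    "\<And>y. y \<in> U \<Longrightarrow> \<phi> y \<in> cball (\<phi> (cur e s)) r' \<Longrightarrow> sgn (Im (\<psi> y)) = sgn (Im ((\<phi> y - \<phi> (cur e s)) / u))"
    by blast
  obtain w where w: "w \<in> U" "\<phi> w \<in> ball (\<phi> (cur e s)) r'" "sgn (Im ((\<phi> w - \<phi> (cur e s)) / u)) = \<sigma>"
    using straight_half(3)[OF st \<sigma> r'(1,2)] by blast
  have "\<phi> w \<in> ball (\<phi> (cur e s)) r" using w(2) r'(2) by auto
  then have "face_at z = face_at w"
    using z w(1,3) by (intro face_at_eqI[OF straight_half(1,2)[OF st \<sigma> e(2) order_refl]]) auto
  also have "w \<in> V" using w r'(3) by auto
  then have "face_at w = face_at y"
    using w r'(4)[OF w(1)] y by (intro face_at_eqI[OF arrow_half(1,2)[OF ch(1) e(1) \<sigma>]]) auto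
  finally show ?thesis .
qed

text \<open>Recentre the first chart at the common arrow point and pass through a nearby point on
  the given side.\<close>

lemma arrow_charts_face:
  assumes ch: "arrow_chart G A pos cur e s V \<psi>" "arrow_chart G A pos cur e s' V' \<psi>'" "e \<in> arcs G"
    and t: "t \<in> {0<..<1}" "cur e t \<in> V" "cur e t \<in> V'" and \<sigma>: "\<sigma> = 1 \<or> \<sigma> = - 1"
    and y: "y \<in> V" "sgn (Im (\<psi> y)) = \<sigma>" "y' \<in> V'" "sgn (Im (\<psi>' y')) = \<sigma>"
  shows "face_at y = face_at y'"
proof -
  note c = arrow_chartD[OF ch(1,3)]
  obtain r where st: "straight e t V \<psi> 1 r" using straight_arrow_chart[OF ch(1,3) t(1,2)] by blast
  have "0 < r" using st unfolding straight_def by blast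
  then obtain z where z: "z \<in> V" "\<psi> z \<in> ball (\<psi> (cur e t)) r" "sgn (Im ((\<psi> z - \<psi> (cur e t)) / 1)) = \<sigma>"
    using straight_half(3)[OF st \<sigma>, of r] by blast
  have "Im (\<psi> (cur e t)) = 0" using c(5)[OF t(2)] arrow_point_in_drawing[OF ch(3) t(1)] by blast
  then have "sgn (Im (\<psi> z)) = \<sigma>" using z(3) by simp
  then have "face_at y = face_at z"
    using y z(1) by (intro face_at_eqI[OF arrow_half(1,2)[OF ch(1,3) \<sigma>]]) auto
  also have "face_at z = face_at y'" by (rule straight_face[OF st \<sigma> z ch(2) t(3) y(3,4)])
  finally show ?thesis .
qed

text \<open>Chart and point are picked arbitrarily; by \<open>arrow_charts_face\<close> every other
  choice gives the same face.\<close>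

definition face_near where
  "face_near e \<sigma> s = face_at (SOME y. \<exists>V \<psi>. arrow_chart G A pos cur e s V \<psi> \<and> y \<in> V \<and> sgn (Im (\<psi> y)) = \<sigma>)"

text \<open>The sign 1 stands for the left and -1 for the right, since charts put the left of an
  arrow into the upper half disc. The parameter 1/2 is an arbitrary interior one.\<close>

definition side where "side e \<sigma> = face_near e \<sigma> (1 / 2)"

lemma face_near:
  assumes e: "e \<in> arcs G" "s \<in> {0<..<1}" "t \<in> {0<..<1}" and \<sigma>: "\<sigma> = 1 \<or> \<sigma> = - 1"
    and ch: "arrow_chart G A pos cur e s V \<psi>" "cur e t \<in> V" and y: "y \<in> V" "sgn (Im (\<psi> y)) = \<sigma>"
  shows "face_at y = face_near e \<sigma> t"
proof -
  let ?P = "\<lambda>y. \<exists>V \<psi>. arrow_chart G A pos cur e t V \<psi> \<and> y \<in> V \<and> sgn (Im (\<psi> y)) = \<sigma>"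
  obtain V' \<psi>' where ch': "arrow_chart G A pos cur e t V' \<psi>'" using arrow_chart_exists e by blast
  then obtain y' where "?P y'" using arrow_half(3)[OF ch' e(1) \<sigma>] by blast
  then have "?P (SOME y. ?P y)" by (rule someI)
  then obtain V' \<psi>' where c: "arrow_chart G A pos cur e t V' \<psi>'" "(SOME y. ?P y) \<in> V'" "sgn (Im (\<psi>' (SOME y. ?P y))) = \<sigma>"
    by blast
  show ?thesis
    unfolding face_near_def
    by (rule arrow_charts_face[OF ch(1) c(1) e(1,3) ch(2) _ \<sigma> y c(2,3)]) (rule arrow_chartD(2)[OF c(1) e(1)])
qed

text \<open>A chart around one point of the arrow also serves all sufficiently close parameters, so
  the face is locally constant along the connected interval of parameters.\<close>

lemma face_near_side:
  assumes e: "e \<in> arcs G" "s \<in> {0<..<1}" and \<sigma>: "\<sigma> = 1 \<or> \<sigma> = - 1"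
  shows "face_near e \<sigma> s = side e \<sigma>"
  unfolding side_def
proof (rule connected_local_const[of "{0<..<1}"])
  show "topological_space_class.connected {0<..<1::real}" by simp
  show "\<forall>a\<in>{0<..<1}. \<forall>\<^sub>F b in at a within {0<..<1}. face_near e \<sigma> a = face_near e \<sigma> b"
  proof
    fix a :: real assume a: "a \<in> {0<..<1}"
    obtain V \<psi> where ch: "arrow_chart G A pos cur e a V \<psi>" using arrow_chart_exists e(1) a by blast
    note c = arrow_chartD[OF ch e(1)]
    obtain y where y: "y \<in> V" "sgn (Im (\<psi> y)) = \<sigma>" using arrow_half(3)[OF ch e(1) \<sigma>] by blast
    have "openin (top_of_set {0..1}) {t \<in> topspace (top_of_set {0..1}). cur e t \<in> V}"
      by (rule openin_continuous_map_preimage[OF arrow_continuous[OF e(1)] chart_openin[OF c(1)]])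
    then obtain T where T: "open T" "{t \<in> {0..1}. cur e t \<in> V} = {0..1} \<inter> T"
      unfolding openin_open topspace_euclidean_subtopology by (elim exE conjE) (rule that)
    have "a \<in> {t \<in> {0..1}. cur e t \<in> V}" using a c(2) by simp
    then have "a \<in> T" unfolding T(2) by blast
    then have "\<forall>\<^sub>F b in at a within {0<..<1}. b \<in> T \<and> b \<in> {0<..<1}"
      unfolding eventually_at_topological using T(1) by blast
    then show "\<forall>\<^sub>F b in at a within {0<..<1}. face_near e \<sigma> a = face_near e \<sigma> b"
    proof (rule eventually_mono)
      fix b assume b: "b \<in> T \<and> b \<in> {0<..<1}"
      then have "b \<in> {t \<in> {0..1}. cur e t \<in> V}" unfolding T(2) by simp
      then have "cur e b \<in> V" by blast
      then show "face_near e \<sigma> a = face_near e \<sigma> b"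
        using face_near[OF e(1) a a \<sigma> ch c(2) y] face_near[OF e(1) a _ \<sigma> ch _ y, of b] b by simp
    qed
  qed
qed (use e in auto)

lemma side_eq:
  assumes "e \<in> arcs G" "s \<in> {0<..<1}" "\<sigma> = 1 \<or> \<sigma> = - 1"
    and "arrow_chart G A pos cur e s V \<psi>" "y \<in> V" "sgn (Im (\<psi> y)) = \<sigma>"
  shows "face_at y = side e \<sigma>"
  using face_near[OF assms(1,2,2,3,4) _ assms(5,6)] arrow_chartD(2)[OF assms(4,1)]
    face_near_side[OF assms(1-3)] by simp

lemma straight_side:
  assumes st: "straight e s U \<phi> u r" and \<sigma>: "\<sigma> = 1 \<or> \<sigma> = - 1"
    and z: "z \<in> U" "\<phi> z \<in> ball (\<phi> (cur e s)) r" "sgn (Im ((\<phi> z - \<phi> (cur e s)) / u)) = \<sigma>"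
  shows "face_at z = side e \<sigma>"
proof -
  have e: "e \<in> arcs G" "s \<in> {0<..<1}" using st unfolding straight_def by blast+
  then obtain V \<psi> where ch: "arrow_chart G A pos cur e s V \<psi>" using arrow_chart_exists by blast
  obtain y where y: "y \<in> V" "sgn (Im (\<psi> y)) = \<sigma>" using arrow_half(3)[OF ch e(1) \<sigma>] by blast
  show ?thesis
    using straight_face[OF st \<sigma> z ch arrow_chartD(2)[OF ch e(1)] y] side_eq[OF e \<sigma> ch y] by simp
qed

text \<open>This removes the existential quantifier over points and charts from
  \<open>on_left\<close> and \<open>on_right\<close>: whichever chart witnesses the left-hand side,
  the face is the same.\<close>

lemma arrow_half_subset_iff:
  assumes e: "e \<in> arcs G" and \<sigma>: "\<sigma> = 1 \<or> \<sigma> = - 1" and f: "f \<in> faces G X pos cur"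
  shows "(\<exists>s\<in>{0<..<1}. \<exists>U \<phi>. arrow_chart G A pos cur e s U \<phi> \<and> {x \<in> U. sgn (Im (\<phi> x)) = \<sigma>} \<subseteq> f) \<longleftrightarrow>
    f = side e \<sigma>" (is "?L \<longleftrightarrow> ?R")
proof
  assume ?L
  then obtain s U \<phi> where s: "s \<in> {0<..<1}" and ch: "arrow_chart G A pos cur e s U \<phi>"
    and sub: "{x \<in> U. sgn (Im (\<phi> x)) = \<sigma>} \<subseteq> f" by blast
  obtain y where y: "y \<in> U" "sgn (Im (\<phi> y)) = \<sigma>" using arrow_half(3)[OF ch e \<sigma>] by blast
  obtain x where x: "f = face_at x" using f unfolding faces_eq by blast
  have "y \<in> f" using y sub by blast
  then have "face_at y = f" unfolding x by (rule face_at_mem)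
  then show ?R using side_eq[OF e s \<sigma> ch y] by simp
next
  assume R: ?R
  have h: "1 / 2 \<in> {0<..<1::real}" by simp
  obtain U \<phi> where ch: "arrow_chart G A pos cur e (1 / 2) U \<phi>" using arrow_chart_exists[OF e h] by blast
  obtain y where y: "y \<in> U" "sgn (Im (\<phi> y)) = \<sigma>" using arrow_half(3)[OF ch e \<sigma>] by blast
  have "{x \<in> U. sgn (Im (\<phi> x)) = \<sigma>} \<subseteq> face_at y"
    using y by (intro subset_face_at[OF arrow_half(1,2)[OF ch e \<sigma>]]) blast
  then show ?L using R side_eq[OF e h \<sigma> ch y] ch h by metis
qed

lemma sgn_eq_1_iff: "sgn x = 1 \<longleftrightarrow> 0 < x" and sgn_eq_m1_iff: "sgn x = -1 \<longleftrightarrow> x < 0" for x :: real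
  by (auto simp: sgn_if)

lemma on_left_iff: "e \<in> arcs G \<Longrightarrow> f \<in> faces G X pos cur \<Longrightarrow> on_left G A pos cur f e \<longleftrightarrow> f = side e 1"
  using arrow_half_subset_iff[of e 1 f] by (simp add: on_left_def sgn_eq_1_iff)

lemma on_right_iff: "e \<in> arcs G \<Longrightarrow> f \<in> faces G X pos cur \<Longrightarrow> on_right G A pos cur f e \<longleftrightarrow> f = side e (- 1)"
  using arrow_half_subset_iff[of e "- 1" f] by (simp add: on_right_def sgn_eq_m1_iff)

lemma side_in_faces:
  assumes e: "e \<in> arcs G" and \<sigma>: "\<sigma> = 1 \<or> \<sigma> = - 1"
  shows "side e \<sigma> \<in> faces G X pos cur"
proof -
  have h: "1 / 2 \<in> {0<..<1::real}" by simp
  obtain U \<phi> where ch: "arrow_chart G A pos cur e (1 / 2) U \<phi>" using arrow_chart_exists[OF e h] by blast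
  obtain y where y: "y \<in> U" "sgn (Im (\<phi> y)) = \<sigma>" using arrow_half(3)[OF ch e \<sigma>] by blast
  have "y \<in> topspace X - Dr"
    using y arrow_half(2)[OF ch e \<sigma>] chart_subset[OF arrow_chartD(1)[OF ch e]] by blast
  then show ?thesis using side_eq[OF e h \<sigma> ch y] unfolding faces_eq by blast
qed

end

section \<open>Face functions without jumps are constant\<close>

section \<open>Functions on the faces\<close>

context tame_quiver
begin

lemma vertex_chart_basic:
  assumes "vertex_chart G A pos cur v U \<phi>"
  shows "(U, \<phi>) \<in> A" "pos v \<in> U" "\<phi> (pos v) = 0" "\<phi> ` U = ball 0 1"
  using assms[unfolded vertex_chart_def] by - (elim conjE, assumption)+

lemma vertex_chart_ends:
  assumes "vertex_chart G A pos cur v U \<phi>"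
  shows "\<exists>dir len. inj_on dir (ends_at G v) \<and>
    (\<forall>d\<in>ends_at G v. cmod (dir d) = 1 \<and> 0 < len d \<and> len d \<le> 1 \<and>
      end_cur cur d ` {0<..<len d} \<subseteq> U \<and>
      \<phi> ` end_cur cur d ` {0<..<len d} = {of_real r * dir d | r. 0 < r \<and> r < 1}) \<and>
    Dr \<inter> U = insert (pos v) (\<Union>d\<in>ends_at G v. end_cur cur d ` {0<..<len d})"
  using assms[unfolded vertex_chart_def] by (elim conjE)

lemma vertex_chart_arrow_point:
  assumes "vertex_chart G A pos cur v U \<phi>" "y \<in> U" "y \<in> Dr" "y \<noteq> pos v"
  shows "\<exists>e\<in>arcs G. \<exists>s\<in>{0<..<1}. y = cur e s"
proof -
  obtain dir len where len: "\<forall>d\<in>ends_at G v. cmod (dir d) = 1 \<and> 0 < len d \<and> len d \<le> 1 \<and>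
      end_cur cur d ` {0<..<len d} \<subseteq> U \<and>
      \<phi> ` end_cur cur d ` {0<..<len d} = {of_real r * dir d | r. 0 < r \<and> r < 1}"
    and D: "Dr \<inter> U = insert (pos v) (\<Union>d\<in>ends_at G v. end_cur cur d ` {0<..<len d})"
    using vertex_chart_ends[OF assms(1)] by (elim exE conjE)
  obtain d s where d: "d \<in> ends_at G v" "s \<in> {0<..<len d}" "y = end_cur cur d s"
    using D assms(2-4) by blast
  have "fst d \<in> arcs G" using d(1) by (auto simp: ends_at_def)
  moreover have "(if snd d then 1 - s else s) \<in> {0<..<1}" using d(2) len[rule_format, OF d(1)] by auto
  ultimately show ?thesis using d(3) unfolding end_cur_def by blast
qed

text \<open>Values of face functions are meaningful only off the drawing, so overlapping
  neighbourhoods can be compared only if the overlap contains such a point. Next to an arrow, one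
  finds it by moving perpendicularly in an arrow chart.\<close>

lemma drawing_nowhere_dense:
  assumes "openin X S" "x \<in> S"
  shows "\<exists>y\<in>S. y \<notin> Dr"
proof -
  have arrow: "\<exists>y\<in>S. y \<notin> Dr" if a: "e \<in> arcs G" "s \<in> {0<..<1}" "cur e s \<in> S" for e s
  proof -
    obtain V \<psi> where ch: "arrow_chart G A pos cur e s V \<psi>" using arrow_chart_exists a by blast
    note c = arrow_chartD[OF ch a(1)]
    have "\<psi> (cur e s) \<in> \<psi> ` (V \<inter> S)" using c(2) a(3) by blast
    then have "0 \<in> \<psi> ` (V \<inter> S)" unfolding c(3) .
    then obtain r where r: "0 < r" "cball 0 r \<subseteq> \<psi> ` (V \<inter> S)"
      using chart_image_open[OF c(1) assms(1)] open_contains_cball by metis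
    have "\<i> * of_real r \<in> cball 0 r" using r(1) by (simp add: norm_mult)
    then have "\<i> * of_real r \<in> \<psi> ` (V \<inter> S)" using r(2) by blast
    then obtain y where "y \<in> V" "y \<in> S" "\<i> * of_real r = \<psi> y" by blast
    then show ?thesis using c(5)[of y] r(1) by (metis Im_complex_of_real Re_complex_of_real Im_i_times less_irrefl)
  qed
  consider "x \<notin> Dr" | e s where "e \<in> arcs G" "s \<in> {0<..<1}" "x = cur e s" | v where "v \<in> verts G" "x = pos v"
    unfolding in_drawing_iff by blast
  then show ?thesis
  proof cases
    case 3
    obtain U \<phi> where ch: "vertex_chart G A pos cur v U \<phi>" using vertex_chart_exists 3 by blast
    have c: "(U, \<phi>) \<in> A" "pos v \<in> U" "\<phi> (pos v) = 0" using vertex_chart_basic[OF ch] by blast+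
    have "\<phi> (pos v) \<in> \<phi> ` (U \<inter> S)" using c(2) 3(2) assms(2) by blast
    then have "0 \<in> \<phi> ` (U \<inter> S)" unfolding c(3) .
    then obtain r where r: "0 < r" "cball 0 r \<subseteq> \<phi> ` (U \<inter> S)"
      using chart_image_open[OF c(1) assms(1)] open_contains_cball by metis
    \<comment> \<open>Any point of the neighbourhood other than the vertex will do: it is off the
      drawing or inside an arrow, and the second case has been settled.\<close>
    have "of_real r \<in> cball (0::complex) r" using r(1) by simp
    then have "of_real r \<in> \<phi> ` (U \<inter> S)" using r(2) by blast
    then obtain y where y: "y \<in> U" "y \<in> S" "of_real r = \<phi> y" by blast
    then have "y \<noteq> pos v" using c(3) r(1) by auto
    then show ?thesis using y vertex_chart_arrow_point[OF ch y(1)] arrow by blast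
  qed (use arrow assms in auto)
qed

text \<open>The usual connectedness argument, except that \<open>g\<close> is controlled only off a
  nowhere dense set while the neighbourhoods may cross it. The open sets where \<open>g\<close> is
  constantly \<open>g y\<close> and where it is constantly something else cover \<open>P\<close>;
  they are disjoint because an overlap would contain a point off the drawing.\<close>

lemma locally_constant_off_drawing:
  assumes P: "connectedin X P"
    and loc: "\<And>x. x \<in> P \<Longrightarrow> \<exists>N k. openin X N \<and> x \<in> N \<and> (\<forall>y\<in>N - Dr. g y = k)"
    and y: "y \<in> P - Dr" "y' \<in> P - Dr"
  shows "g y = g y'"
proof -
  define S1 where "S1 = \<Union>{N. openin X N \<and> (\<forall>z\<in>N - Dr. g z = g y)}"
  define S2 where "S2 = \<Union>{N. openin X N \<and> (\<exists>k. k \<noteq> g y \<and> (\<forall>z\<in>N - Dr. g z = k))}"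
  have o: "openin X S1" "openin X S2" unfolding S1_def S2_def by blast+
  have cover: "P \<subseteq> S1 \<union> S2"
  proof
    fix x assume "x \<in> P"
    then obtain N k where "openin X N" "x \<in> N" "\<forall>z\<in>N - Dr. g z = k" using loc by blast
    then show "x \<in> S1 \<union> S2" unfolding S1_def S2_def by (cases "k = g y") blast+
  qed
  have disj: "S1 \<inter> S2 = {}"
  proof (rule ccontr)
    assume "S1 \<inter> S2 \<noteq> {}"
    then obtain x N N' k where N: "x \<in> N \<inter> N'" "openin X N" "openin X N'"
      "\<forall>z\<in>N - Dr. g z = g y" "k \<noteq> g y" "\<forall>z\<in>N' - Dr. g z = k"
      unfolding S1_def S2_def by blast
    obtain z where "z \<in> N \<inter> N'" "z \<notin> Dr"
      using drawing_nowhere_dense[OF openin_Int[OF N(2,3)] N(1)] by blast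
    then show False using N(4-6) by (metis DiffI IntD1 IntD2)
  qed
  have "y \<notin> S2"
  proof
    assume "y \<in> S2"
    then obtain N k where "y \<in> N" "k \<noteq> g y" "\<forall>z\<in>N - Dr. g z = k" unfolding S2_def by blast
    then show False using y(1) by (metis DiffD2 DiffI)
  qed
  then have "y \<in> S1 \<inter> P" using cover y(1) by blast
  then have "S2 \<inter> P = {}" using P o cover disj unfolding connectedin by blast
  then have "y' \<in> S1" using cover y(2) by blast
  then obtain N where "y' \<in> N" "\<forall>z\<in>N - Dr. g z = g y" unfolding S1_def by blast
  then show ?thesis using y(2) by (metis DiffD2 DiffI)
qed

text \<open>Off the drawing, a small disc lies in one face. On an arrow, the two half discs lie in
  the faces beside it, and there \<open>c\<close> takes the same value by assumption.\<close>

lemma locally_constant_off_vertices: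
  assumes c: "\<And>e. e \<in> arcs G \<Longrightarrow> c (side e 1) = c (side e (- 1))"
    and x: "x \<in> topspace X" "x \<notin> pos ` verts G"
  shows "\<exists>N k. openin X N \<and> x \<in> N \<and> (\<forall>y\<in>N - Dr. c (face_at y) = k)"
proof (cases "x \<in> Dr")
  case True
  then obtain e s where e: "e \<in> arcs G" "s \<in> {0<..<1}" "x = cur e s"
    using x(2) unfolding in_drawing_iff by blast
  obtain V \<psi> where ch: "arrow_chart G A pos cur e s V \<psi>" using arrow_chart_exists e by blast
  note a = arrow_chartD[OF ch e(1)]
  have "c (face_at y) = c (side e 1)" if y: "y \<in> V - Dr" for y
  proof -
    have "sgn (Im (\<psi> y)) \<noteq> 0" using a(5)[of y] y by (auto simp: sgn_0_0)
    then have s: "sgn (Im (\<psi> y)) = 1 \<or> sgn (Im (\<psi> y)) = - 1" by (auto simp: sgn_if)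
    have "face_at y = side e (sgn (Im (\<psi> y)))" using y by (intro side_eq[OF e(1,2) s ch]) auto
    then show ?thesis using s c[OF e(1)] by auto
  qed
  then show ?thesis using chart_openin[OF a(1)] a(2) e(3) by blast
next
  case False
  obtain U \<phi> where U: "(U, \<phi>) \<in> A" "x \<in> U" using chart_cover[OF x(1)] by blast
  have "openin X (topspace X - Dr)" using drawing_closed by blast
  from chart_image_open[OF U(1) this] have "open (\<phi> ` (U \<inter> (topspace X - Dr)))" .
  moreover have "\<phi> x \<in> \<phi> ` (U \<inter> (topspace X - Dr))" using U(2) False x(1) by blast
  ultimately obtain r where r: "0 < r" "ball (\<phi> x) r \<subseteq> \<phi> ` (U \<inter> (topspace X - Dr))"
    using open_contains_ball by metis
  define N where "N = {y \<in> U. \<phi> y \<in> ball (\<phi> x) r}"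
  have N: "openin X N" unfolding N_def by (rule chart_preimage_openin[OF U(1) open_ball])
  have "connectedin X N" unfolding N_def
    by (rule chart_preimage_connectedin[OF U(1)]) (use r(2) in auto)
  moreover have "N \<inter> Dr = {}"
  proof -
    have "y \<notin> Dr" if y: "y \<in> N" for y
    proof -
      obtain y' where "\<phi> y = \<phi> y'" "y' \<in> U" "y' \<notin> Dr" using r(2) y unfolding N_def by blast
      then show ?thesis using inj_onD[OF chart_inj[OF U(1)], of y y'] y unfolding N_def by blast
    qed
    then show ?thesis by blast
  qed
  moreover have "x \<in> N" using U(2) r(1) by (simp add: N_def)
  ultimately have "\<forall>y\<in>N - Dr. c (face_at y) = c (face_at x)" using face_at_eqI by (metis DiffD1)
  then show ?thesis using N \<open>x \<in> N\<close> by blast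
qed

text \<open>The punctured disc around a vertex is connected and contains no vertex, so local
  constancy along the arrows already gives constancy on all of it. The individual sectors need not
  be examined.\<close>

lemma locally_constant_near_vertex:
  assumes c: "\<And>e. e \<in> arcs G \<Longrightarrow> c (side e 1) = c (side e (- 1))" and v: "v \<in> verts G"
  shows "\<exists>N k. openin X N \<and> pos v \<in> N \<and> (\<forall>y\<in>N - Dr. c (face_at y) = k)"
proof -
  obtain U \<phi> where ch: "vertex_chart G A pos cur v U \<phi>" using vertex_chart_exists v by blast
  have a: "(U, \<phi>) \<in> A" "pos v \<in> U" "\<phi> (pos v) = 0" "\<phi> ` U = ball 0 1" using vertex_chart_basic[OF ch] by blast+
  define P where "P = {y \<in> U. \<phi> y \<in> ball 0 1 - {0}}"
  have "topological_space_class.connected (ball (0::complex) 1 - {0})"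
    by (rule connected_punctured_ball) simp
  then have P: "connectedin X P"
    unfolding P_def by (rule chart_preimage_connectedin[OF a(1)]) (simp add: a(4) Diff_subset)
  have U: "y \<in> P" if "y \<in> U" "y \<noteq> pos v" for y
  proof -
    have "\<phi> y \<noteq> 0" using inj_onD[OF chart_inj[OF a(1)], of y "pos v"] that a(2,3) by auto
    moreover have "\<phi> y \<in> ball 0 1" using a(4) that(1) by blast
    ultimately show ?thesis using that(1) unfolding P_def by blast
  qed
  have notv: "x \<notin> pos ` verts G" if x: "x \<in> P" for x
  proof
    assume "x \<in> pos ` verts G"
    then obtain w where w: "w \<in> verts G" "x = pos w" by blast
    have "x \<in> U" "x \<noteq> pos v" using x a(3) unfolding P_def by auto
    moreover have "x \<in> Dr" using w unfolding in_drawing_iff by blast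
    ultimately show False using vertex_chart_arrow_point[OF ch] arrow_point_not_vertex w by metis
  qed
  have eq: "c (face_at y) = c (face_at y')" if y: "y \<in> P - Dr" "y' \<in> P - Dr" for y y'
  proof (rule locally_constant_off_drawing[OF P _ y])
    fix x assume x: "x \<in> P"
    then have "x \<in> topspace X" using chart_subset[OF a(1)] unfolding P_def by blast
    then show "\<exists>N k. openin X N \<and> x \<in> N \<and> (\<forall>y\<in>N - Dr. c (face_at y) = k)"
      by (intro locally_constant_off_vertices[where c = c, OF c] notv[OF x])
  qed
  have "\<exists>k. \<forall>y\<in>U - Dr. c (face_at y) = k"
  proof (cases "U - Dr = {}")
    case False
    then obtain y0 where y0: "y0 \<in> U - Dr" by blast
    have "pos v \<in> Dr" using v unfolding in_drawing_iff by blast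
    then have "U - Dr \<subseteq> P - Dr" using U by blast
    then show ?thesis using eq y0 by blast
  qed blast
  then show ?thesis using chart_openin[OF a(1)] a(2) by blast
qed

text \<open>The surface is connected, hence so is the dual graph.\<close>

lemma face_function_constant:
  assumes c: "\<And>e. e \<in> arcs G \<Longrightarrow> c (side e 1) = c (side e (- 1))"
    and f: "f \<in> faces G X pos cur" "f' \<in> faces G X pos cur"
  shows "c f = c f'"
proof -
  obtain y y' where y: "y \<in> topspace X - Dr" "y' \<in> topspace X - Dr" "f = face_at y" "f' = face_at y'"
    using f unfolding faces_eq by blast
  have "connected_space X" using surface unfolding closed_oriented_surface_def by blast
  then have X: "connectedin X (topspace X)" by (simp add: connectedin_topspace)
  have "c (face_at y) = c (face_at y')"
  proof (rule locally_constant_off_drawing[OF X _ y(1,2)])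
    fix x assume x: "x \<in> topspace X"
    show "\<exists>N k. openin X N \<and> x \<in> N \<and> (\<forall>y\<in>N - Dr. c (face_at y) = k)"
    proof (cases "x \<in> pos ` verts G")
      case True
      then show ?thesis using locally_constant_near_vertex[where c = c, OF c] by blast
    next
      case False
      then show ?thesis by (intro locally_constant_off_vertices[where c = c, OF c x])
    qed
  qed
  then show ?thesis by (simp add: y)
qed

end

section \<open>Vertex charts as straightening charts of the incident arrows\<close>

section \<open>Arrow ends in a vertex chart\<close>

text \<open>Telescoping for a step function with finitely many jumps and one-sided values
  \<open>L\<close> and \<open>R\<close>: the induction splits off the largest jump.\<close>

lemma sum_jumps:
  fixes g :: "real \<Rightarrow> 'a::ab_group_add"
  assumes "finite S" "S \<subseteq> {a<..<b}" "a \<le> b"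
    and "\<And>x y. a \<le> x \<Longrightarrow> x \<le> y \<Longrightarrow> y \<le> b \<Longrightarrow> {x..y} \<inter> S = {} \<Longrightarrow> g x = g y"
    and "\<And>s. s \<in> S \<Longrightarrow> \<exists>\<epsilon>>0. \<forall>t. 0 < t \<and> t < \<epsilon> \<longrightarrow> g (s + t) = R s \<and> g (s - t) = L s"
  shows "(\<Sum>s\<in>S. R s - L s) = g b - g a"
  using assms
proof (induction S arbitrary: b rule: finite_linorder_max_induct)
  case empty
  then show ?case by simp
next
  case (insert m S)
  obtain \<epsilon> where \<epsilon>: "\<epsilon> > 0" "\<And>t. 0 < t \<Longrightarrow> t < \<epsilon> \<Longrightarrow> g (m + t) = R m \<and> g (m - t) = L m"
    using insert.prems(4)[of m] by blast
  \<comment> \<open>The jump preceding \<open>m\<close>, or the left end of the interval if there is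
    none.\<close>
  define l where "l = Max (insert a S)"
  have l: "a \<le> l" "\<And>s. s \<in> S \<Longrightarrow> s \<le> l" using insert.hyps by (auto simp: l_def)
  have "l \<in> insert a S" unfolding l_def using insert.hyps by (intro Max_in) auto
  then have "l < m" using insert.hyps(2) insert.prems(1) by auto
  \<comment> \<open>Half of the minimum, so that \<open>m - t\<close> and \<open>m + t\<close> are
    strictly inside the two plateaus next to \<open>m\<close> and within the range of the one-sided
    values.\<close>
  define t where "t = min \<epsilon> (min (m - l) (b - m)) / 2"
  have t: "0 < t" "t < \<epsilon>" "t < m - l" "t < b - m"
    using \<epsilon>(1) \<open>l < m\<close> insert.prems(1) by (auto simp: t_def)
  have "(\<Sum>s\<in>S. R s - L s) = g (m - t) - g a"
  proof (rule insert.IH)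
    show "S \<subseteq> {a<..<m - t}" using l t insert.prems(1) by fastforce
    show "a \<le> m - t" using l t by simp
    show "g x = g y" if "a \<le> x" "x \<le> y" "y \<le> m - t" "{x..y} \<inter> S = {}" for x y
      using that t by (intro insert.prems(3)) auto
    show "\<exists>\<epsilon>>0. \<forall>t. 0 < t \<and> t < \<epsilon> \<longrightarrow> g (s + t) = R s \<and> g (s - t) = L s" if "s \<in> S" for s
      using insert.prems(4) that by blast
  qed
  moreover have "g (m + t) = g b"
    using t l \<open>l < m\<close> by (intro insert.prems(3)) fastforce+
  moreover have "m \<notin> S" using insert.hyps(2) by blast
  ultimately show ?case using \<epsilon>(2)[OF t(1,2)] insert.hyps(1) by simp
qed

text \<open>A continuous injection of an interval is monotone, and the comparison with the value at
  0 excludes that it decreases.\<close>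

lemma continuous_inj_increasing:
  fixes \<xi> :: "real \<Rightarrow> real"
  assumes "continuous_on {0..<l} \<xi>" "inj_on \<xi> {0..<l}" "\<And>t. 0 < t \<Longrightarrow> t < l \<Longrightarrow> \<xi> 0 < \<xi> t"
    and "0 < s" "0 < t" "s < l" "t < l"
  shows "sgn (\<xi> s - \<xi> t) = sgn (s - t)"
proof -
  have *: "\<xi> a < \<xi> b" if "0 < a" "a < b" "b < l" for a b
    using continuous_inj_imp_mono[of 0 a b \<xi>] continuous_on_subset[OF assms(1), of "{0..b}"]
      inj_on_subset[OF assms(2), of "{0..b}"] assms(3)[of b] that by fastforce
  show ?thesis using *[of s t] *[of t s] assms(4-7) by (cases s t rule: linorder_cases) auto
qed

context tame_quiver
begin

lemma finite_ends_at: "finite (ends_at G v)"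
  by (rule finite_subset[of _ "arcs G \<times> UNIV"]) (auto simp: ends_at_def)

lemma end_curD:
  assumes "d \<in> ends_at G v"
  shows "fst d \<in> arcs G" "end_cur cur d 0 = pos v"
    and "continuous_map (top_of_set {0..1}) X (end_cur cur d)"
proof -
  show a: "fst d \<in> arcs G" using assms by (auto simp: ends_at_def)
  show "end_cur cur d 0 = pos v"
    using assms arrow_ends by (cases d) (auto simp: ends_at_def end_cur_def split: if_splits)
  have "continuous_map (top_of_set {0..1}) (top_of_set {0..1}) (\<lambda>s. if snd d then 1 - s else s :: real)"
    by (auto simp: continuous_map_in_subtopology intro!: continuous_intros)
  from continuous_map_compose[OF this arrow_continuous[OF a]]
  show "continuous_map (top_of_set {0..1}) X (end_cur cur d)"
    by (simp add: o_def end_cur_def[abs_def])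
qed

text \<open>A vertex chart describes an arrow end only as a set, namely a radius. That the end runs
  along it monotonically outwards is recovered from continuity and injectivity.\<close>

lemma vertex_end_radius:
  assumes ch: "vertex_chart G A pos cur v U \<phi>" and d: "d \<in> ends_at G v"
    and len: "cmod u = 1" "0 < l" "l \<le> 1" "end_cur cur d ` {0<..<l} \<subseteq> U"
      "\<phi> ` end_cur cur d ` {0<..<l} = {of_real r * u | r. 0 < r \<and> r < 1}"
  defines "\<xi> \<equiv> \<lambda>t. cmod (\<phi> (end_cur cur d t))"
  shows "\<And>t. 0 < t \<Longrightarrow> t < l \<Longrightarrow> \<phi> (end_cur cur d t) = of_real (\<xi> t) * u"
    and "\<And>s t. 0 < s \<Longrightarrow> 0 < t \<Longrightarrow> s < l \<Longrightarrow> t < l \<Longrightarrow> sgn (\<xi> s - \<xi> t) = sgn (s - t)"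
    and "\<exists>t. 0 < t \<and> t < l \<and> \<xi> t = 1 / 2"
proof -
  note c = vertex_chart_basic[OF ch]
  note e = end_curD[OF d]
  have rad: "\<phi> (end_cur cur d t) = of_real (\<xi> t) * u \<and> 0 < \<xi> t" if t: "0 < t" "t < l" for t
  proof -
    have "\<phi> (end_cur cur d t) \<in> \<phi> ` end_cur cur d ` {0<..<l}" using t by auto
    then obtain r where "\<phi> (end_cur cur d t) = of_real r * u" "0 < r" unfolding len(5) by blast
    then show ?thesis using len(1) by (simp add: \<xi>_def norm_mult)
  qed
  then show "\<phi> (end_cur cur d t) = of_real (\<xi> t) * u" if "0 < t" "t < l" for t using that by blast
  have \<xi>0: "\<xi> 0 = 0" using c(3) e(2) by (simp add: \<xi>_def)
  have U: "end_cur cur d t \<in> U" if "0 \<le> t" "t < l" for t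
  proof (cases "t = 0")
    case True
    then show ?thesis using c(2) e(2) by simp
  next
    case False
    then have "t \<in> {0<..<l}" using that by simp
    then show ?thesis using len(4) by blast
  qed
  have "continuous_map (top_of_set {0..<l}) X (end_cur cur d)"
    by (rule continuous_map_from_subtopology_mono[OF e(3)]) (use len(3) in auto)
  then have "continuous_map (top_of_set {0..<l}) (subtopology X U) (end_cur cur d)"
    using U by (simp add: continuous_map_in_subtopology image_subset_iff)
  from continuous_map_compose[OF this chart_continuous[OF c(1)]]
  have cont: "continuous_on {0..<l} \<xi>"
    unfolding \<xi>_def by (intro continuous_intros) (simp add: o_def)
  have inj: "inj_on \<xi> {0..<l}"
  proof (rule inj_onI)
    fix s t assume st: "s \<in> {0..<l}" "t \<in> {0..<l}" "\<xi> s = \<xi> t"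
    show "s = t"
    proof (cases "s = 0 \<or> t = 0")
      case True
      have "\<not> (0 < s)" "\<not> (0 < t)" using rad[of s] rad[of t] st \<xi>0 True by auto
      then show ?thesis using st by auto
    next
      case False
      then have "\<phi> (end_cur cur d s) = \<phi> (end_cur cur d t)" using rad[of s] rad[of t] st by simp
      then have "end_cur cur d s = end_cur cur d t"
        using inj_onD[OF chart_inj[OF c(1)]] U st by (meson atLeastLessThan_iff)
      then have "cur (fst d) (if snd d then 1 - s else s) = cur (fst d) (if snd d then 1 - t else t)"
        by (simp add: end_cur_def)
      moreover have "(if snd d then 1 - s else s) \<in> {0<..<1}" "(if snd d then 1 - t else t) \<in> {0<..<1}"
        using False st len(3) by auto
      ultimately have "(if snd d then 1 - s else s) = (if snd d then 1 - t else t)"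
        using arrow_point_inj(2)[OF e(1) e(1)] by blast
      then show ?thesis by (simp split: if_splits)
    qed
  qed
  show "sgn (\<xi> s - \<xi> t) = sgn (s - t)" if "0 < s" "0 < t" "s < l" "t < l" for s t
    by (rule continuous_inj_increasing[OF cont inj _ that]) (use rad \<xi>0 in simp)
  \<comment> \<open>The midpoint of the radius is where the circle used for walking around the
    vertex crosses it.\<close>
  have "of_real (1 / 2) * u \<in> \<phi> ` end_cur cur d ` {0<..<l}"
    unfolding len(5) by (intro CollectI exI[of _ "1 / 2"]) simp
  then obtain t where t: "t \<in> {0<..<l}" "of_real (1 / 2) * u = \<phi> (end_cur cur d t)" by blast
  have "\<xi> t = cmod (of_real (1 / 2) * u)" unfolding \<xi>_def t(2) ..
  also have "\<dots> = 1 / 2" using len(1) by (simp add: norm_mult)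
  finally show "\<exists>t. 0 < t \<and> t < l \<and> \<xi> t = 1 / 2" using t(1) by auto
qed

text \<open>The set \<open>F\<close> of directions is finite, hence closed, and \<open>sgn\<close>
  is continuous away from 0. A radius below 1/2 keeps the disc around \<open>w / 2\<close> away from
  the centre and inside the unit disc.\<close>

lemma radius_isolated:
  fixes F :: "complex set"
  assumes "finite F" "cmod w = 1" "w \<notin> F"
  shows "\<exists>\<rho>>0. \<rho> < 1 / 2 \<and> (\<forall>z\<in>cball (w / 2) \<rho>. sgn z \<notin> F)"
proof -
  have w: "w \<noteq> 0" using assms by auto
  have "isCont sgn (w / 2)" using w by (intro continuous_intros) auto
  moreover have "open (- F)" "sgn (w / 2) \<in> - F"
    using assms by (auto simp: sgn_div_norm finite_imp_closed scaleR_conv_of_real)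
  ultimately have "\<forall>\<^sub>F z in at (w / 2). sgn z \<in> - F"
    unfolding isCont_def by (intro topological_tendstoD)
  then obtain \<epsilon> where \<epsilon>: "\<epsilon> > 0" "\<And>z. z \<noteq> w / 2 \<Longrightarrow> dist z (w / 2) < \<epsilon> \<Longrightarrow> sgn z \<notin> F"
    unfolding eventually_at by auto
  have \<epsilon>': "sgn z \<notin> F" if "dist z (w / 2) < \<epsilon>" for z
    using \<epsilon>(2)[OF _ that] \<open>sgn (w / 2) \<in> - F\<close> by blast
  define \<rho> where "\<rho> = min (\<epsilon> / 2) (1 / 4)"
  have "0 < \<rho>" "\<rho> < 1 / 2" "\<rho> < \<epsilon>" using \<epsilon>(1) by (auto simp: \<rho>_def)
  then show ?thesis using \<epsilon>' by (intro exI[of _ \<rho>]) (auto simp: dist_commute)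
qed

text \<open>This is what connects the two kinds of charts. At its head an arrow runs towards the
  vertex, against the outward radius, whence the sign in \<open>u\<close>.\<close>

lemma vertex_end_straight:
  assumes ch: "vertex_chart G A pos cur v U \<phi>" and d: "d \<in> ends_at G v" and inj: "inj_on dir (ends_at G v)"
    and len: "\<forall>d\<in>ends_at G v. cmod (dir d) = 1 \<and> 0 < len d \<and> len d \<le> 1 \<and>
      end_cur cur d ` {0<..<len d} \<subseteq> U \<and>
      \<phi> ` end_cur cur d ` {0<..<len d} = {of_real r * dir d | r. 0 < r \<and> r < 1}"
    and D: "Dr \<inter> U = insert (pos v) (\<Union>d\<in>ends_at G v. end_cur cur d ` {0<..<len d})"
  defines "u \<equiv> of_real (if snd d then - 1 else 1) * dir d"
  shows "\<exists>s \<rho>. straight (fst d) s U \<phi> u \<rho> \<and> \<phi> (cur (fst d) s) = dir d / 2"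
proof -
  note c = vertex_chart_basic[OF ch]
  note e = end_curD[OF d]
  have ends: "cmod (dir d) = 1" "0 < len d" "len d \<le> 1"
    "end_cur cur d ` {0<..<len d} \<subseteq> U"
    "\<phi> ` end_cur cur d ` {0<..<len d} = {of_real r * dir d | r. 0 < r \<and> r < 1}"
    if "d \<in> ends_at G v" for d using bspec[OF len that] by - (elim conjE, assumption)+
  note l = ends[OF d]
  define \<xi> where "\<xi> t = cmod (\<phi> (end_cur cur d t))" for t
  note rad = vertex_end_radius[OF ch d l, folded \<xi>_def]
  obtain t where t: "0 < t" "t < len d" "\<xi> t = 1 / 2" using rad(3) by blast
  define par where "par t = (if snd d then 1 - t else t)" for t :: real
  have par: "end_cur cur d t = cur (fst d) (par t)" for t by (simp add: end_cur_def par_def)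
  have par01: "par t \<in> {0<..<1}" if "0 < t" "t < len d" for t using that l(3) by (auto simp: par_def)
  have x: "\<phi> (cur (fst d) (par t)) = dir d / 2" using rad(1)[OF t(1,2)] t(3) par[of t] by simp
  have "finite (dir ` (ends_at G v - {d}))" using finite_ends_at by blast
  moreover have "dir d \<notin> dir ` (ends_at G v - {d})" using inj d by (auto dest: inj_onD)
  ultimately have "\<exists>\<rho>>0. \<rho> < 1 / 2 \<and> (\<forall>z\<in>cball (dir d / 2) \<rho>. sgn z \<notin> dir ` (ends_at G v - {d}))"
    by (intro radius_isolated l(1))
  then obtain \<rho> where \<rho>: "0 < \<rho>" "\<rho> < 1 / 2"
    "\<And>z. z \<in> cball (dir d / 2) \<rho> \<Longrightarrow> sgn z \<notin> dir ` (ends_at G v - {d})"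
    by blast
  have d0: "dir d \<noteq> 0" "u \<noteq> 0" using l(1) by (auto simp: u_def)
  have u1: "cmod u = 1" using l(1) by (simp add: u_def norm_mult)
  define \<tau> :: real where "\<tau> = (if snd d then - 1 else 1)"
  have \<tau>: "\<tau> * \<tau> = 1" "\<tau> \<noteq> 0" by (auto simp: \<tau>_def)
  have u: "u = of_real \<tau> * dir d" by (simp add: u_def \<tau>_def)
  \<comment> \<open>The disc lies on the positive side of the radius and inside the chart, so a
    point of it on the line through \<open>dir d\<close> is on the radius itself.\<close>
  have near: "0 < Re (z / dir d) \<and> cmod z < 1" if z: "z \<in> cball (dir d / 2) \<rho>" for z
  proof -
    have "cmod (z - dir d / 2) < 1 / 2" using z \<rho>(2) by (simp add: dist_norm norm_minus_commute)
    then have *: "cmod ((z - dir d / 2) / dir d) < 1 / 2" using l(1) by (simp add: norm_divide)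
    have "(z - dir d / 2) / dir d = z / dir d - 1 / 2" using d0 by (simp add: diff_divide_distrib)
    then have "\<bar>Re (z / dir d) - 1 / 2\<bar> < 1 / 2" using * abs_Re_le_cmod[of "z / dir d - 1 / 2"] by simp
    then have "0 < Re (z / dir d)" unfolding abs_less_iff by linarith
    moreover have "cmod z \<le> cmod (z - dir d / 2) + cmod (dir d / 2)" by (metis diff_add_cancel norm_triangle_ineq)
    ultimately show ?thesis using \<open>cmod (z - dir d / 2) < 1 / 2\<close> l(1) by (auto simp: norm_divide)
  qed
  \<comment> \<open>Dividing by the sign \<open>\<tau>\<close> is the same as multiplying by
    it.\<close>
  have quot: "(z - dir d / 2) / u = of_real \<tau> * (z / dir d - 1 / 2)" for z
  proof -
    have "(z - dir d / 2) / u = (z / dir d - 1 / 2) / of_real \<tau>"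
      unfolding u using d0(1) \<tau>(2) by (simp add: field_simps)
    then show ?thesis by (simp add: \<tau>_def)
  qed
  \<comment> \<open>By the choice of \<open>\<rho>\<close>, no radius other than that of
    \<open>d\<close> meets the disc.\<close>
  have on: "\<exists>t'. 0 < t' \<and> t' < len d \<and> y = end_cur cur d t'" if y: "y \<in> U" "\<phi> y \<in> cball (dir d / 2) \<rho>" "y \<in> Dr" for y
  proof -
    have "y \<noteq> pos v" using near[OF y(2)] c(3) by auto
    moreover have "y \<in> Dr \<inter> U" using y by blast
    ultimately obtain d' t' where d': "d' \<in> ends_at G v" "t' \<in> {0<..<len d'}" "y = end_cur cur d' t'"
      unfolding D by blast
    then have "\<phi> y \<in> \<phi> ` end_cur cur d' ` {0<..<len d'}" by blast
    then obtain r where r: "\<phi> y = of_real r * dir d'" "0 < r" unfolding ends(5)[OF d'(1)] by blast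
    then have "sgn (\<phi> y) = dir d'" using ends(1)[OF d'(1)] by (simp add: sgn_div_norm norm_mult scaleR_conv_of_real)
    then have "d' = d" using \<rho>(3)[OF y(2)] d'(1) by blast
    then show ?thesis using d' by auto
  qed
  have "straight (fst d) (par t) U \<phi> u \<rho>"
    unfolding straight_def x
  proof (intro conjI ballI impI)
    show "cur (fst d) (par t) \<in> U" using subsetD[OF l(4), of "end_cur cur d t"] t(1,2) unfolding par[symmetric] by simp
    show "cball (dir d / 2) \<rho> \<subseteq> \<phi> ` U" using near unfolding c(4) by auto
    fix y assume y: "y \<in> U" "\<phi> y \<in> cball (dir d / 2) \<rho>"
    show "y \<in> Dr \<longleftrightarrow> Im ((\<phi> y - dir d / 2) / u) = 0"
    proof
      assume "y \<in> Dr"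
      then obtain t' where t': "0 < t'" "t' < len d" "y = end_cur cur d t'" using on y by blast
      have "\<phi> y / dir d = of_real (\<xi> t')" using rad(1)[OF t'(1,2)] t'(3) d0 by simp
      then show "Im ((\<phi> y - dir d / 2) / u) = 0" unfolding quot by simp
    next
      assume "Im ((\<phi> y - dir d / 2) / u) = 0"
      then have "Im (\<phi> y / dir d) = 0" unfolding quot using \<tau> by simp
      then have "\<phi> y / dir d = of_real (Re (\<phi> y / dir d))" by (simp add: complex_eq_iff)
      then have eq: "\<phi> y = of_real (Re (\<phi> y / dir d)) * dir d" using d0(1) by (metis nonzero_divide_eq_eq)
      have "cmod (\<phi> y) = \<bar>Re (\<phi> y / dir d)\<bar>" using l(1) by (subst eq) (simp add: norm_mult)
      then have "Re (\<phi> y / dir d) < 1" using near[OF y(2)] by simp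
      then have "\<phi> y \<in> \<phi> ` end_cur cur d ` {0<..<len d}" unfolding l(5)
        by (intro CollectI exI[of _ "Re (\<phi> y / dir d)"] conjI eq) (use near[OF y(2)] in simp)
      then obtain y' where y': "y' \<in> end_cur cur d ` {0<..<len d}" "\<phi> y = \<phi> y'" by blast
      then have "y' \<in> U" using l(4) by blast
      then have "y = y'" using inj_onD[OF chart_inj[OF c(1)] y'(2)] y(1) by blast
      then have "y \<in> (\<Union>d\<in>ends_at G v. end_cur cur d ` {0<..<len d})" using y'(1) d by blast
      then have "y \<in> Dr \<inter> U" unfolding D by blast
      then show "y \<in> Dr" by blast
    qed
    assume "y \<in> Dr"
    then obtain t' where t': "0 < t'" "t' < len d" "y = end_cur cur d t'" using on y by blast
    have q: "\<phi> y / dir d = of_real (\<xi> t')" using rad(1)[OF t'(1,2)] t'(3) d0 by simp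
    have "Re ((\<phi> y - dir d / 2) / u) = \<tau> * (\<xi> t' - \<xi> t)" unfolding quot q t(3) by simp
    then have "sgn (Re ((\<phi> y - dir d / 2) / u)) = sgn \<tau> * sgn (t' - t)"
      using rad(2)[OF t'(1) t(1) t'(2) t(2)] by (simp add: sgn_mult)
    \<comment> \<open>\<open>par\<close> reverses the order exactly when \<open>\<tau>\<close> is
      -1, so the two sign changes cancel.\<close>
    also have "\<dots> = sgn (par t' - par t)" by (auto simp: \<tau>_def par_def sgn_if)
    finally show "\<exists>s'\<in>{0<..<1}. y = cur (fst d) s' \<and> sgn (Re ((\<phi> y - dir d / 2) / u)) = sgn (s' - par t)"
      using par01[OF t'(1,2)] t'(3) par by blast
  qed (use c(1) e(1) par01[OF t(1,2)] u1 \<rho>(1) in simp_all)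
  then show ?thesis using x by blast
qed

end

section \<open>Jumps around a vertex add up to zero\<close>

section \<open>Conservation at the vertices\<close>

lemma cis_eq_imp_eq:
  assumes "cis s = cis t" "\<bar>s - t\<bar> < 2 * pi"
  shows "s = t"
proof -
  have "exp (\<i> * of_real s) = exp (\<i> * of_real t)" using assms(1) by (simp add: cis_conv_exp)
  then obtain n :: int where "\<i> * of_real s = \<i> * of_real t + of_int (2 * n) * pi * \<i>"
    unfolding exp_eq by blast
  then have "Im (\<i> * of_real s) = Im (\<i> * of_real t + of_int (2 * n) * pi * \<i>)" by simp
  then have n: "s - t = 2 * pi * n" by simp
  then have "2 * pi * \<bar>real_of_int n\<bar> < 2 * pi * 1" using assms(2) by (simp add: abs_mult)
  then have "n = 0" by simp
  then show ?thesis using n by simp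
qed

context tame_quiver
begin

text \<open>Go once around the vertex.\<close>

lemma sum_jumps_around_vertex:
  fixes c :: "'s set \<Rightarrow> 'a::ab_group_add"
  assumes v: "v \<in> verts G"
  defines "\<tau> \<equiv> \<lambda>d :: 'e \<times> bool. if snd d then - 1 else 1 :: real"
  shows "(\<Sum>d\<in>ends_at G v. c (side (fst d) (\<tau> d)) - c (side (fst d) (- \<tau> d))) = 0"
proof -
  obtain U \<phi> where ch: "vertex_chart G A pos cur v U \<phi>" using vertex_chart_exists v by blast
  note b = vertex_chart_basic[OF ch]
  obtain dir len where inj: "inj_on dir (ends_at G v)"
    and len: "\<forall>d\<in>ends_at G v. cmod (dir d) = 1 \<and> 0 < len d \<and> len d \<le> 1 \<and>
      end_cur cur d ` {0<..<len d} \<subseteq> U \<and>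
      \<phi> ` end_cur cur d ` {0<..<len d} = {of_real r * dir d | r. 0 < r \<and> r < 1}"
    and D: "Dr \<inter> U = insert (pos v) (\<Union>d\<in>ends_at G v. end_cur cur d ` {0<..<len d})"
    using vertex_chart_ends[OF ch] by (elim exE conjE)
  have norm_dir: "cmod (dir d) = 1" if "d \<in> ends_at G v" for d using bspec[OF len that] by (elim conjE)
  have radius: "\<phi> ` end_cur cur d ` {0<..<len d} = {of_real r * dir d | r. 0 < r \<and> r < 1}"
    if "d \<in> ends_at G v" for d using bspec[OF len that] by (elim conjE)
  \<comment> \<open>The walk must start and end between two radii. Finitely many directions cannot
    exhaust an arc.\<close>
  have "\<exists>a. cis a \<notin> dir ` ends_at G v"
  proof (rule ccontr)
    assume "\<nexists>a. cis a \<notin> dir ` ends_at G v"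
    then have "cis ` {0<..<pi} \<subseteq> dir ` ends_at G v" by blast
    then have "finite (cis ` {0<..<pi})" using finite_ends_at finite_subset by blast
    moreover have "inj_on cis {0<..<pi}" by (auto intro!: inj_onI cis_eq_imp_eq)
    ultimately have "finite {0<..<pi}" by (simp add: finite_image_iff)
    then show False using pi_gt_zero by (simp add: infinite_Ioo)
  qed
  then obtain a where a: "cis a \<notin> dir ` ends_at G v" by blast
  \<comment> \<open>The angle of the radius of \<open>d\<close>, taken in the open interval from
    \<open>a\<close> to \<open>a + 2 * pi\<close>, on which \<open>cis\<close> is injective.\<close>
  define \<theta> where "\<theta> d = a + Arg2pi (dir d / cis a)" for d
  have \<theta>: "cis (\<theta> d) = dir d" "a < \<theta> d" "\<theta> d < a + 2 * pi" if d: "d \<in> ends_at G v" for d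
  proof -
    have "cmod (dir d / cis a) = 1" using norm_dir[OF d] by (simp add: norm_divide)
    then have "cis (Arg2pi (dir d / cis a)) = dir d / cis a"
      using Arg2pi_eq[of "dir d / cis a"] by (simp add: cis_conv_exp)
    then show *: "cis (\<theta> d) = dir d" by (simp add: \<theta>_def flip: cis_mult)
    then have "\<theta> d \<noteq> a" using a d by (metis image_eqI)
    then show "a < \<theta> d" using Arg2pi_ge_0[of "dir d / cis a"] unfolding \<theta>_def by linarith
    show "\<theta> d < a + 2 * pi" using Arg2pi_lt_2pi[of "dir d / cis a"] unfolding \<theta>_def by linarith
  qed
  have inj\<theta>: "inj_on \<theta> (ends_at G v)" using inj \<theta>(1) unfolding inj_on_def by metis
  define S where "S = \<theta> ` ends_at G v"
  have in_S: "t \<in> S" if t: "cis t \<in> dir ` ends_at G v" "a \<le> t" "t \<le> a + 2 * pi" for t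
  proof -
    obtain d where d: "d \<in> ends_at G v" "cis t = dir d" using t(1) by blast
    have "cis t = cis (\<theta> d)" using d \<theta>(1) by simp
    moreover have "\<bar>t - \<theta> d\<bar> < 2 * pi" using \<theta>(2,3)[OF d(1)] t(2,3) by linarith
    ultimately have "t = \<theta> d" by (rule cis_eq_imp_eq)
    then show ?thesis using d(1) unfolding S_def by blast
  qed
  \<comment> \<open>The circle of radius 1/2 in the chart, pulled back to the surface; it crosses
    every radius at its midpoint.\<close>
  define \<gamma> where "\<gamma> t = inv_into U \<phi> (cis t / 2)" for t
  have half: "cis t / 2 \<in> ball 0 1" for t by (simp add: norm_divide)
  have \<gamma>: "\<gamma> t \<in> U" "\<phi> (\<gamma> t) = cis t / 2" for t
    using inv_into_into[of "cis t / 2" \<phi> U] f_inv_into_f[of "cis t / 2" \<phi> U] half[of t]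
    unfolding \<gamma>_def b(4) by blast+
  define g where "g t = c (face_at (\<gamma> t))" for t
  \<comment> \<open>The values just after and just before the radius at angle \<open>s\<close>.
    Counterclockwise of a radius lies the left side of an outgoing arrow but the right side of an
    incoming one, which is what \<open>\<tau>\<close> records.\<close>
  define R where "R s = c (side (fst (inv_into (ends_at G v) \<theta> s)) (\<tau> (inv_into (ends_at G v) \<theta> s)))" for s
  define L where "L s = c (side (fst (inv_into (ends_at G v) \<theta> s)) (- \<tau> (inv_into (ends_at G v) \<theta> s)))" for s
  have "(\<Sum>s\<in>S. R s - L s) = g (a + 2 * pi) - g a"
  proof (rule sum_jumps)
    show "finite S" unfolding S_def using finite_ends_at by blast
    show "S \<subseteq> {a<..<a + 2 * pi}" using \<theta> unfolding S_def by auto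
    show "a \<le> a + 2 * pi" by simp
  next
    fix x y assume xy: "a \<le> x" "x \<le> y" "y \<le> a + 2 * pi" "{x..y} \<inter> S = {}"
    define H where "H = {p \<in> U. \<phi> p \<in> (\<lambda>t. cis t / 2) ` {x..y}}"
    have "connectedin X H" unfolding H_def
    proof (rule chart_preimage_connectedin[OF b(1)])
      show "topological_space_class.connected ((\<lambda>t. cis t / 2) ` {x..y})"
        by (intro connected_continuous_image continuous_intros) auto
    qed (use half b(4) in auto)
    \<comment> \<open>A drawn point of the arc would lie on a radius; comparing absolute values
      makes it the midpoint, so its angle would belong to \<open>S\<close>.\<close>
    moreover have "p \<notin> Dr" if p: "p \<in> H" for p
    proof
      assume "p \<in> Dr"
      obtain t where t: "p \<in> U" "t \<in> {x..y}" "\<phi> p = cis t / 2" using p unfolding H_def by blast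
      then have "p \<noteq> pos v" using b(3) by auto
      moreover have "p \<in> Dr \<inter> U" using t(1) \<open>p \<in> Dr\<close> by blast
      ultimately obtain d where d: "d \<in> ends_at G v" "p \<in> end_cur cur d ` {0<..<len d}"
        unfolding D by blast
      then have "\<phi> p \<in> \<phi> ` end_cur cur d ` {0<..<len d}" by blast
      then obtain r where r: "cis t / 2 = of_real r * dir d" "0 < r" unfolding radius[OF d(1)] t(3) by blast
      then have "cmod (cis t / 2) = r" using norm_dir[OF d(1)] by (simp add: norm_mult)
      then have "r = 1 / 2" by (simp add: norm_divide)
      then have "cis t / 2 = of_real (1 / 2) * dir d" using r(1) by (simp only:)
      then have "cis t = dir d" by simp
      then have "t \<in> S" using in_S[of t] d(1) t(2) xy by auto
      then show False using xy(4) t(2) by blast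
    qed
    then have "H \<inter> Dr = {}" by blast
    moreover have "\<gamma> x \<in> H" "\<gamma> y \<in> H" using \<gamma> xy(2) unfolding H_def by auto
    ultimately have "face_at (\<gamma> x) = face_at (\<gamma> y)" by (rule face_at_eqI)
    then show "g x = g y" by (simp add: g_def)
  next
    fix s assume "s \<in> S"
    then obtain d where d: "d \<in> ends_at G v" "s = \<theta> d" unfolding S_def by blast
    have R: "R s = c (side (fst d) (\<tau> d))" and L: "L s = c (side (fst d) (- \<tau> d))"
      unfolding R_def L_def d(2) inv_into_f_f[OF inj\<theta> d(1)] by (rule refl)+
    obtain s0 \<rho> where st: "straight (fst d) s0 U \<phi> (of_real (\<tau> d) * dir d) \<rho>"
      and x: "\<phi> (cur (fst d) s0) = dir d / 2"
      using vertex_end_straight[OF ch d(1) inj len D] unfolding \<tau>_def by blast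
    have \<rho>: "0 < \<rho>" using st unfolding straight_def by blast
    have \<tau>: "\<tau> d = 1 \<or> \<tau> d = - 1" by (simp add: \<tau>_def)
    have dir: "dir d = cis s" using \<theta>(1)[OF d(1)] d(2) by simp
    have "continuous_on UNIV (\<lambda>t. cis (s + t) / 2)" by (intro continuous_intros) auto
    then have "isCont (\<lambda>t. cis (s + t) / 2) 0" by (simp add: continuous_on_eq_continuous_at)
    then obtain \<epsilon> where \<epsilon>: "\<epsilon> > 0" "\<And>t. \<bar>t\<bar> < \<epsilon> \<Longrightarrow> dist (cis (s + t) / 2) (cis s / 2) < \<rho>"
      unfolding continuous_at_eps_delta using \<rho> by (auto simp: dist_norm)
    have side: "g (s + t) = c (side (fst d) (\<tau> d * sgn t))" if t: "\<bar>t\<bar> < \<epsilon>" "\<bar>t\<bar> < pi" "t \<noteq> 0" for t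
    proof -
      \<comment> \<open>Relative to the straightened arrow, the position at angle
        \<open>s + t\<close> has imaginary part \<open>\<tau> d * sin t / 2\<close>, so the side is
        decided by the signs of \<open>\<tau> d\<close> and \<open>t\<close>.\<close>
      have q: "(cis (s + t) / 2 - cis s / 2) / (of_real (\<tau> d) * cis s) = of_real (\<tau> d) * (cis t - 1) / 2"
        using \<tau> by (auto simp: field_simps simp flip: cis_mult)
      have "sgn (sin t) = sgn t"
        using sin_gt_zero[of t] sin_gt_zero[of "- t"] t by (cases "t > 0") auto
      moreover have "sgn (\<tau> d) = \<tau> d" using \<tau> by auto
      ultimately have im: "sgn (Im ((cis (s + t) / 2 - cis s / 2) / (of_real (\<tau> d) * cis s))) = \<tau> d * sgn t"
        unfolding q by (simp add: sgn_mult)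
      have "face_at (\<gamma> (s + t)) = side (fst d) (\<tau> d * sgn t)"
      proof (rule straight_side[OF st])
        show "\<tau> d * sgn t = 1 \<or> \<tau> d * sgn t = - 1" using \<tau> t(3) by (auto simp: sgn_if)
        show "\<gamma> (s + t) \<in> U" by (rule \<gamma>)
        show "\<phi> (\<gamma> (s + t)) \<in> ball (\<phi> (cur (fst d) s0)) \<rho>"
          using \<epsilon>(2)[OF t(1)] unfolding \<gamma> x dir by (simp add: dist_commute)
        show "sgn (Im ((\<phi> (\<gamma> (s + t)) - \<phi> (cur (fst d) s0)) / (of_real (\<tau> d) * dir d))) = \<tau> d * sgn t"
          using im unfolding \<gamma> x dir .
      qed
      then show ?thesis by (simp add: g_def)
    qed
    have "g (s + t) = R s \<and> g (s - t) = L s" if "0 < t" "t < min \<epsilon> pi" for t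
      using side[of t] side[of "- t"] that unfolding R L by simp
    then show "\<exists>\<epsilon>>0. \<forall>t. 0 < t \<and> t < \<epsilon> \<longrightarrow> g (s + t) = R s \<and> g (s - t) = L s"
      using \<epsilon>(1) by (intro exI[of _ "min \<epsilon> pi"]) simp
  qed
  \<comment> \<open>The walk closes up, so the telescoped sum of jumps is 0.\<close>
  also have "g (a + 2 * pi) = g a" by (simp add: g_def \<gamma>_def flip: cis_mult)
  finally have "(\<Sum>s\<in>S. R s - L s) = 0" by simp
  then have "(\<Sum>d\<in>ends_at G v. R (\<theta> d) - L (\<theta> d)) = 0"
    unfolding S_def sum.reindex[OF inj\<theta>] o_def .
  moreover have "(\<Sum>d\<in>ends_at G v. R (\<theta> d) - L (\<theta> d)) =
      (\<Sum>d\<in>ends_at G v. c (side (fst d) (\<tau> d)) - c (side (fst d) (- \<tau> d)))"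
    unfolding R_def L_def by (intro sum.cong refl) (simp only: inv_into_f_f[OF inj\<theta>])
  ultimately show ?thesis by (simp only:)
qed

text \<open>The jump met when crossing an arrow counterclockwise is \<open>- x e\<close> at its tail
  and \<open>x e\<close> at its head, so the vanishing sum over arrow ends splits into outflow and
  inflow.\<close>

lemma vertex_conservation:
  fixes c :: "'s set \<Rightarrow> 'a::ab_group_add"
  assumes v: "v \<in> verts G"
  defines "x \<equiv> \<lambda>e. c (side e (- 1)) - c (side e 1)"
  shows "(\<Sum>e\<in>{e \<in> arcs G. tail G e = v}. x e) = (\<Sum>e\<in>{e \<in> arcs G. head G e = v}. x e)"
proof -
  let ?T = "{e \<in> arcs G. tail G e = v}" and ?H = "{e \<in> arcs G. head G e = v}"
  define y where "y d = (if snd d then x (fst d) else - x (fst d))" for d :: "'e \<times> bool"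
  have "ends_at G v = (\<lambda>e. (e, False)) ` ?T \<union> (\<lambda>e. (e, True)) ` ?H"
    by (auto simp: ends_at_def image_iff split: if_splits)
  then have "(\<Sum>d\<in>ends_at G v. y d) = (\<Sum>d\<in>(\<lambda>e. (e, False)) ` ?T. y d) + (\<Sum>d\<in>(\<lambda>e. (e, True)) ` ?H. y d)"
    using finite_arcs by (simp, intro sum.union_disjoint) auto
  also have "\<dots> = (\<Sum>e\<in>?T. - x e) + (\<Sum>e\<in>?H. x e)"
    by (simp add: sum.reindex inj_on_def y_def)
  also have "(\<Sum>d\<in>ends_at G v. y d) = 0"
    using sum_jumps_around_vertex[OF v, of c] by (simp add: y_def x_def if_distrib cong: if_cong)
  finally show ?thesis by (simp add: sum_negf)
qed

end

section \<open>Orthogonality of gradients and conservative flows\<close>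

section \<open>Gradients and curls\<close>

text \<open>In characteristic 0 the field is a rational vector space; take the coordinate of
  \<open>x\<close> in a basis extending \<open>{x}\<close>.\<close>

lemma additive_functional_to_rat:
  fixes x :: "'k::field_char_0"
  assumes "x \<noteq> 0"
  obtains l :: "'k \<Rightarrow> rat" where "\<And>a b. l (a - b) = l a - l b" "l x \<noteq> 0"
proof -
  interpret Q: vector_space "\<lambda>(q::rat) (y::'k). of_rat q * y"
    by unfold_locales (simp_all add: algebra_simps of_rat_add of_rat_mult)
  have x: "Q.independent {x}" using assms by simp
  define B where "B = Q.extend_basis {x}"
  have B: "Q.independent B" "x \<in> B" "Q.span B = UNIV"
    using Q.independent_extend_basis[OF x] Q.extend_basis_superset[OF x] Q.span_extend_basis[OF x]
    unfolding B_def by simp_all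
  define l where "l y = Q.representation B y x" for y
  have "l (a - b) = l a - l b" for a b
    using Q.representation_diff[OF B(1), of b a] B(3) unfolding l_def by simp
  moreover have "l x \<noteq> 0"
    using Q.representation_basis[OF B(1,2)] unfolding l_def by simp
  ultimately show thesis by (rule that)
qed

context tame_quiver
begin

text \<open>Summation by parts: pairing the gradient of \<open>a\<close> with the flow
  \<open>x\<close> gives the sum of \<open>a v\<close> times outflow minus inflow at
  \<open>v\<close>, hence 0. Since the gradient is \<open>x\<close> itself, this pairing is a sum of
  squares.\<close>

lemma gradient_eq_curl_imp_zero_ordered:
  fixes a :: "'v \<Rightarrow> 'r::linordered_idom" and c :: "'s set \<Rightarrow> 'r"
  assumes eq: "\<And>e. e \<in> arcs G \<Longrightarrow> a (tail G e) - a (head G e) = c (side e (- 1)) - c (side e 1)"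
    and e: "e \<in> arcs G"
  shows "a (tail G e) = a (head G e)"
proof -
  define x where "x e = c (side e (- 1)) - c (side e 1)" for e
  have "(\<Sum>e\<in>arcs G. a (tail G e) * x e) = (\<Sum>v\<in>verts G. \<Sum>e\<in>{e \<in> arcs G. tail G e = v}. a (tail G e) * x e)"
    by (rule sum.group[symmetric]) auto
  also have "\<dots> = (\<Sum>v\<in>verts G. a v * (\<Sum>e\<in>{e \<in> arcs G. tail G e = v}. x e))"
    by (simp add: sum_distrib_left)
  also have "\<dots> = (\<Sum>v\<in>verts G. a v * (\<Sum>e\<in>{e \<in> arcs G. head G e = v}. x e))"
    unfolding x_def by (intro sum.cong refl) (simp only: vertex_conservation)
  also have "\<dots> = (\<Sum>v\<in>verts G. \<Sum>e\<in>{e \<in> arcs G. head G e = v}. a (head G e) * x e)"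
    by (simp add: sum_distrib_left)
  also have "\<dots> = (\<Sum>e\<in>arcs G. a (head G e) * x e)"
    by (rule sum.group) auto
  finally have "(\<Sum>e\<in>arcs G. (a (tail G e) - a (head G e)) * x e) = 0"
    by (simp add: left_diff_distrib sum_subtractf)
  moreover have "(\<Sum>e\<in>arcs G. (a (tail G e) - a (head G e)) * x e) = (\<Sum>e\<in>arcs G. x e * x e)"
    by (intro sum.cong refl) (simp add: eq x_def)
  ultimately have "(\<Sum>e\<in>arcs G. x e * x e) = 0" by simp
  then have "\<forall>e\<in>arcs G. x e * x e = 0"
    by (subst (asm) sum_nonneg_eq_0_iff) auto
  then have "x e = 0" using e by simp
  then show ?thesis using eq[OF e] by (simp add: x_def)
qed

text \<open>
  Since the fields in question need not be ordered, the sum of squares argument is applied after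
  an additive map to the rational numbers.
\<close>

lemma gradient_eq_curl_imp_zero:
  fixes a :: "'v \<Rightarrow> 'k::field_char_0" and c :: "'s set \<Rightarrow> 'k"
  assumes eq: "\<And>e. e \<in> arcs G \<Longrightarrow> a (tail G e) - a (head G e) = c (side e (- 1)) - c (side e 1)"
    and e: "e \<in> arcs G"
  shows "a (tail G e) = a (head G e)"
proof (rule ccontr)
  assume "a (tail G e) \<noteq> a (head G e)"
  then have "a (tail G e) - a (head G e) \<noteq> 0" by simp
  then obtain l :: "'k \<Rightarrow> rat" where l: "\<And>x y. l (x - y) = l x - l y" "l (a (tail G e) - a (head G e)) \<noteq> 0"
    by (rule additive_functional_to_rat) blast
  have "l (a (tail G e)) = l (a (head G e))"
  proof (rule gradient_eq_curl_imp_zero_ordered[OF _ e])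
    show "l (a (tail G e)) - l (a (head G e)) = l (c (side e (- 1))) - l (c (side e 1))" if "e \<in> arcs G" for e
      using arg_cong[OF eq[OF that], of l] by (simp only: l(1))
  qed
  then show False using l by simp
qed

end

section \<open>Bilinearity, associativity and closure of the path product\<close>

section \<open>The path algebra\<close>

lemma pscale_simps [simp]:
  "pscale 0 x = 0" "pscale c 0 = 0" "pscale 1 x = x" "pscale c (pscale d x) = pscale (c * d) x"
  by (auto intro!: poly_mapping_eqI simp: lookup_pscale)

lemma pscale_add: "pscale c (x + y) = pscale c x + pscale c y"
  by (auto intro!: poly_mapping_eqI simp: lookup_pscale lookup_add algebra_simps)

lemma pscale_add_left: "pscale (c + d) x = pscale c x + pscale d x"
  by (auto intro!: poly_mapping_eqI simp: lookup_pscale lookup_add algebra_simps)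

lemma pscale_diff: "pscale c (x - y) = pscale c x - pscale c y"
  by (rule poly_mapping_eqI) (simp add: lookup_pscale lookup_minus right_diff_distrib)

lemma pscale_sum: "pscale c (sum f I) = (\<Sum>i\<in>I. pscale c (f i))"
  by (induction I rule: infinite_finite_induct) (simp_all add: pscale_add)

lemma pscale_minus_one: "pscale (- 1) x = - x"
  by (auto intro!: poly_mapping_eqI simp: lookup_pscale)

lemma keys_pscale: "Poly_Mapping.keys (pscale c x) \<subseteq> Poly_Mapping.keys x"
  by (auto simp: in_keys_iff lookup_pscale)

lemma pelem_sum: "x = (\<Sum>p\<in>Poly_Mapping.keys x. pscale (Poly_Mapping.lookup x p) (basis_elem p))"
proof (rule poly_mapping_eqI)
  fix q
  have "Poly_Mapping.lookup (\<Sum>p\<in>Poly_Mapping.keys x. pscale (Poly_Mapping.lookup x p) (basis_elem p)) q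
      = (\<Sum>p\<in>Poly_Mapping.keys x. if p = q then Poly_Mapping.lookup x p else 0)"
    by (simp add: lookup_sum lookup_pscale basis_elem_def lookup_single when_def if_distrib cong: if_cong)
  also have "\<dots> = Poly_Mapping.lookup x q"
    by (simp add: in_keys_iff)
  finally show "Poly_Mapping.lookup x q
    = Poly_Mapping.lookup (\<Sum>p\<in>Poly_Mapping.keys x. pscale (Poly_Mapping.lookup x p) (basis_elem p)) q" ..
qed

text \<open>Reduces linear statements to basis paths, one at a time. The set \<open>K\<close>
  carries along which paths may occur.\<close>

lemma pelem_induct [consumes 1, case_names zero add]:
  assumes "Poly_Mapping.keys x \<subseteq> K" "P 0"
    and step: "\<And>c p x. p \<in> K \<Longrightarrow> P x \<Longrightarrow> P (pscale c (basis_elem p) + x)"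
  shows "P x"
proof -
  have "P (\<Sum>p\<in>F. pscale (Poly_Mapping.lookup x p) (basis_elem p))" if "finite F" "F \<subseteq> K" for F
    using that by (induction F rule: finite_induct) (auto intro: assms)
  then show ?thesis using assms(1) pelem_sum[of x] finite_keys by metis
qed

lemmas pelem_induct_UNIV [case_names zero add] = pelem_induct[OF subset_UNIV]

text \<open>Cancellation can make the support of a sum smaller than the union of the supports.
  Summing over a common finite superset makes the bilinearity of the product a termwise
  matter.\<close>

lemma pmult_superset:
  assumes "finite P" "Poly_Mapping.keys x \<subseteq> P" "finite Q" "Poly_Mapping.keys y \<subseteq> Q"
  shows "pmult G x y = (\<Sum>p\<in>P. \<Sum>q\<in>Q. if phead G p = ptail q
        then Poly_Mapping.single (concat_path p q) (Poly_Mapping.lookup x p * Poly_Mapping.lookup y q) else 0)"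
proof -
  have "pmult G x y = (\<Sum>p\<in>Poly_Mapping.keys x. \<Sum>q\<in>Q. if phead G p = ptail q
        then Poly_Mapping.single (concat_path p q) (Poly_Mapping.lookup x p * Poly_Mapping.lookup y q) else 0)"
    unfolding pmult_def using assms(3,4)
    by (intro sum.cong refl sum.mono_neutral_left) (auto simp: in_keys_iff)
  also have "\<dots> = (\<Sum>p\<in>P. \<Sum>q\<in>Q. if phead G p = ptail q
        then Poly_Mapping.single (concat_path p q) (Poly_Mapping.lookup x p * Poly_Mapping.lookup y q) else 0)"
    using assms(1,2) by (intro sum.mono_neutral_left) (auto simp: in_keys_iff intro!: sum.neutral)
  finally show ?thesis .
qed

lemma pmult_add_left: "pmult G (x + x') y = pmult G x y + pmult G x' y"
proof -
  define P where "P = Poly_Mapping.keys x \<union> Poly_Mapping.keys x'"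
  have P: "finite P" "Poly_Mapping.keys x \<subseteq> P" "Poly_Mapping.keys x' \<subseteq> P" "Poly_Mapping.keys (x + x') \<subseteq> P"
    using keys_add[of x x'] by (auto simp: P_def)
  show ?thesis
    unfolding pmult_superset[OF P(1,2) finite_keys order_refl] pmult_superset[OF P(1,3) finite_keys order_refl]
      pmult_superset[OF P(1,4) finite_keys order_refl] sum.distrib[symmetric]
    by (intro sum.cong refl) (simp add: lookup_add distrib_right single_add)
qed

lemma pmult_add_right: "pmult G x (y + y') = pmult G x y + pmult G x y'"
proof -
  define P where "P = Poly_Mapping.keys y \<union> Poly_Mapping.keys y'"
  have P: "finite P" "Poly_Mapping.keys y \<subseteq> P" "Poly_Mapping.keys y' \<subseteq> P" "Poly_Mapping.keys (y + y') \<subseteq> P"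
    using keys_add[of y y'] by (auto simp: P_def)
  show ?thesis
    unfolding pmult_superset[OF finite_keys order_refl P(1,2)] pmult_superset[OF finite_keys order_refl P(1,3)]
      pmult_superset[OF finite_keys order_refl P(1,4)] sum.distrib[symmetric]
    by (intro sum.cong refl) (simp add: lookup_add distrib_left single_add)
qed

lemma pscale_single: "pscale c (Poly_Mapping.single p d) = Poly_Mapping.single p (c * d)"
  by (auto intro!: poly_mapping_eqI simp: lookup_pscale lookup_single when_def)

lemma pmult_pscale_left: "pmult G (pscale c x) y = pscale c (pmult G x y)"
  unfolding pmult_superset[OF finite_keys keys_pscale finite_keys order_refl]
  unfolding pmult_def pscale_sum
  by (intro sum.cong refl) (simp add: lookup_pscale pscale_single mult.assoc)

lemma pmult_pscale_right: "pmult G x (pscale c y) = pscale c (pmult G x y)"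
  unfolding pmult_superset[OF finite_keys order_refl finite_keys keys_pscale]
  unfolding pmult_def pscale_sum
  by (intro sum.cong refl) (simp add: lookup_pscale pscale_single mult.left_commute)

lemma pmult_zero [simp]: "pmult G 0 y = 0" "pmult G x 0 = 0"
  by (simp_all add: pmult_def)

lemma pmult_minus: "pmult G (- x) y = - pmult G x y" "pmult G x (- y) = - pmult G x y"
  by (simp_all flip: pscale_minus_one add: pmult_pscale_left pmult_pscale_right)

lemma pmult_diff: "pmult G (x - x') y = pmult G x y - pmult G x' y" "pmult G x (y - y') = pmult G x y - pmult G x y'"
  unfolding diff_conv_add_uminus pmult_add_left pmult_add_right pmult_minus by (rule refl)+

lemma pmult_sum_left: "pmult G (sum f I) y = (\<Sum>i\<in>I. pmult G (f i) y)"
  by (induction I rule: infinite_finite_induct) (simp_all add: pmult_add_left)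

lemma pmult_sum_right: "pmult G x (sum f I) = (\<Sum>i\<in>I. pmult G x (f i))"
  by (induction I rule: infinite_finite_induct) (simp_all add: pmult_add_right)

lemma pmult_basis:
  "pmult G (basis_elem p) (basis_elem q) = (if phead G p = ptail q then basis_elem (concat_path p q) else 0)"
  by (simp add: pmult_def basis_elem_def)

lemma phead_eq: "phead G (u, p) = (if p = [] then u else head G (last p))"
  by (simp add: phead_def pre_digraph.awalk_verts_conv)

lemma phead_concat: "phead G p = ptail q \<Longrightarrow> phead G (concat_path p q) = phead G q"
  by (cases p; cases q) (auto simp: phead_eq concat_path_def ptail_def)

lemma ptail_concat [simp]: "ptail (concat_path p q) = ptail p"
  by (simp add: ptail_def concat_path_def)

lemma concat_assoc: "concat_path (concat_path p q) r = concat_path p (concat_path q r)"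
  by (simp add: concat_path_def)

lemma pmult_assoc:
  fixes x y z :: "('v, 'e, 'k::field) pelem"
  shows "pmult G (pmult G x y) z = pmult G x (pmult G y z)"
proof (induction x rule: pelem_induct_UNIV)
  case (add c p x)
  have "pmult G (pmult G (basis_elem p) y) z = pmult G (basis_elem p :: ('v, 'e, 'k) pelem) (pmult G y z)"
  proof (induction y rule: pelem_induct_UNIV)
    case (add d q y)
    have "pmult G (pmult G (basis_elem p) (basis_elem q)) z
        = pmult G (basis_elem p :: ('v, 'e, 'k) pelem) (pmult G (basis_elem q) z)"
    proof (induction z rule: pelem_induct_UNIV)
      case (add e r z)
      then show ?case
        by (simp add: pmult_add_right pmult_pscale_right pmult_basis phead_concat concat_assoc)
    qed simp
    then show ?case using add by (simp add: pmult_add_right pmult_add_left pmult_pscale_right pmult_pscale_left)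
  qed simp
  then show ?case using add by (simp add: pmult_add_left pmult_pscale_left)
qed simp

lemma lookup_vertex_pmult:
  fixes x :: "('v, 'e, 'k::field) pelem"
  shows "Poly_Mapping.lookup (pmult G (basis_elem (vertex_path v)) x) r = (if ptail r = v then Poly_Mapping.lookup x r else 0)"
proof (induction x rule: pelem_induct_UNIV)
  case (add c p x)
  have "concat_path (v, []) p = p" if "v = ptail p" using that by (simp add: concat_path_def ptail_def)
  then have "Poly_Mapping.lookup (pmult G (basis_elem (vertex_path v)) (basis_elem p :: ('v, 'e, 'k) pelem)) r
      = (if ptail r = v then Poly_Mapping.lookup (basis_elem p) r else 0)"
    unfolding pmult_basis by (auto simp: vertex_path_def phead_eq basis_elem_def lookup_single when_def)
  then show ?case using add by (simp add: pmult_add_right pmult_pscale_right lookup_add lookup_pscale)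
qed simp

lemma lookup_pmult_vertex:
  fixes x :: "('v, 'e, 'k::field) pelem"
  shows "Poly_Mapping.lookup (pmult G x (basis_elem (vertex_path v))) r = (if phead G r = v then Poly_Mapping.lookup x r else 0)"
proof (induction x rule: pelem_induct_UNIV)
  case (add c p x)
  have "concat_path p (v, []) = p" by (simp add: concat_path_def)
  then have "Poly_Mapping.lookup (pmult G (basis_elem p :: ('v, 'e, 'k) pelem) (basis_elem (vertex_path v))) r
      = (if phead G r = v then Poly_Mapping.lookup (basis_elem p) r else 0)"
    unfolding pmult_basis by (auto simp: vertex_path_def ptail_def basis_elem_def lookup_single when_def)
  then show ?case using add by (simp add: pmult_add_left pmult_pscale_left lookup_add lookup_pscale)
qed simp

lemma path_algebra_zero [simp, intro]: "0 \<in> path_algebra G"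
  by (simp add: path_algebra_def)

lemma path_algebra_add [intro]: "x \<in> path_algebra G \<Longrightarrow> y \<in> path_algebra G \<Longrightarrow> x + y \<in> path_algebra G"
  unfolding path_algebra_def using keys_add[of x y] by blast

lemma path_algebra_pscale [intro]: "x \<in> path_algebra G \<Longrightarrow> pscale c x \<in> path_algebra G"
  unfolding path_algebra_def using keys_pscale[of c x] by blast

lemma path_algebra_diff [intro]: "x \<in> path_algebra G \<Longrightarrow> y \<in> path_algebra G \<Longrightarrow> x - y \<in> path_algebra G"
  using path_algebra_add[of x G "pscale (- 1) y"] path_algebra_pscale[of y G "- 1"]
  by (simp add: pscale_minus_one)

lemma path_algebra_sum [intro]: "(\<And>i. i \<in> I \<Longrightarrow> f i \<in> path_algebra G) \<Longrightarrow> sum f I \<in> path_algebra G"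
  by (induction I rule: infinite_finite_induct) auto

lemma path_algebra_basis [simp]: "basis_elem p \<in> path_algebra G \<longleftrightarrow> p \<in> paths G"
  by (simp add: path_algebra_def basis_elem_def)

lemma path_algebra_induct [consumes 1, case_names zero add]:
  assumes "x \<in> path_algebra G" "P 0"
    and step: "\<And>c p x. p \<in> paths G \<Longrightarrow> x \<in> path_algebra G \<Longrightarrow> P x \<Longrightarrow> P (pscale c (basis_elem p) + x)"
  shows "P x"
proof -
  have "Poly_Mapping.keys x \<subseteq> paths G" using assms(1) by (simp add: path_algebra_def)
  then have "x \<in> path_algebra G \<and> P x"
    by (induction x rule: pelem_induct) (auto intro!: assms path_algebra_add path_algebra_pscale)
  then show ?thesis ..
qed

context wf_digraph
begin

lemma paths_iff: "(u, p) \<in> paths G \<longleftrightarrow> u \<in> verts G \<and> set p \<subseteq> arcs G \<and> cas u p (phead G (u, p))"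
  using awlast_if_cas by (auto simp: paths_def awalk_def phead_def)

lemma vertex_path_in_paths [simp]: "vertex_path v \<in> paths G \<longleftrightarrow> v \<in> verts G"
  by (simp add: vertex_path_def paths_iff phead_eq)

lemma arrow_path_in_paths [simp]: "arrow_path G e \<in> paths G \<longleftrightarrow> e \<in> arcs G"
  by (auto simp: arrow_path_def paths_iff phead_eq)

lemma ptail_simps [simp]: "ptail (vertex_path v) = v" "ptail (arrow_path G e) = tail G e" "ptail (u, p) = u"
  by (simp_all add: ptail_def vertex_path_def arrow_path_def)

lemma phead_simps [simp]: "phead G (vertex_path v) = v" "phead G (arrow_path G e) = head G e"
  by (simp_all add: vertex_path_def arrow_path_def phead_eq)

lemma ptail_in_verts: "p \<in> paths G \<Longrightarrow> ptail p \<in> verts G"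
  by (cases p) (simp add: paths_iff)

lemma phead_in_verts: "p \<in> paths G \<Longrightarrow> phead G p \<in> verts G"
  unfolding phead_def paths_def using awlast_in_verts by (auto simp: awalk_def)

lemma Cons_in_paths: "(u, e # es) \<in> paths G \<longleftrightarrow> e \<in> arcs G \<and> u = tail G e \<and> (head G e, es) \<in> paths G"
  by (auto simp: paths_iff phead_eq)

lemma phead_Cons [simp]: "phead G (u, e # es) = phead G (head G e, es)"
  by (simp add: phead_eq)

lemma concat_in_paths: "p \<in> paths G \<Longrightarrow> q \<in> paths G \<Longrightarrow> phead G p = ptail q \<Longrightarrow> concat_path p q \<in> paths G"
proof -
  have "(u, es) \<in> paths G \<Longrightarrow> q \<in> paths G \<Longrightarrow> phead G (u, es) = ptail q \<Longrightarrow> (u, es @ snd q) \<in> paths G" for u es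
    by (induction es arbitrary: u) (auto simp: Cons_in_paths phead_eq[of _ _ "[]"], cases q, auto)
  then show "p \<in> paths G \<Longrightarrow> q \<in> paths G \<Longrightarrow> phead G p = ptail q \<Longrightarrow> concat_path p q \<in> paths G"
    by (cases p) (simp add: concat_path_def)
qed

lemma path_algebra_pmult [intro]:
  assumes "x \<in> path_algebra G" "y \<in> path_algebra G"
  shows "pmult G x y \<in> path_algebra G"
  using assms(1)
proof (induction x rule: path_algebra_induct)
  case (add c p x)
  have "pmult G (basis_elem p) y \<in> path_algebra G"
    using assms(2)
  proof (induction y rule: path_algebra_induct)
    case (add d q y)
    then show ?case
      using \<open>p \<in> paths G\<close> concat_in_paths[of p q]
      by (auto simp: pmult_add_right pmult_pscale_right pmult_basis intro!: path_algebra_add path_algebra_pscale)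
  qed simp
  then show ?case using add by (auto simp: pmult_add_left pmult_pscale_left)
qed simp

end

section \<open>Derivations with prescribed values on the arrows\<close>

section \<open>Derivations\<close>

lemma sum_fun_apply: "(\<Sum>i\<in>I. f i) x = (\<Sum>i\<in>I. f i x)"
  by (induction I rule: infinite_finite_induct) simp_all

interpretation pmap: vector_space "map_scale :: 'k::field \<Rightarrow> ('v, 'e, 'k) pmap \<Rightarrow> ('v, 'e, 'k) pmap"
  by (rule vector_space_map_scale)

abbreviation vertex_elem :: "'v \<Rightarrow> ('v, 'e, 'k::field) pelem" where
  "vertex_elem v \<equiv> basis_elem (vertex_path v)"

abbreviation arrow_elem :: "('v, 'e) pre_digraph \<Rightarrow> 'e \<Rightarrow> ('v, 'e, 'k::field) pelem" where
  "arrow_elem G e \<equiv> basis_elem (arrow_path G e)"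

lemma DerI:
  assumes "\<And>x. x \<notin> path_algebra G \<Longrightarrow> D x = 0" "\<And>x. x \<in> path_algebra G \<Longrightarrow> D x \<in> path_algebra G"
    and "\<And>x y. x \<in> path_algebra G \<Longrightarrow> y \<in> path_algebra G \<Longrightarrow> D (x + y) = D x + D y"
    and "\<And>c x. x \<in> path_algebra G \<Longrightarrow> D (pscale c x) = pscale c (D x)"
    and "\<And>x y. x \<in> path_algebra G \<Longrightarrow> y \<in> path_algebra G \<Longrightarrow>
      D (pmult G x y) = pmult G (D x) y + pmult G x (D y)"
  shows "D \<in> Der G"
  unfolding Der_def using assms by simp

context
  fixes G :: "('v, 'e) pre_digraph" and D :: "('v, 'e, 'k::field) pmap"
  assumes D: "D \<in> Der G"
begin

lemma Der_outside: "x \<notin> path_algebra G \<Longrightarrow> D x = 0"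
  and Der_closed: "x \<in> path_algebra G \<Longrightarrow> D x \<in> path_algebra G"
  and Der_add: "x \<in> path_algebra G \<Longrightarrow> y \<in> path_algebra G \<Longrightarrow> D (x + y) = D x + D y"
  and Der_pscale: "x \<in> path_algebra G \<Longrightarrow> D (pscale c x) = pscale c (D x)"
  and Der_pmult: "x \<in> path_algebra G \<Longrightarrow> y \<in> path_algebra G \<Longrightarrow>
    D (pmult G x y) = pmult G (D x) y + pmult G x (D y)"
  using D unfolding Der_def by simp_all

lemma Der_zero: "D 0 = 0"
  using Der_pscale[of 0 0] by simp

end

lemma Der_plus: "D \<in> Der G \<Longrightarrow> D' \<in> Der G \<Longrightarrow> D + D' \<in> Der G"
  by (rule DerI)
    (simp_all add: Der_outside Der_closed Der_add Der_pscale Der_pmult path_algebra_add pscale_add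
      pmult_add_left pmult_add_right algebra_simps)

lemma Der_map_scale: "D \<in> Der G \<Longrightarrow> map_scale c D \<in> Der G"
  unfolding map_scale_def
  by (rule DerI)
    (simp_all add: Der_outside Der_closed Der_add Der_pscale Der_pmult path_algebra_pscale pscale_add
      pmult_pscale_left pmult_pscale_right mult.commute)

lemma Der_zero_mem: "0 \<in> Der G"
  by (rule DerI) simp_all

lemma subspace_Der: "pmap.subspace (Der G)"
  by (intro pmap.subspaceI Der_zero_mem Der_plus Der_map_scale)

text \<open>The Peirce component between two vertex idempotents, i.e. the combinations of paths from
  \<open>v\<close> to \<open>w\<close>. Stated through the idempotents, it can be handled by
  associativity and the Leibniz rule.\<close>

definition hom_space :: "('v, 'e) pre_digraph \<Rightarrow> 'v \<Rightarrow> 'v \<Rightarrow> ('v, 'e, 'k::field) pelem set" where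
  "hom_space G v w = {x \<in> path_algebra G. pmult G (vertex_elem v) x = x \<and> pmult G x (vertex_elem w) = x}"

lemma hom_space_zero: "0 \<in> hom_space G v w"
  by (simp add: hom_space_def)

lemma hom_space_add: "x \<in> hom_space G v w \<Longrightarrow> y \<in> hom_space G v w \<Longrightarrow> x + y \<in> hom_space G v w"
  by (simp add: hom_space_def pmult_add_left pmult_add_right path_algebra_add)

lemma hom_space_pscale: "x \<in> hom_space G v w \<Longrightarrow> pscale c x \<in> hom_space G v w"
  by (simp add: hom_space_def pmult_pscale_left pmult_pscale_right path_algebra_pscale)

lemma hom_space_subset: "x \<in> hom_space G v w \<Longrightarrow> x \<in> path_algebra G"
  by (simp add: hom_space_def)

lemma hom_space_keys:
  assumes "x \<in> hom_space G v w" "r \<in> Poly_Mapping.keys x"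
  shows "ptail r = v" "phead G r = w" "r \<in> paths G"
proof -
  have "Poly_Mapping.lookup (pmult G (vertex_elem v) x) r \<noteq> 0" "Poly_Mapping.lookup (pmult G x (vertex_elem w)) r \<noteq> 0"
    using assms by (simp_all add: hom_space_def in_keys_iff)
  then show "ptail r = v" "phead G r = w"
    unfolding lookup_vertex_pmult lookup_pmult_vertex by (simp_all split: if_splits)
  show "r \<in> paths G" using assms by (auto simp: hom_space_def path_algebra_def)
qed

lemma pmult_vertex_elems: "pmult G (vertex_elem v) (vertex_elem w) = (if v = w then vertex_elem v else 0)"
  by (simp add: pmult_basis vertex_path_def phead_eq ptail_def concat_path_def)

text \<open>The Leibniz rule unfolded arrow by arrow. The start of the path can be left out: the
  first arrow determines it, and on trivial paths the value is 0 anyway.\<close>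

primrec path_der ::
  "('v, 'e) pre_digraph \<Rightarrow> ('e \<Rightarrow> ('v, 'e, 'k::field) pelem) \<Rightarrow> 'e list \<Rightarrow> ('v, 'e, 'k) pelem" where
  "path_der G \<delta> [] = 0" |
  "path_der G \<delta> (e # es) =
     pmult G (\<delta> e) (basis_elem (head G e, es)) + pmult G (arrow_elem G e) (path_der G \<delta> es)"

definition linear_extension ::
  "(('v, 'e) path \<Rightarrow> ('v, 'e, 'k::field) pelem) \<Rightarrow> ('v, 'e, 'k) pelem \<Rightarrow> ('v, 'e, 'k) pelem" where
  "linear_extension f x = (\<Sum>p\<in>Poly_Mapping.keys x. pscale (Poly_Mapping.lookup x p) (f p))"

lemma linear_extension_superset:
  assumes "finite P" "Poly_Mapping.keys x \<subseteq> P"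
  shows "linear_extension f x = (\<Sum>p\<in>P. pscale (Poly_Mapping.lookup x p) (f p))"
  unfolding linear_extension_def using assms by (intro sum.mono_neutral_left) (auto simp: in_keys_iff)

lemma linear_extension_add: "linear_extension f (x + y) = linear_extension f x + linear_extension f y"
proof -
  define P where "P = Poly_Mapping.keys x \<union> Poly_Mapping.keys y"
  have P: "finite P" "Poly_Mapping.keys x \<subseteq> P" "Poly_Mapping.keys y \<subseteq> P" "Poly_Mapping.keys (x + y) \<subseteq> P"
    using keys_add[of x y] by (auto simp: P_def)
  show ?thesis
    unfolding linear_extension_superset[OF P(1,2)] linear_extension_superset[OF P(1,3)]
      linear_extension_superset[OF P(1,4)] by (simp add: lookup_add pscale_add_left sum.distrib)
qed

lemma linear_extension_pscale: "linear_extension f (pscale c x) = pscale c (linear_extension f x)"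
  unfolding linear_extension_superset[OF finite_keys keys_pscale]
  by (simp add: linear_extension_def lookup_pscale pscale_sum)

lemma linear_extension_basis: "linear_extension f (basis_elem p) = f p"
  by (simp add: linear_extension_def basis_elem_def)

lemma linear_extension_zero: "linear_extension f 0 = 0"
  by (simp add: linear_extension_def)

context wf_digraph
begin

lemma hom_space_basis: "p \<in> paths G \<Longrightarrow> basis_elem p \<in> hom_space G (ptail p) (phead G p)"
  by (cases p) (simp add: hom_space_def pmult_basis concat_path_def vertex_path_def phead_eq)

lemma hom_space_pmult:
  assumes "x \<in> hom_space G u v" "y \<in> hom_space G v w"
  shows "pmult G x y \<in> hom_space G u w"
  using assms path_algebra_pmult[of x y] unfolding hom_space_def
  by (simp add: pmult_assoc) (simp flip: pmult_assoc)

lemma hom_space_pmult_zero: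
  assumes "x \<in> hom_space G u v" "y \<in> hom_space G v' w" "v \<noteq> v'"
  shows "pmult G x y = 0"
proof -
  have "pmult G x y = pmult G (pmult G x (vertex_elem v)) (pmult G (vertex_elem v') y)"
    using assms by (simp add: hom_space_def)
  also have "\<dots> = pmult G x (pmult G (pmult G (vertex_elem v) (vertex_elem v')) y)"
    by (simp only: pmult_assoc)
  finally show ?thesis using assms(3) by (simp add: pmult_vertex_elems)
qed

lemma basis_Cons:
  "basis_elem (tail G e, e # es) = pmult G (arrow_elem G e) (basis_elem (head G e, es))"
  by (simp add: pmult_basis) (simp add: arrow_path_def concat_path_def)

text \<open>Vertices and arrows generate the algebra: a nontrivial path is its first arrow times a
  shorter path.\<close>

lemma der_eqI:
  assumes D: "D \<in> Der G" "D' \<in> Der G"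
    and v: "\<And>v. v \<in> verts G \<Longrightarrow> D (vertex_elem v) = D' (vertex_elem v)"
    and e: "\<And>e. e \<in> arcs G \<Longrightarrow> D (arrow_elem G e) = D' (arrow_elem G e)"
  shows "D = D'"
proof
  fix x
  have path: "D (basis_elem (u, p)) = D' (basis_elem (u, p))" if "(u, p) \<in> paths G" for u p
    using that
  proof (induction p arbitrary: u)
    case Nil
    then show ?case using v[of u] vertex_path_in_paths[of u] unfolding vertex_path_def by simp
  next
    case (Cons a p)
    then have a: "a \<in> arcs G" "u = tail G a" "(head G a, p) \<in> paths G" by (simp_all add: Cons_in_paths)
    then show ?case
      using Cons.IH[OF a(3)] e[OF a(1)] D by (simp add: basis_Cons Der_pmult)
  qed
  show "D x = D' x"
  proof (cases "x \<in> path_algebra G")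
    case True
    then show ?thesis
    proof (induction x rule: path_algebra_induct)
      case zero
      then show ?case using D by (simp add: Der_zero)
    next
      case (add c p x)
      then show ?case
        using D path[of "fst p" "snd p"] by (simp add: Der_add Der_pscale path_algebra_pscale)
    qed
  qed (use D in \<open>simp add: Der_outside\<close>)
qed

context
  fixes \<delta> :: "'b \<Rightarrow> ('a, 'b, 'k::field) pelem"
  assumes \<delta>: "\<And>e. e \<in> arcs G \<Longrightarrow> \<delta> e \<in> hom_space G (tail G e) (head G e)"
begin

lemma path_der_hom_space: "(u, p) \<in> paths G \<Longrightarrow> path_der G \<delta> p \<in> hom_space G u (phead G (u, p))"
proof (induction p arbitrary: u)
  case (Cons a p)
  then have a: "a \<in> arcs G" "u = tail G a" "(head G a, p) \<in> paths G" by (simp_all add: Cons_in_paths)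
  have "basis_elem (head G a, p) \<in> hom_space G (head G a) (phead G (head G a, p))"
    using hom_space_basis[OF a(3)] by simp
  then have "pmult G (\<delta> a) (basis_elem (head G a, p)) \<in> hom_space G u (phead G (head G a, p))"
    using \<delta>[OF a(1)] a(2) by (auto intro: hom_space_pmult)
  moreover have "arrow_elem G a \<in> hom_space G u (head G a)"
    using hom_space_basis[of "arrow_path G a"] a by simp
  then have "pmult G (arrow_elem G a) (path_der G \<delta> p) \<in> hom_space G u (phead G (head G a, p))"
    using Cons.IH[OF a(3)] by (rule hom_space_pmult)
  ultimately show ?case by (simp add: hom_space_add)
qed (simp add: hom_space_zero)

text \<open>Unfolding from the first arrow agrees with splitting the path anywhere else, which is
  the Leibniz rule for composable paths.\<close>

lemma path_der_append:
  assumes "(u, p) \<in> paths G" "(phead G (u, p), q) \<in> paths G"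
  shows "path_der G \<delta> (p @ q) =
    pmult G (path_der G \<delta> p) (basis_elem (phead G (u, p), q)) + pmult G (basis_elem (u, p)) (path_der G \<delta> q)"
  using assms
proof (induction p arbitrary: u)
  case Nil
  then show ?case
    using path_der_hom_space[of u q] by (simp add: phead_eq[of G u "[]"] hom_space_def vertex_path_def)
next
  case (Cons a p)
  then have a: "a \<in> arcs G" "u = tail G a" "(head G a, p) \<in> paths G" by (simp_all add: Cons_in_paths)
  have "(basis_elem (head G a, p @ q) :: ('a, 'b, 'k) pelem) = pmult G (basis_elem (head G a, p)) (basis_elem (phead G (head G a, p), q))"
    by (simp add: pmult_basis) (simp add: concat_path_def)
  then show ?case
    using Cons.IH[OF a(3)] Cons.prems(2) a(2)
    by (simp add: basis_Cons pmult_add_left pmult_add_right pmult_assoc add.assoc)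
qed

text \<open>Extend \<open>path_der\<close> linearly. Pairs of paths that do not compose have to be
  checked too: there both Leibniz terms vanish because the value at a path lies in the Peirce
  component of that path. This is where \<delta> must respect tails and heads.\<close>

lemma arrow_der_exists:
  "\<exists>D\<in>Der G. (\<forall>v\<in>verts G. D (vertex_elem v) = 0) \<and> (\<forall>e\<in>arcs G. D (arrow_elem G e) = \<delta> e)"
proof
  define f where "f p = path_der G \<delta> (snd p)" for p :: "('a, 'b) path"
  define D where "D x = (if x \<in> path_algebra G then linear_extension f x else 0)" for x
  have f: "f p \<in> hom_space G (ptail p) (phead G p)" if "p \<in> paths G" for p
    using path_der_hom_space[of "fst p" "snd p"] that by (simp add: f_def ptail_def)
  have leibniz: "linear_extension f (pmult G (basis_elem p) (basis_elem q))
      = pmult G (f p) (basis_elem q) + pmult G (basis_elem p) (f q)"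
    if p: "p \<in> paths G" and q: "q \<in> paths G" for p q
  proof (cases "phead G p = ptail q")
    case True
    then have "(phead G (fst p, snd p), snd q) \<in> paths G" using q by (simp add: ptail_def)
    then show ?thesis
      using path_der_append[of "fst p" "snd p" "snd q"] p True
      by (simp add: pmult_basis linear_extension_basis f_def concat_path_def ptail_def)
  next
    case False
    then show ?thesis
      using hom_space_pmult_zero[OF f[OF p] hom_space_basis[OF q]] hom_space_pmult_zero[OF hom_space_basis[OF p] f[OF q]]
      by (simp add: pmult_basis linear_extension_zero)
  qed
  have leibniz': "linear_extension f (pmult G x y) = pmult G (linear_extension f x) y + pmult G x (linear_extension f y)"
    if x: "x \<in> path_algebra G" and y: "y \<in> path_algebra G" for x y
    using x
  proof (induction x rule: path_algebra_induct)
    case (add c p x)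
    have "linear_extension f (pmult G (basis_elem p) y) = pmult G (f p) y + pmult G (basis_elem p) (linear_extension f y)"
      using y
    proof (induction y rule: path_algebra_induct)
      case (add d q y)
      then show ?case
        using leibniz[OF \<open>p \<in> paths G\<close> \<open>q \<in> paths G\<close>]
        by (simp add: pmult_add_right pmult_pscale_right linear_extension_add linear_extension_pscale
            linear_extension_basis pscale_add algebra_simps)
    qed (simp add: linear_extension_zero)
    then show ?case
      using add by (simp add: pmult_add_left pmult_pscale_left linear_extension_add linear_extension_pscale
          linear_extension_basis pscale_add algebra_simps)
  qed (simp add: linear_extension_zero)
  have closed: "linear_extension f x \<in> path_algebra G" if "x \<in> path_algebra G" for x
    unfolding linear_extension_def using that
    by (intro path_algebra_sum path_algebra_pscale hom_space_subset[OF f]) (auto simp: path_algebra_def)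
  show "D \<in> Der G"
    by (rule DerI)
      (simp_all add: D_def path_algebra_add path_algebra_pscale path_algebra_pmult closed linear_extension_add
        linear_extension_pscale leibniz')
  have "D (vertex_elem v) = 0" if "v \<in> verts G" for v
    using that by (simp add: D_def linear_extension_basis f_def vertex_path_def[of v])
  moreover have "D (arrow_elem G e) = \<delta> e" if "e \<in> arcs G" for e
  proof -
    have "pmult G (\<delta> e) (basis_elem (head G e, [])) = \<delta> e"
      using \<delta>[OF that] by (simp add: hom_space_def vertex_path_def)
    then show ?thesis using that by (simp add: D_def linear_extension_basis f_def) (simp add: arrow_path_def)
  qed
  ultimately show "(\<forall>v\<in>verts G. D (vertex_elem v) = 0) \<and> (\<forall>e\<in>arcs G. D (arrow_elem G e) = \<delta> e)" by blast
qed

text \<open>Existence and, by \<open>der_eqI\<close>, uniqueness license the definite description in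
  \<open>arrow_der\<close>.\<close>

lemma arrow_der:
  shows arrow_der_in_Der: "arrow_der G \<delta> \<in> Der G"
    and arrow_der_vertex: "v \<in> verts G \<Longrightarrow> arrow_der G \<delta> (vertex_elem v) = 0"
    and arrow_der_arrow: "e \<in> arcs G \<Longrightarrow> arrow_der G \<delta> (arrow_elem G e) = \<delta> e"
proof -
  let ?P = "\<lambda>D. D \<in> Der G \<and> (\<forall>v\<in>verts G. D (vertex_elem v) = 0) \<and> (\<forall>e\<in>arcs G. D (arrow_elem G e) = \<delta> e)"
  have "\<exists>!D. ?P D"
  proof (rule ex_ex1I)
    show "\<exists>D. ?P D" using arrow_der_exists by blast
    show "D = D'" if "?P D" "?P D'" for D D' using that by (intro der_eqI) simp_all
  qed
  then have "?P (arrow_der G \<delta>)" unfolding arrow_der_def by (rule theI')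
  then show "arrow_der G \<delta> \<in> Der G" "v \<in> verts G \<Longrightarrow> arrow_der G \<delta> (vertex_elem v) = 0"
    "e \<in> arcs G \<Longrightarrow> arrow_der G \<delta> (arrow_elem G e) = \<delta> e" by simp_all
qed

end

end

section \<open>Gradients as inner derivations, and the reduction to derivations killing the
  vertices\<close>

section \<open>Inner and diagonal derivations\<close>

lemma coset_eq_iff:
  fixes scl :: "'k::field \<Rightarrow> 'a::ab_group_add \<Rightarrow> 'a"
  assumes "module scl" "module.subspace scl U"
  shows "coset U x = coset U y \<longleftrightarrow> x - y \<in> U"
proof
  interpret module scl by fact
  show "x - y \<in> U" if "coset U x = coset U y"
  proof -
    have "x \<in> coset U x" using subspace_0[OF assms(2)] by (simp add: coset_def)
    then show ?thesis unfolding that by (simp add: coset_def)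
  qed
  show "coset U x = coset U y" if xy: "x - y \<in> U"
  proof -
    have "z - x \<in> U \<longleftrightarrow> z - y \<in> U" for z
      using subspace_add[OF assms(2) _ xy, of "z - x"] subspace_diff[OF assms(2) _ xy, of "z - y"] by auto
    then show ?thesis by (simp add: coset_def)
  qed
qed

definition diag_der :: "('v, 'e) pre_digraph \<Rightarrow> ('e \<Rightarrow> 'k) \<Rightarrow> ('v, 'e, 'k::field) pmap" where
  "diag_der G w = arrow_der G (\<lambda>p. pscale (w p) (arrow_elem G p))"

context wf_digraph
begin

lemma inner_der_in_Der:
  assumes "a \<in> path_algebra G"
  shows "inner_der G a \<in> Der G"
  using assms
  by (intro DerI)
    (simp_all add: inner_der_def path_algebra_add path_algebra_pscale path_algebra_pmult path_algebra_diff
      pmult_add_left pmult_add_right pmult_pscale_left pmult_pscale_right pmult_diff pmult_assoc pscale_diff)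

lemma subspace_InDer: "pmap.subspace (InDer G)"
proof (rule pmap.subspaceI)
  show "0 \<in> InDer G"
    unfolding InDer_def by (rule image_eqI[of _ _ 0]) (auto simp: inner_der_def)
next
  fix D D' :: "('a, 'b, 'k::field) pmap" assume "D \<in> InDer G" "D' \<in> InDer G"
  then obtain a b where "a \<in> path_algebra G" "b \<in> path_algebra G" "D = inner_der G a" "D' = inner_der G b"
    unfolding InDer_def by blast
  then show "D + D' \<in> InDer G"
    unfolding InDer_def
    by (intro image_eqI[of _ _ "a + b"] path_algebra_add)
      (auto simp: inner_der_def pmult_add_left pmult_add_right)
next
  fix c and D :: "('a, 'b, 'k::field) pmap" assume "D \<in> InDer G"
  then obtain a where a: "a \<in> path_algebra G" "D = inner_der G a"
    unfolding InDer_def by blast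
  then show "map_scale c D \<in> InDer G"
    unfolding InDer_def
    by (intro image_eqI[of _ _ "pscale c a"] path_algebra_pscale)
      (auto simp: inner_der_def map_scale_def pmult_pscale_left pmult_pscale_right pscale_diff)
qed

text \<open>Apply \<open>D\<close> to an arrow multiplied by its end idempotents: these are
  constants for \<open>D\<close>, so they also fix the image.\<close>

lemma der_arrow_in_hom_space:
  assumes D: "D \<in> Der G" and v: "\<And>v. v \<in> verts G \<Longrightarrow> D (vertex_elem v) = 0" and e: "e \<in> arcs G"
  shows "D (arrow_elem G e) \<in> hom_space G (tail G e) (head G e)"
proof -
  let ?x = "arrow_elem G e :: ('a, 'b, 'c) pelem"
  have x: "?x \<in> path_algebra G" using e by simp
  have "?x \<in> hom_space G (tail G e) (head G e)" using hom_space_basis[of "arrow_path G e"] e by simp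
  then have l: "pmult G (vertex_elem (tail G e)) ?x = ?x" and r: "pmult G ?x (vertex_elem (head G e)) = ?x"
    by (simp_all add: hom_space_def)
  have "D (pmult G (vertex_elem (tail G e)) ?x) = pmult G (vertex_elem (tail G e)) (D ?x)"
    using v[of "tail G e"] e x by (subst Der_pmult[OF D]) simp_all
  moreover have "D (pmult G ?x (vertex_elem (head G e))) = pmult G (D ?x) (vertex_elem (head G e))"
    using v[of "head G e"] e x by (subst Der_pmult[OF D]) simp_all
  ultimately show ?thesis unfolding l r using Der_closed[OF D x] by (simp add: hom_space_def)
qed

lemma arrow_elem_in_hom_space: "e \<in> arcs G \<Longrightarrow> arrow_elem G e \<in> hom_space G (tail G e) (head G e)"
  using hom_space_basis[of "arrow_path G e"] by simp

lemma vertex_pmult_hom_space: "x \<in> hom_space G u w \<Longrightarrow> v \<in> verts G \<Longrightarrow>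
    pmult G (vertex_elem v) x = (if u = v then x else 0)"
  using hom_space_pmult_zero[OF hom_space_basis[of "vertex_path v"]] by (auto simp: hom_space_def)

lemma hom_space_pmult_vertex: "x \<in> hom_space G u w \<Longrightarrow> v \<in> verts G \<Longrightarrow>
    pmult G x (vertex_elem v) = (if w = v then x else 0)"
  using hom_space_pmult_zero[OF _ hom_space_basis[of "vertex_path v"]] by (auto simp: hom_space_def)

lemma diag_der_in_Der: "diag_der G w \<in> Der G"
  and diag_der_vertex: "v \<in> verts G \<Longrightarrow> diag_der G w (vertex_elem v) = 0"
  and diag_der_arrow: "e \<in> arcs G \<Longrightarrow> diag_der G w (arrow_elem G e) = pscale (w e) (arrow_elem G e)"
  unfolding diag_der_def
  by (rule arrow_der; simp add: hom_space_pscale arrow_elem_in_hom_space)+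

lemma diag_der_eq_iff: "diag_der G w = diag_der G w' \<longleftrightarrow> (\<forall>e\<in>arcs G. w e = w' e)"
proof
  assume "diag_der G w = diag_der G w'"
  then have "Poly_Mapping.lookup (pscale (w e) (arrow_elem G e)) (arrow_path G e)
      = Poly_Mapping.lookup (pscale (w' e) (arrow_elem G e)) (arrow_path G e)" if "e \<in> arcs G" for e
    using that by (metis diag_der_arrow)
  then show "\<forall>e\<in>arcs G. w e = w' e" by (simp add: lookup_pscale basis_elem_def)
qed (auto intro!: der_eqI simp: diag_der_in_Der diag_der_vertex diag_der_arrow)

lemma diag_der_add: "diag_der G w + diag_der G w' = diag_der G (\<lambda>e. w e + w' e)"
  by (rule der_eqI) (simp_all add: Der_plus diag_der_in_Der diag_der_vertex diag_der_arrow pscale_add_left)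

lemma diag_der_scale: "map_scale c (diag_der G w) = diag_der G (\<lambda>e. c * w e)"
  by (rule der_eqI) (simp_all add: Der_map_scale diag_der_in_Der diag_der_vertex diag_der_arrow,
      simp_all add: map_scale_def diag_der_vertex diag_der_arrow)

lemma diag_der_zero: "diag_der G (\<lambda>e. 0) = 0"
  by (rule der_eqI) (simp_all add: diag_der_in_Der Der_zero_mem diag_der_vertex diag_der_arrow)

lemma diag_der_sum: "(\<Sum>i\<in>I. map_scale (k i) (diag_der G (w i))) = diag_der G (\<lambda>e. \<Sum>i\<in>I. k i * w i e)"
  by (induction I rule: infinite_finite_induct) (simp_all add: diag_der_zero diag_der_scale diag_der_add)

lemma D_arrow_in_hom_space:
  assumes "r \<in> paths G" "parallel G r (arrow_path G p)" "e \<in> arcs G"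
  shows "(if e = p then basis_elem r else 0) \<in> hom_space G (tail G e) (head G e)"
  using assms hom_space_basis[of r] by (auto simp: parallel_def hom_space_zero)

lemma D_arrow:
  assumes "r \<in> paths G" "parallel G r (arrow_path G p)"
  shows D_arrow_in_Der: "D_arrow G p r \<in> Der G"
    and D_arrow_vertex: "v \<in> verts G \<Longrightarrow> D_arrow G p r (vertex_elem v) = 0"
    and D_arrow_arrow: "e \<in> arcs G \<Longrightarrow> D_arrow G p r (arrow_elem G e) = (if e = p then basis_elem r else 0)"
  unfolding D_arrow_def by (rule arrow_der; (rule D_arrow_in_hom_space[OF assms])?; assumption?)+

lemma D_arrow_diag:
  assumes "p \<in> arcs G"
  shows "D_arrow G p (arrow_path G p) = diag_der G (\<lambda>e. of_bool (e = p))"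
proof -
  have p: "arrow_path G p \<in> paths G" "parallel G (arrow_path G p) (arrow_path G p)"
    using assms by (simp_all add: parallel_def)
  show ?thesis
    by (rule der_eqI) (auto simp: D_arrow[OF p] diag_der_in_Der diag_der_vertex diag_der_arrow)
qed

text \<open>The weight is the gradient of the indicator function of \<open>v\<close>; the commutator
  fixes the sign convention tail minus head.\<close>

lemma D_vertex_diag:
  assumes "v \<in> verts G"
  shows "(D_vertex G v :: ('a, 'b, 'k::field) pmap) = diag_der G (\<lambda>e. of_bool (tail G e = v) - of_bool (head G e = v))"
  (is "?D = ?D'")
proof (rule der_eqI)
  show "?D \<in> Der G" using assms unfolding D_vertex_def by (intro inner_der_in_Der) simp
  show "?D (vertex_elem w) = ?D' (vertex_elem w)" if "w \<in> verts G" for w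
    using that by (simp add: D_vertex_def inner_der_def diag_der_vertex pmult_vertex_elems)
  show "?D (arrow_elem G e) = ?D' (arrow_elem G e)" if e: "e \<in> arcs G" for e
  proof -
    let ?x = "arrow_elem G e :: ('a, 'b, 'k) pelem"
    have "pmult G (vertex_elem v) ?x = (if tail G e = v then ?x else 0)"
      by (rule vertex_pmult_hom_space[OF arrow_elem_in_hom_space[OF e] assms])
    moreover have "pmult G ?x (vertex_elem v) = (if head G e = v then ?x else 0)"
      by (rule hom_space_pmult_vertex[OF arrow_elem_in_hom_space[OF e] assms])
    ultimately show ?thesis
      using e by (simp add: D_vertex_def inner_der_def diag_der_arrow pscale_minus_one)
  qed
qed (rule diag_der_in_Der)

lemma span_V_subset_InDer: "span_V G \<subseteq> InDer G"
  unfolding span_V_def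
  by (rule pmap.span_minimal[OF _ subspace_InDer]) (auto simp: D_vertex_def InDer_def)

end

context fin_digraph
begin

lemma diag_der_in_span_E: "diag_der G w \<in> span_E G"
proof -
  have "diag_der G w = (\<Sum>p\<in>arcs G. map_scale (w p) (D_arrow G p (arrow_path G p)))"
    by (simp add: D_arrow_diag diag_der_sum diag_der_eq_iff)
  also have "\<dots> \<in> span_E G"
    unfolding span_E_def by (intro pmap.span_sum pmap.span_scale pmap.span_base) blast
  finally show ?thesis .
qed

lemma span_E_eq: "span_E G = range (diag_der G)"
proof
  show "span_E G \<subseteq> range (diag_der G)"
    unfolding span_E_def
  proof (rule pmap.span_minimal)
    show "pmap.subspace (range (diag_der G))"
    proof (rule pmap.subspaceI)
      show "0 \<in> range (diag_der G)" using diag_der_zero by (metis rangeI)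
    qed (auto simp: diag_der_add diag_der_scale)
  qed (auto simp: D_arrow_diag)
qed (use diag_der_in_span_E in auto)

lemma span_V_eq: "span_V G = range (\<lambda>a :: 'a \<Rightarrow> 'k::field. diag_der G (\<lambda>e. a (tail G e) - a (head G e)))" (is "?L = ?R")
proof
  show "?L \<subseteq> ?R"
    unfolding span_V_def
  proof (rule pmap.span_minimal)
    show "pmap.subspace (?R)"
    proof (rule pmap.subspaceI)
      show "0 \<in> ?R"
        by (rule range_eqI[of _ _ "\<lambda>v. 0"]) (simp add: diag_der_zero)
    next
      fix x y :: "('a, 'b, 'k) pmap" assume "x \<in> ?R"
        "y \<in> ?R"
      then obtain a b where "x = diag_der G (\<lambda>e. a (tail G e) - a (head G e))"
        "y = diag_der G (\<lambda>e. b (tail G e) - b (head G e))" by blast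
      then show "x + y \<in> ?R"
        by (intro range_eqI[of _ _ "\<lambda>v. a v + b v"]) (simp add: diag_der_add algebra_simps)
    next
      fix c and x :: "('a, 'b, 'k) pmap" assume "x \<in> ?R"
      then obtain a where "x = diag_der G (\<lambda>e. a (tail G e) - a (head G e))" by blast
      then show "map_scale c x \<in> ?R"
        by (intro range_eqI[of _ _ "\<lambda>v. c * a v"]) (simp add: diag_der_scale algebra_simps)
    qed
    show "D_vertex G ` verts G \<subseteq> ?R"
      by (auto simp: D_vertex_diag)
  qed
  have "diag_der G (\<lambda>e. a (tail G e) - a (head G e)) \<in> span_V G" for a :: "'a \<Rightarrow> 'k"
  proof -
    have "diag_der G (\<lambda>e. a (tail G e) - a (head G e)) = (\<Sum>v\<in>verts G. map_scale (a v) (D_vertex G v))"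
      by (simp add: D_vertex_diag diag_der_sum diag_der_eq_iff right_diff_distrib sum_subtractf)
    also have "\<dots> \<in> span_V G"
      unfolding span_V_def by (intro pmap.span_sum pmap.span_scale pmap.span_base) blast
    finally show ?thesis .
  qed
  then show "?R \<subseteq> span_V G" by blast
qed

lemma sum_vertex_elems: "x \<in> path_algebra G \<Longrightarrow> (\<Sum>v\<in>verts G. pmult G x (vertex_elem v)) = x"
proof (rule poly_mapping_eqI)
  fix r assume x: "x \<in> path_algebra G"
  have "Poly_Mapping.lookup (\<Sum>v\<in>verts G. pmult G x (vertex_elem v)) r
      = (if phead G r \<in> verts G then Poly_Mapping.lookup x r else 0)"
    by (simp add: lookup_sum lookup_pmult_vertex)
  also have "\<dots> = Poly_Mapping.lookup x r"
    using phead_in_verts[of r] x by (auto simp: path_algebra_def in_keys_iff)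
  finally show "Poly_Mapping.lookup (\<Sum>v\<in>verts G. pmult G x (vertex_elem v)) r = Poly_Mapping.lookup x r" .
qed

text \<open>The vertices span a separable subalgebra, on which derivations are inner. The element
  \<open>a\<close> is built from its separability idempotent, the sum of the tensors of each vertex
  with itself.\<close>

lemma der_inner_on_vertices:
  assumes D: "D \<in> Der G"
  obtains a where "a \<in> path_algebra G" "\<And>v. v \<in> verts G \<Longrightarrow> inner_der G a (vertex_elem v) = D (vertex_elem v)"
proof -
  define a where "a = (\<Sum>w\<in>verts G. pmult G (D (vertex_elem w)) (vertex_elem w))"
  have c: "D (vertex_elem w) \<in> path_algebra G" if "w \<in> verts G" for w using Der_closed[OF D] that by simp
  have "inner_der G a (vertex_elem v) = D (vertex_elem v)" if v: "v \<in> verts G" for v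
  proof -
    let ?e = "vertex_elem :: 'a \<Rightarrow> ('a, 'b, 'c) pelem"
    have l: "pmult G a (?e v) = pmult G (D (?e v)) (?e v)"
    proof -
      have "pmult G a (?e v) = (\<Sum>w\<in>verts G. if v = w then pmult G (D (?e v)) (?e v) else 0)"
        unfolding a_def pmult_sum_left by (intro sum.cong refl) (simp add: pmult_assoc pmult_vertex_elems)
      then show ?thesis using v by simp
    qed
    \<comment> \<open>Differentiate the orthogonality relation of the idempotents \<open>v\<close>
      and \<open>w\<close> and multiply by \<open>w\<close> from the right. Summed over
      \<open>w\<close>, the last term gives \<open>D (?e v)\<close>, as the vertices add up to the
      unit.\<close>
    have "pmult G (?e v) (pmult G (D (?e w)) (?e w))
        = (if v = w then pmult G (D (?e v)) (?e v) else 0) - pmult G (D (?e v)) (?e w)" if w: "w \<in> verts G" for w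
    proof -
      have "D (pmult G (?e v) (?e w)) = pmult G (D (?e v)) (?e w) + pmult G (?e v) (D (?e w))"
        using v w by (intro Der_pmult[OF D]) simp_all
      then have "pmult G (?e v) (D (?e w)) = D (pmult G (?e v) (?e w)) - pmult G (D (?e v)) (?e w)"
        by (simp add: algebra_simps)
      then have "pmult G (?e v) (pmult G (D (?e w)) (?e w))
          = pmult G (D (pmult G (?e v) (?e w))) (?e w) - pmult G (pmult G (D (?e v)) (?e w)) (?e w)"
        by (simp add: pmult_diff flip: pmult_assoc)
      then show ?thesis by (simp add: pmult_assoc pmult_vertex_elems Der_zero[OF D])
    qed
    then have "pmult G (?e v) a
        = (\<Sum>w\<in>verts G. (if v = w then pmult G (D (?e v)) (?e v) else 0) - pmult G (D (?e v)) (?e w))"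
      unfolding a_def pmult_sum_right by (intro sum.cong refl)
    also have "\<dots> = pmult G (D (?e v)) (?e v) - D (?e v)"
      using v sum_vertex_elems[OF c[OF v]] by (simp add: sum_subtractf)
    finally show ?thesis using v l by (simp add: inner_der_def)
  qed
  moreover have "a \<in> path_algebra G"
    unfolding a_def using c by (intro path_algebra_sum path_algebra_pmult) simp_all
  ultimately show thesis by (rule that[rotated])
qed

text \<open>A nontrivial closed walk contains a cycle. Acyclicity enters the argument only
  here.\<close>

lemma acyclic_closed_path:
  assumes "acyclic_quiver G" "r \<in> paths G" "phead G r = ptail r"
  shows "r = vertex_path (ptail r)"
proof -
  obtain u p v where r: "r = (u, p)" "awalk u p v" using assms(2) by (auto simp: paths_def)
  then have "v = u" using assms(3) by (auto simp: phead_def ptail_def)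
  then have "p = []" using closed_w_imp_cycle[of p] assms(1) r(2) by (auto simp: acyclic_quiver_def closed_w_def)
  then show ?thesis by (simp add: r ptail_def vertex_path_def)
qed

text \<open>An element commuting with all vertices involves closed paths only. These are trivial, so
  the element is a combination of vertices.\<close>

lemma inner_der_in_span_V:
  assumes acyclic: "acyclic_quiver G" and a: "a \<in> path_algebra G"
    and v: "\<And>v. v \<in> verts G \<Longrightarrow> inner_der G a (vertex_elem v) = 0"
  shows "inner_der G a \<in> span_V G"
proof -
  define k where "k v = Poly_Mapping.lookup a (vertex_path v)" for v
  have keys: "r = vertex_path (ptail r)" "ptail r \<in> verts G" if r: "r \<in> Poly_Mapping.keys a" for r
  proof -
    have p: "r \<in> paths G" using a r by (auto simp: path_algebra_def)
    \<comment> \<open>In the commutator with the head of \<open>r\<close>, the coefficient of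
      \<open>a\<close> at \<open>r\<close> survives unless \<open>r\<close> also starts
      there.\<close>
    have "Poly_Mapping.lookup (inner_der G a (vertex_elem (phead G r))) r = 0"
      using v[OF phead_in_verts[OF p]] by simp
    then have "phead G r = ptail r"
      using r phead_in_verts[OF p]
      by (simp add: inner_der_def lookup_minus lookup_vertex_pmult lookup_pmult_vertex in_keys_iff split: if_splits)
    then show "r = vertex_path (ptail r)" using acyclic_closed_path[OF acyclic p] by simp
    show "ptail r \<in> verts G" by (rule ptail_in_verts[OF p])
  qed
  have "a = (\<Sum>v\<in>verts G. pscale (k v) (vertex_elem v))"
  proof (rule poly_mapping_eqI)
    fix r :: "('a, 'b) path"
    have vp: "vertex_path v = r \<longleftrightarrow> v = ptail r \<and> r = vertex_path (ptail r)" for v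
      by (auto simp: vertex_path_def ptail_def)
    have "Poly_Mapping.lookup (\<Sum>v\<in>verts G. pscale (k v) (vertex_elem v)) r
        = (\<Sum>v\<in>verts G. if v = ptail r then if r = vertex_path (ptail r) then k v else 0 else 0)"
      unfolding lookup_sum
      by (intro sum.cong refl) (simp add: lookup_pscale basis_elem_def lookup_single when_def vp)
    also have "\<dots> = Poly_Mapping.lookup a r"
      using keys[of r] by (auto simp: k_def in_keys_iff)
    finally show "Poly_Mapping.lookup a r = Poly_Mapping.lookup (\<Sum>v\<in>verts G. pscale (k v) (vertex_elem v)) r" ..
  qed
  then have "inner_der G a = (\<Sum>v\<in>verts G. map_scale (k v) (D_vertex G v))"
    by (intro ext) (simp add: inner_der_def sum_fun_apply map_scale_def D_vertex_def pmult_sum_left pmult_sum_right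
        pmult_pscale_left pmult_pscale_right sum_subtractf[symmetric] pscale_diff)
  also have "\<dots> \<in> span_V G"
    unfolding span_V_def by (intro pmap.span_sum pmap.span_scale pmap.span_base) blast
  finally show ?thesis .
qed

end

section \<open>Coordinates modulo inner derivations\<close>

section \<open>The basis\<close>

context
  fixes scl :: "'k::field \<Rightarrow> 'a::ab_group_add \<Rightarrow> 'a" and U :: "'a set"
  assumes scl: "module scl" and U: "module.subspace scl U"
begin

lemma quotient_basisI:
  assumes "\<And>i. i \<in> I \<Longrightarrow> b i \<in> W"
    and "\<And>J c i. finite J \<Longrightarrow> J \<subseteq> I \<Longrightarrow> (\<Sum>i\<in>J. scl (c i) (b i)) \<in> U \<Longrightarrow> i \<in> J \<Longrightarrow> c i = 0"
    and "\<And>w. w \<in> W \<Longrightarrow> \<exists>J c. finite J \<and> J \<subseteq> I \<and> w - (\<Sum>i\<in>J. scl (c i) (b i)) \<in> U"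
  shows "quotient_basis scl W U I b"
  unfolding quotient_basis_def
proof (intro conjI allI impI ballI)
  fix J c i assume "finite J \<and> J \<subseteq> I \<and> coset U (\<Sum>i\<in>J. scl (c i) (b i)) = coset U 0" "i \<in> J"
  then show "c i = 0" using assms(2)[of J c i] by (simp add: coset_eq_iff[OF scl U])
next
  fix C assume "C \<in> quotient_space W U"
  then obtain w where w: "w \<in> W" "C = coset U w" unfolding quotient_space_def by (elim imageE)
  show "\<exists>J c. finite J \<and> J \<subseteq> I \<and> C = coset U (\<Sum>i\<in>J. scl (c i) (b i))"
    using assms(3)[OF w(1)] unfolding w(2) coset_eq_iff[OF scl U] .
qed (rule assms(1))

lemma quotient_basisD:
  assumes "quotient_basis scl W U I b"
  shows "i \<in> I \<Longrightarrow> b i \<in> W"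
    and "finite J \<Longrightarrow> J \<subseteq> I \<Longrightarrow> (\<Sum>i\<in>J. scl (c i) (b i)) \<in> U \<Longrightarrow> i \<in> J \<Longrightarrow> c i = 0"
    and "w \<in> W \<Longrightarrow> \<exists>J c. finite J \<and> J \<subseteq> I \<and> w - (\<Sum>i\<in>J. scl (c i) (b i)) \<in> U"
proof -
  note qb = assms[unfolded quotient_basis_def]
  show "i \<in> I \<Longrightarrow> b i \<in> W" by (rule bspec[OF conjunct1[OF qb]])
  have "\<forall>i\<in>J. c i = 0" if "finite J" "J \<subseteq> I" "(\<Sum>i\<in>J. scl (c i) (b i)) \<in> U"
    using conjunct1[OF conjunct2[OF qb], THEN spec, of J, THEN spec, of c] that
    by (simp add: coset_eq_iff[OF scl U])
  then show "finite J \<Longrightarrow> J \<subseteq> I \<Longrightarrow> (\<Sum>i\<in>J. scl (c i) (b i)) \<in> U \<Longrightarrow> i \<in> J \<Longrightarrow> c i = 0" by simp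
  have "\<exists>J c. finite J \<and> J \<subseteq> I \<and> coset U w = coset U (\<Sum>i\<in>J. scl (c i) (b i))" if "w \<in> W"
    using that by (intro bspec[OF conjunct2[OF conjunct2[OF qb]]]) (simp add: quotient_space_def)
  then show "w \<in> W \<Longrightarrow> \<exists>J c. finite J \<and> J \<subseteq> I \<and> w - (\<Sum>i\<in>J. scl (c i) (b i)) \<in> U"
    unfolding coset_eq_iff[OF scl U] .
qed

end

lemma sum_Plus_parts:
  assumes "finite J" "J \<subseteq> I1 <+> (I2 <+> I3)"
  defines "J1 \<equiv> Inl -` J" and "J2 \<equiv> Inl -` Inr -` J" and "J3 \<equiv> Inr -` Inr -` J"
  shows "J = J1 <+> (J2 <+> J3)" "finite J1" "finite J2" "finite J3" "J1 \<subseteq> I1" "J2 \<subseteq> I2" "J3 \<subseteq> I3"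
    and "sum g J = (\<Sum>i\<in>J1. g (Inl i)) + ((\<Sum>i\<in>J2. g (Inr (Inl i))) + (\<Sum>i\<in>J3. g (Inr (Inr i))))"
proof -
  show J: "J = J1 <+> (J2 <+> J3)"
    unfolding J1_def J2_def J3_def
  proof (intro equalityI subsetI)
    fix x assume "x \<in> J"
    then show "x \<in> Inl -` J <+> (Inl -` Inr -` J <+> Inr -` Inr -` J)"
      by (cases x; cases "projr x") auto
  qed auto
  have i: "inj Inl" "inj Inr" by simp_all
  show f: "finite J1" "finite J2" "finite J3"
    unfolding J1_def J2_def J3_def by (intro finite_vimageI assms i; simp)+
  show "J1 \<subseteq> I1" "J2 \<subseteq> I2" "J3 \<subseteq> I3" using assms(2) unfolding J1_def J2_def J3_def by auto
  show "sum g J = (\<Sum>i\<in>J1. g (Inl i)) + ((\<Sum>i\<in>J2. g (Inr (Inl i))) + (\<Sum>i\<in>J3. g (Inr (Inr i))))"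
    unfolding J using f by (simp add: sum.Plus)
qed

context wf_digraph
begin

text \<open>Different pairs contribute to different coefficients, so the coordinates can be read off
  from the values on arrows. Both independence and spanning rest on this.\<close>

lemma sum_D_arrow:
  fixes c :: "'b \<times> ('a, 'b) path \<Rightarrow> 'k::field"
  assumes J: "finite J" "J \<subseteq> almost_oriented_cycles G"
  defines "S \<equiv> \<Sum>j\<in>J. map_scale (c j) ((\<lambda>(p, r). D_arrow G p r) j)"
  shows "S \<in> Der G" "v \<in> verts G \<Longrightarrow> S (vertex_elem v) = 0"
    and "e \<in> arcs G \<Longrightarrow> Poly_Mapping.lookup (S (arrow_elem G e)) r = (if (e, r) \<in> J then c (e, r) else 0)"
proof -
  have AL: "r \<in> paths G" "parallel G r (arrow_path G p)" if "(p, r) \<in> J" for p r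
    using that J(2) by (auto simp: almost_oriented_cycles_def)
  show "S \<in> Der G"
    unfolding S_def
    by (intro pmap.subspace_sum[OF subspace_Der] Der_map_scale) (auto intro: D_arrow_in_Der AL)
  show "S (vertex_elem v) = 0" if "v \<in> verts G"
    unfolding S_def sum_fun_apply
  proof (intro sum.neutral ballI)
    fix j assume j: "j \<in> J"
    obtain p s where ps: "j = (p, s)" by (cases j)
    show "map_scale (c j) ((\<lambda>(p, r). D_arrow G p r) j) (vertex_elem v) = 0"
      by (simp add: ps map_scale_def D_arrow_vertex[OF AL[OF j[unfolded ps]] that])
  qed
  show "Poly_Mapping.lookup (S (arrow_elem G e)) r = (if (e, r) \<in> J then c (e, r) else 0)" if e: "e \<in> arcs G"
  proof -
    have "Poly_Mapping.lookup (S (arrow_elem G e)) r = (\<Sum>j\<in>J. if j = (e, r) then c j else 0)"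
      unfolding S_def sum_fun_apply lookup_sum
    proof (intro sum.cong refl)
      fix j assume j: "j \<in> J"
      obtain p s where ps: "j = (p, s)" by (cases j)
      show "Poly_Mapping.lookup (map_scale (c j) ((\<lambda>(p, r). D_arrow G p r) j) (arrow_elem G e)) r
          = (if j = (e, r) then c j else 0)"
        unfolding ps prod.case map_scale_def lookup_pscale D_arrow_arrow[OF AL[OF j[unfolded ps]] e]
        by (auto simp: basis_elem_def lookup_single when_def)
    qed
    then show ?thesis using J(1) by simp
  qed
qed

end

context tame_quiver
begin

lemma D_face_diag:
  assumes "f \<in> faces G X pos cur"
  shows "D_face G A pos cur f = diag_der G (\<lambda>e. of_bool (f = side e (- 1)) - of_bool (f = side e 1))"
proof -
  have "D_face G A pos cur f
      = diag_der G (\<lambda>e. of_bool (on_right G A pos cur f e) - of_bool (on_left G A pos cur f e))"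
    unfolding D_face_def diag_der_def ..
  also have "\<dots> = diag_der G (\<lambda>e. of_bool (f = side e (- 1)) - of_bool (f = side e 1))"
    unfolding diag_der_eq_iff using on_right_iff[OF _ assms] on_left_iff[OF _ assms] by simp
  finally show ?thesis .
qed

text \<open>The change of \<open>c\<close> from left to right across each arrow, i.e. the coboundary
  of \<open>c\<close> on the dual graph, carried over to the arrows.\<close>

definition curl :: "('s set \<Rightarrow> 'k) \<Rightarrow> ('v, 'e, 'k::field) pmap" where
  "curl c = diag_der G (\<lambda>e. c (side e (- 1)) - c (side e 1))"

lemma sum_D_face:
  fixes k :: "'i \<Rightarrow> 'k::field"
  assumes bij: "bij_betw f I (faces G X pos cur)" and "finite I" "J \<subseteq> I"
  shows "(\<Sum>i\<in>J. map_scale (k i) (D_face G A pos cur (f i)))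
    = curl (\<lambda>F. if inv_into I f F \<in> J then k (inv_into I f F) else 0)"
proof -
  have f: "f i \<in> faces G X pos cur" if "i \<in> J" for i using bij that assms(3) by (auto simp: bij_betw_def)
  have J: "finite J" using assms(2,3) finite_subset by blast
  have pick: "(\<Sum>i\<in>J. k i * of_bool (f i = F)) = (if inv_into I f F \<in> J then k (inv_into I f F) else 0)"
    if F: "F \<in> faces G X pos cur" for F
  proof -
    have "f i = F \<longleftrightarrow> i = inv_into I f F" if "i \<in> I" for i
      using bij F that bij_betw_inv_into_left[OF bij] bij_betw_inv_into_right[OF bij] by metis
    then have "(\<Sum>i\<in>J. k i * of_bool (f i = F)) = (\<Sum>i\<in>J. if i = inv_into I f F then k i else 0)"
      using assms(3) by (intro sum.cong refl) auto
    then show ?thesis using J by simp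
  qed
  have "(\<Sum>i\<in>J. map_scale (k i) (D_face G A pos cur (f i)))
      = (\<Sum>i\<in>J. map_scale (k i) (diag_der G (\<lambda>e. of_bool (f i = side e (- 1)) - of_bool (f i = side e 1))))"
    by (intro sum.cong refl) (simp add: D_face_diag f)
  also have "\<dots> = diag_der G (\<lambda>e. (\<Sum>i\<in>J. k i * of_bool (f i = side e (- 1))) - (\<Sum>i\<in>J. k i * of_bool (f i = side e 1)))"
    unfolding diag_der_sum by (simp only: right_diff_distrib sum_subtractf)
  also have "\<dots> = curl (\<lambda>F. if inv_into I f F \<in> J then k (inv_into I f F) else 0)"
    unfolding curl_def diag_der_eq_iff by (simp add: pick side_in_faces)
  finally show ?thesis .
qed

lemma span_F_subset: "span_F G X A pos cur \<subseteq> range (curl :: _ \<Rightarrow> ('v, 'e, 'k::field) pmap)" (is "_ \<subseteq> ?R")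
  unfolding span_F_def
proof (rule pmap.span_minimal)
  show "pmap.subspace ?R"
  proof (rule pmap.subspaceI)
    show "0 \<in> ?R" by (rule range_eqI[of _ _ "\<lambda>F. 0"]) (simp add: curl_def diag_der_zero)
  next
    fix x y :: "('v, 'e, 'k) pmap" assume "x \<in> ?R" "y \<in> ?R"
    then obtain a b where "x = curl a" "y = curl b" by blast
    then show "x + y \<in> ?R"
      by (intro range_eqI[of _ _ "\<lambda>F. a F + b F"]) (simp add: curl_def diag_der_add algebra_simps)
  next
    fix c and x :: "('v, 'e, 'k) pmap" assume "x \<in> ?R"
    then obtain a where "x = curl a" by blast
    then show "map_scale c x \<in> ?R"
      by (intro range_eqI[of _ _ "\<lambda>F. c * a F"]) (simp add: curl_def diag_der_scale algebra_simps)
  qed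
  have "D_face G A pos cur f = curl (\<lambda>F. of_bool (f = F))" if "f \<in> faces G X pos cur" for f
    using D_face_diag[OF that] by (simp add: curl_def)
  then show "D_face G A pos cur ` faces G X pos cur \<subseteq> ?R" by blast
qed

text \<open>The sum of all face derivations vanishes, so one of them may be dropped.\<close>

lemma span_F_omit_first:
  fixes x :: "('v, 'e, 'k::field) pmap" and n :: nat
  assumes bij: "bij_betw f {1..n} (faces G X pos cur)" and x: "x \<in> span_F G X A pos cur"
  shows "\<exists>k. x = (\<Sum>i\<in>{2..n}. map_scale (k i) (D_face G A pos cur (f i)))"
proof -
  obtain c where c: "x = curl c" using x span_F_subset by blast
  \<comment> \<open>A constant added to \<open>c\<close> does not change \<open>curl c\<close>; this
    normalisation gives the first face the coefficient 0.\<close>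
  define k where "k i = c (f i) - c (f 1)" for i
  have val: "(if inv_into {1..n} f F \<in> {2..n} then k (inv_into {1..n} f F) else 0) = c F - c (f 1)"
    if F: "F \<in> faces G X pos cur" for F
  proof -
    have i: "inv_into {1..n} f F \<in> {1..n}" "f (inv_into {1..n} f F) = F"
      using bij F bij_betw_inv_into_right[OF bij F] inv_into_into[of F f "{1..n}"] by (auto simp: bij_betw_def)
    show ?thesis
    proof (cases "inv_into {1..n} f F = 1")
      case True
      then show ?thesis using i(2) by simp
    next
      case False
      then show ?thesis using i by (simp add: k_def)
    qed
  qed
  have "(\<Sum>i\<in>{2..n}. map_scale (k i) (D_face G A pos cur (f i)))
      = curl (\<lambda>F. if inv_into {1..n} f F \<in> {2..n} then k (inv_into {1..n} f F) else 0)"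
    by (rule sum_D_face[OF bij]) auto
  also have "\<dots> = x"
    unfolding c curl_def diag_der_eq_iff using val side_in_faces by simp
  finally show ?thesis by metis
qed

text \<open>A curl that is also a gradient vanishes, so \<open>c\<close> has no jumps and is
  constant, with the value 0 that it takes at the omitted face.\<close>

lemma D_face_independent:
  fixes k :: "nat \<Rightarrow> 'k::field_char_0"
  assumes bij: "bij_betw f {1..n} (faces G X pos cur)" and J: "J \<subseteq> {2..n}"
    and V: "(\<Sum>i\<in>J. map_scale (k i) (D_face G A pos cur (f i))) \<in> span_V G"
    and i: "i \<in> J"
  shows "k i = 0"
proof -
  define c where "c F = (if inv_into {1..n} f F \<in> J then k (inv_into {1..n} f F) else 0)" for F
  have "(\<Sum>i\<in>J. map_scale (k i) (D_face G A pos cur (f i))) = curl c"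
    unfolding c_def by (rule sum_D_face[OF bij]) (use J in auto)
  then have "curl c \<in> span_V G" using V by simp
  then obtain a where "curl c = diag_der G (\<lambda>e. a (tail G e) - a (head G e))"
    unfolding span_V_eq by (elim rangeE)
  then have eq: "a (tail G e) - a (head G e) = c (side e (- 1)) - c (side e 1)" if "e \<in> arcs G" for e
    using that unfolding curl_def diag_der_eq_iff by simp
  have sides: "c (side e 1) = c (side e (- 1))" if "e \<in> arcs G" for e
    using gradient_eq_curl_imp_zero[of a c, OF eq that] eq[OF that] by simp
  have "i \<in> {2..n}" using i J by blast
  then have i1: "i \<in> {1..n}" "1 \<in> {1..n}" by auto
  have "f i \<in> faces G X pos cur" "f 1 \<in> faces G X pos cur"
    using bspec[OF bij_betwE[OF bij]] i1 by simp_all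
  from face_function_constant[of c, OF sides this] have "c (f i) = c (f 1)" .
  moreover have "inv_into {1..n} f (f i) = i" "inv_into {1..n} f (f 1) = 1"
    using bij_betw_inv_into_left[OF bij] i1 by simp_all
  \<comment> \<open>Indices start at 2, so \<open>c (f 1)\<close> is the default 0.\<close>
  moreover have "1 \<notin> J" using J by auto
  ultimately show ?thesis using i by (simp add: c_def)
qed

lemma D_face_in_span_E: "f \<in> faces G X pos cur \<Longrightarrow> D_face G A pos cur f \<in> span_E G"
  by (simp only: D_face_diag diag_der_in_span_E)

lemma span_E_properties:
  fixes x :: "('v, 'e, 'k::field) pmap"
  assumes "x \<in> span_E G"
  shows "x \<in> Der G" "v \<in> verts G \<Longrightarrow> x (vertex_elem v) = 0"
    and "e \<in> arcs G \<Longrightarrow> r \<noteq> arrow_path G e \<Longrightarrow> Poly_Mapping.lookup (x (arrow_elem G e)) r = 0"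
proof -
  obtain w where w: "x = diag_der G w" using assms unfolding span_E_eq by (elim rangeE)
  show "x \<in> Der G" "v \<in> verts G \<Longrightarrow> x (vertex_elem v) = 0"
    unfolding w by (simp_all add: diag_der_in_Der diag_der_vertex)
  show "Poly_Mapping.lookup (x (arrow_elem G e)) r = 0" if "e \<in> arcs G" "r \<noteq> arrow_path G e"
    unfolding w diag_der_arrow[OF that(1)] lookup_pscale
    unfolding basis_elem_def lookup_single when_def using that(2) by simp
qed

lemma span_V_subset_span_E: "span_V G \<subseteq> span_E G"
  unfolding span_V_eq span_E_eq by (intro image_subsetI rangeI)

abbreviation span_VF :: "('v, 'e, 'k::field) pmap set" where
  "span_VF \<equiv> {x + y | x y. x \<in> span_V G \<and> y \<in> span_F G X A pos cur}"

lemma subspaces: "pmap.subspace (span_V G)" "pmap.subspace (span_E G)" "pmap.subspace (span_F G X A pos cur)"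
  "pmap.subspace span_VF"
proof -
  show s: "pmap.subspace (span_V G)" "pmap.subspace (span_E G)" "pmap.subspace (span_F G X A pos cur)"
    unfolding span_V_def span_E_def span_F_def by (rule pmap.subspace_span)+
  show "pmap.subspace span_VF" by (rule pmap.subspace_sums[OF s(1,3)])
qed

context
  fixes f :: "nat \<Rightarrow> 's set" and n :: nat and Bstar :: "('v, 'e, 'k::field_char_0) pmap set"
  assumes acyclic: "acyclic_quiver G"
    and bij: "bij_betw f {1..n} (faces G X pos cur)"
    and basis: "quotient_basis map_scale (span_E G) span_VF Bstar id"
begin

lemmas basisD = quotient_basisD[OF pmap.module_axioms subspaces(4) basis, unfolded id_apply]

text \<open>The order of elimination matters. The sum lies in \<open>span_V\<close>, so its
  off-diagonal coefficients vanish, which gives \<open>c1\<close>. Then \<open>S3\<close> lies in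
  \<open>span_VF\<close>, and the basis property of the quotient gives \<open>c3\<close>. Only now
  is \<open>S2\<close> alone in \<open>span_V\<close>, as \<open>D_face_independent\<close>
  requires.\<close>

lemma HH1_independent:
  fixes c1 :: "'e \<times> ('v, 'e) path \<Rightarrow> 'k" and c2 :: "nat \<Rightarrow> 'k" and c3 :: "('v, 'e, 'k) pmap \<Rightarrow> 'k"
  assumes J: "finite J1" "J1 \<subseteq> almost_oriented_cycles G" "J2 \<subseteq> {2..n}" "finite J3" "J3 \<subseteq> Bstar"
  defines "S1 \<equiv> \<Sum>j\<in>J1. map_scale (c1 j) ((\<lambda>(p, r). D_arrow G p r) j)"
    and "S2 \<equiv> \<Sum>i\<in>J2. map_scale (c2 i) (D_face G A pos cur (f i))"
    and "S3 \<equiv> \<Sum>b\<in>J3. map_scale (c3 b) b"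
  assumes inner: "S1 + (S2 + S3) \<in> InDer G"
  shows "j \<in> J1 \<Longrightarrow> c1 j = 0" "i \<in> J2 \<Longrightarrow> c2 i = 0" "b \<in> J3 \<Longrightarrow> c3 b = 0"
proof -
  have f: "f i \<in> faces G X pos cur" if "i \<in> J2" for i
    using bspec[OF bij_betwE[OF bij], of i] subsetD[OF J(3) that] by simp
  note S1 = sum_D_arrow[OF J(1,2), where c = c1, folded S1_def]
  have S2F: "S2 \<in> span_F G X A pos cur"
    unfolding S2_def span_F_def by (intro pmap.span_sum pmap.span_scale pmap.span_base imageI f)
  have S2: "S2 \<in> span_E G"
    unfolding S2_def
    by (intro pmap.subspace_sum[OF subspaces(2)] pmap.subspace_scale[OF subspaces(2)] D_face_in_span_E f)
  have S3: "S3 \<in> span_E G"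
    unfolding S3_def
    by (intro pmap.subspace_sum[OF subspaces(2)] pmap.subspace_scale[OF subspaces(2)] basisD(1) subsetD[OF J(5)])
  obtain a where a: "a \<in> path_algebra G" "S1 + (S2 + S3) = inner_der G a"
    using inner unfolding InDer_def by (elim imageE)
  have "inner_der G a (vertex_elem v) = 0" if "v \<in> verts G" for v
    unfolding a(2)[symmetric] plus_fun_apply S1(2)[OF that] span_E_properties(2)[OF S2 that]
      span_E_properties(2)[OF S3 that] by simp
  then have V: "S1 + (S2 + S3) \<in> span_V G"
    unfolding a(2) by (rule inner_der_in_span_V[OF acyclic a(1)])
  show c1: "c1 j = 0" if "j \<in> J1" for j
  proof -
    obtain p r where j: "j = (p, r)" by (cases j)
    have p: "p \<in> arcs G" "r \<noteq> arrow_path G p"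
      using subsetD[OF J(2) that] unfolding j almost_oriented_cycles_def by simp_all
    have "Poly_Mapping.lookup ((S1 + (S2 + S3)) (arrow_elem G p)) r = 0"
      by (rule span_E_properties(3)[OF subsetD[OF span_V_subset_span_E V] p])
    then show ?thesis
      unfolding plus_fun_apply lookup_add S1(3)[OF p(1)] span_E_properties(3)[OF S2 p] span_E_properties(3)[OF S3 p]
      using that by (simp add: j)
  qed
  then have "S1 = 0" unfolding S1_def by (intro sum.neutral ballI) simp
  then have V': "S2 + S3 \<in> span_V G" using V by simp
  have "S3 = (S2 + S3) + (- S2)" by simp
  then have "S3 \<in> span_VF" using V' pmap.subspace_neg[OF subspaces(3) S2F] by blast
  then show c3: "c3 b = 0" if "b \<in> J3" for b
    unfolding S3_def using that by (rule basisD(2)[OF J(4,5)])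
  then have "S3 = 0" unfolding S3_def by (intro sum.neutral ballI) simp
  then have "S2 \<in> span_V G" using V' by simp
  then show "c2 i = 0" if "i \<in> J2" for i
    unfolding S2_def using that by (rule D_face_independent[OF bij J(3)])
qed

lemma HH1_spanning:
  assumes E: "E \<in> Der G"
  shows "\<exists>J1 c1 c2 J3 c3. finite J1 \<and> J1 \<subseteq> almost_oriented_cycles G \<and> finite J3 \<and> J3 \<subseteq> Bstar \<and>
    E - ((\<Sum>j\<in>J1. map_scale (c1 j) ((\<lambda>(p, r). D_arrow G p r) j)) +
      ((\<Sum>i\<in>{2..n}. map_scale (c2 i) (D_face G A pos cur (f i))) + (\<Sum>b\<in>J3. map_scale (c3 b) b)))
    \<in> InDer G"
proof -
  obtain a where a: "a \<in> path_algebra G" "\<And>v. v \<in> verts G \<Longrightarrow> inner_der G a (vertex_elem v) = E (vertex_elem v)"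
    by (rule der_inner_on_vertices[OF E]) (rule that)
  define E0 where "E0 = E - inner_der G a"
  have E0: "E0 \<in> Der G"
    unfolding E0_def by (rule pmap.subspace_diff[OF subspace_Der E inner_der_in_Der[OF a(1)]])
  have E0v: "E0 (vertex_elem v) = 0" if "v \<in> verts G" for v by (simp add: E0_def a(2)[OF that])
  note hom = der_arrow_in_hom_space[OF E0 E0v]
  \<comment> \<open>The off-diagonal support of \<open>E0\<close>: the paths other than
    \<open>p\<close> itself that occur in the image of an arrow \<open>p\<close>. They are parallel
    to \<open>p\<close> because \<open>E0\<close> kills the vertices.\<close>
  define J1 where "J1 = (SIGMA p:arcs G. Poly_Mapping.keys (E0 (arrow_elem G p)) - {arrow_path G p})"
  define c1 where "c1 j = Poly_Mapping.lookup (E0 (arrow_elem G (fst j))) (snd j)" for j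
  define w where "w p = Poly_Mapping.lookup (E0 (arrow_elem G p)) (arrow_path G p)" for p
  define S1 where "S1 = (\<Sum>j\<in>J1. map_scale (c1 j) ((\<lambda>(p, r). D_arrow G p r) j))"
  have J1: "finite J1" "J1 \<subseteq> almost_oriented_cycles G"
  proof -
    show "finite J1" unfolding J1_def by (intro finite_SigmaI finite_arcs finite_Diff finite_keys)
    show "J1 \<subseteq> almost_oriented_cycles G"
    proof
      fix j assume "j \<in> J1"
      then obtain p r where j: "j = (p, r)" "p \<in> arcs G" "r \<in> Poly_Mapping.keys (E0 (arrow_elem G p))" "r \<noteq> arrow_path G p"
        unfolding J1_def by blast
      show "j \<in> almost_oriented_cycles G"
        using hom_space_keys[OF hom[OF _ j(2)] j(3)] j(2,4)
        unfolding j(1) almost_oriented_cycles_def parallel_def by simp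
    qed
  qed
  note S1 = sum_D_arrow[OF J1, where c = c1, folded S1_def]
  have E0_eq: "E0 = S1 + diag_der G w"
  proof (rule der_eqI[OF E0])
    show "S1 + diag_der G w \<in> Der G" by (intro Der_plus S1(1) diag_der_in_Der)
    show "E0 (vertex_elem v) = (S1 + diag_der G w) (vertex_elem v)" if "v \<in> verts G" for v
      by (simp add: E0v[OF that] S1(2)[OF that] diag_der_vertex[OF that])
    show "E0 (arrow_elem G e) = (S1 + diag_der G w) (arrow_elem G e)" if e: "e \<in> arcs G" for e
    proof (rule poly_mapping_eqI)
      fix r
      have "Poly_Mapping.lookup (diag_der G w (arrow_elem G e)) r = (if r = arrow_path G e then w e else 0)"
        unfolding diag_der_arrow[OF e] lookup_pscale
        unfolding basis_elem_def lookup_single when_def by simp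
      moreover have "(e, r) \<in> J1 \<longleftrightarrow> Poly_Mapping.lookup (E0 (arrow_elem G e)) r \<noteq> 0 \<and> r \<noteq> arrow_path G e"
        using e by (simp add: J1_def in_keys_iff)
      ultimately show "Poly_Mapping.lookup (E0 (arrow_elem G e)) r
          = Poly_Mapping.lookup ((S1 + diag_der G w) (arrow_elem G e)) r"
        unfolding plus_fun_apply lookup_add S1(3)[OF e, of r] by (simp add: c1_def w_def)
    qed
  qed
  obtain J3 c3 where J3: "finite J3" "J3 \<subseteq> Bstar" "diag_der G w - (\<Sum>b\<in>J3. map_scale (c3 b) b) \<in> span_VF"
    using basisD(3)[OF diag_der_in_span_E, of w] by (elim exE conjE)
  from J3(3) obtain x y where xy: "diag_der G w - (\<Sum>b\<in>J3. map_scale (c3 b) b) = x + y"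
    "x \<in> span_V G" "y \<in> span_F G X A pos cur" by (elim CollectE exE conjE)
  obtain k where k: "y = (\<Sum>i\<in>{2..n}. map_scale (k i) (D_face G A pos cur (f i)))"
    using span_F_omit_first[OF bij xy(3)] by (elim exE)
  \<comment> \<open>The component \<open>x\<close> in \<open>span_V\<close> is itself inner and
    joins the inner derivation subtracted at the beginning.\<close>
  have "E - (S1 + (y + (\<Sum>b\<in>J3. map_scale (c3 b) b))) = inner_der G a + x"
    using E0_eq xy(1) by (simp add: E0_def algebra_simps)
  also have "\<dots> \<in> InDer G"
    unfolding InDer_def
    by (rule pmap.subspace_add[OF subspace_InDer[unfolded InDer_def]])
      (use a(1) subsetD[OF span_V_subset_InDer xy(2)] in \<open>simp_all add: InDer_def\<close>)
  finally show ?thesis unfolding S1_def k using J1 J3(1,2) by blast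
qed

lemma HH1_basis:
  "HH1_basis G (almost_oriented_cycles G <+> ({2..n} <+> Bstar))
    (case_sum (\<lambda>(p, r). D_arrow G p r) (case_sum (\<lambda>i. D_face G A pos cur (f i)) id))"
  (is "HH1_basis G ?I ?D")
  unfolding HH1_basis_def
proof (rule quotient_basisI[OF pmap.module_axioms subspace_InDer])
  fix i assume i: "i \<in> ?I"
  show "?D i \<in> Der G"
  proof (cases i)
    case (Inl j)
    then have j: "j \<in> almost_oriented_cycles G" using i by auto
    obtain p r where "j = (p, r)" by (cases j)
    with j Inl show ?thesis using D_arrow_in_Der[of r p] by (simp add: almost_oriented_cycles_def)
  next
    case (Inr k)
    show ?thesis
    proof (cases k)
      case (Inl j)
      then have "j \<in> {1..n}" using i Inr by auto
      then have "f j \<in> faces G X pos cur" by (rule bspec[OF bij_betwE[OF bij]])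
      then show ?thesis using Inl Inr by (simp add: span_E_properties(1) D_face_in_span_E)
    next
      case inr: (Inr b)
      then have "b \<in> Bstar" using i Inr by auto
      then show ?thesis using inr Inr span_E_properties(1)[OF basisD(1)] by simp
    qed
  qed
next
  fix J and c :: "_ \<Rightarrow> 'k" and i
  assume J: "finite J" "J \<subseteq> ?I" and inner: "(\<Sum>i\<in>J. map_scale (c i) (?D i)) \<in> InDer G" and i: "i \<in> J"
  note parts = sum_Plus_parts[OF J]
  note indep = HH1_independent[OF parts(2,5,6,4,7), of "\<lambda>j. c (Inl j)" "\<lambda>i. c (Inr (Inl i))" "\<lambda>b. c (Inr (Inr b))"]
  have "(\<Sum>j\<in>Inl -` J. map_scale (c (Inl j)) ((\<lambda>(p, r). D_arrow G p r) j)) +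
      ((\<Sum>i\<in>Inl -` Inr -` J. map_scale (c (Inr (Inl i))) (D_face G A pos cur (f i))) +
       (\<Sum>b\<in>Inr -` Inr -` J. map_scale (c (Inr (Inr b))) b)) \<in> InDer G"
    using inner unfolding parts(8) by simp
  note indep = indep[OF this]
  show "c i = 0"
  proof (cases i)
    case (Inl j)
    then show ?thesis using indep(1)[of j] i by simp
  next
    case (Inr k)
    then show ?thesis using indep(2) indep(3) i by (cases k) simp_all
  qed
next
  fix E :: "('v, 'e, 'k) pmap" assume "E \<in> Der G"
  from HH1_spanning[OF this] obtain J1 c1 c2 J3 c3 where
    J: "finite J1" "J1 \<subseteq> almost_oriented_cycles G" "finite J3" "J3 \<subseteq> Bstar"
    and E: "E - ((\<Sum>j\<in>J1. map_scale (c1 j) ((\<lambda>(p, r). D_arrow G p r) j)) +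
      ((\<Sum>i\<in>{2..n}. map_scale (c2 i) (D_face G A pos cur (f i))) + (\<Sum>b\<in>J3. map_scale (c3 b) b))) \<in> InDer G"
    by (elim exE conjE)
  have "finite (J1 <+> ({2..n} <+> J3))" "J1 <+> ({2..n} <+> J3) \<subseteq> ?I" using J by auto
  moreover have "E - (\<Sum>i\<in>J1 <+> ({2..n} <+> J3). map_scale (case_sum c1 (case_sum c2 c3) i) (?D i)) \<in> InDer G"
    using E J(1,3) by (simp add: sum.Plus)
  ultimately show "\<exists>J c. finite J \<and> J \<subseteq> ?I \<and> E - (\<Sum>i\<in>J. map_scale (c i) (?D i)) \<in> InDer G" by blast
qed

end

end

theorem theorem5p5:
  fixes G :: "('v, 'e) pre_digraph"
    and X :: "'s topology"
    and A :: "('s set \<times> ('s \<Rightarrow> complex)) set"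
    and pos :: "'v \<Rightarrow> 's"
    and cur :: "'e \<Rightarrow> real \<Rightarrow> 's"
    and f :: "nat \<Rightarrow> 's set"
    and \<gamma>\<^sub>2 :: nat
    and Bstar :: "('v, 'e, 'k::field_char_0) pmap set"
  assumes "fin_digraph G"
    and "Digraph_Component.connected G"
    and "acyclic_quiver G"
    and "closed_oriented_surface X A"
    and "tame_embedding G X A pos cur"
    and "genus_minimal G X"
    and "\<gamma>\<^sub>2 = card (faces G X pos cur)"
    and "bij_betw f {1..\<gamma>\<^sub>2} (faces G X pos cur)"
    and "quotient_basis map_scale
           (span_E G) {x + y | x y. x \<in> span_V G \<and> y \<in> span_F G X A pos cur} Bstar id"
  shows "HH1_basis G
           (almost_oriented_cycles G <+> ({2..\<gamma>\<^sub>2} <+> Bstar))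
           (case_sum (\<lambda>(p, r). D_arrow G p r)
             (case_sum (\<lambda>i. D_face G A pos cur (f i)) id))"
proof -
  interpret fin_digraph G by fact
  interpret tame_quiver X A G pos cur by unfold_locales fact+
  show ?thesis by (rule HH1_basis[OF assms(3,8,9)])
qed

end
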